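(* Let $\lambda\in(0,1)$. For $k\in\mathbb N$ sufficiently large the following inequality holds: $$\gamma^\lambda(1,k)>\inf_{\rho\in(0,1]}\gamma^\lambda(\rho,k).$$
   Context: Vectors and lattice. Let $\mathrm w_1=(1,0)$, $\mathrm w_2=(\frac12,\frac{\sqrt3}2)$. For $\rho\in(0,1]$ put $\mathcal L_1^-=\{\xi_1\mathrm w_1+\xi_2\mathrm w_2\colon\xi_1,\xi_2\in\mathbb Z,\ \xi_1<0\}$, $\mathcal L_\rho^+=\{\xi_1\mathrm w_1+\xi_2\mathrm w_2\colon\xi_1,\xi_2\in\rho\mathbb Z,\ \xi_1\ge0\}$, $\mathcal L_\rho=\mathcal L_1^-\cup\mathcal L_\rho^+$. Triangulation $\mathcal T_\rho$ and nearest neighbours. A triangulation of $\mathcal L_\rho$ (partition of $\mathbb R^2$, up to boundaries, into open nonempty triangles with vertices in $\mathcal L_\rho$) has the Delaunay property if the circumcircle of each triangle contains no points of $\mathcal L_\rho$ in its interior. Put $P_i=-\mathrm w_1+i\mathrm w_2$, $Q_j=j\rho\mathrm w_2$ ($i,j\in\mathbb Z$). The triangulation with the Delaunay property is unique unless for some $i,j$ the points $P_i,P_{i+1},Q_j,Q_{j+1}$ lie on a common circle. $\mathcal T_\rho$ denotes the triangulation of $\mathcal L_\rho$ with the Delaunay property in which, by convention, every such concyclic 4-tuple is triangulated by $P_iQ_jQ_{j+1}$ and $P_iP_{i+1}Q_{j+1}$. Two distinct points of $\mathcal L_\rho$ are nearest neighbours (NN) if they are vertices of one and the same triangle of $\mathcal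 T_\rho$. Transition cost. Let $\Omega_{k,\infty}=\mathbb R\times(0,\frac{\sqrt3}2k)$, $\mathcal L_{\rho,\infty}(k)=\mathcal L_\rho\cap\overline\Omega_{k,\infty}$, and let $\mathcal L^-_{1,\infty}(k)$, $\mathcal L^+_{\rho,\infty}(k)$ be its subsets of points $\xi_1\mathrm w_1+\xi_2\mathrm w_2$ with $\xi_1<0$, respectively $\xi_1\ge0$. $\mathcal A_{\rho,\infty}(\Omega_{k,\infty})$ is the set of $u\in C^0(\overline\Omega_{k,\infty};\mathbb R^2)$ piecewise affine with $\nabla u$ constant on $\Omega_{k,\infty}\cap T$ for all $T\in\mathcal T_\rho$ and $\det\nabla u>0$ a.e. For such $u$, $$\mathcal E_\infty^\lambda(u,\rho,k)=\tfrac12\sum_{\substack{x,y\ \mathrm{NN}\\ x\in\mathcal L^-_{1,\infty}(k),\,y\in\mathcal L_{\rho,\infty}(k)}}(|u(x)-u(y)|-1)^2+\tfrac12\sum_{\substack{x,y\ \mathrm{NN}\\ x\in\mathcal L^+_{\rho,\infty}(k),\,y\in\mathcal L_{\rho,\infty}(k)}}(|u(x)-u(y)|-\lambda)^2,$$ the sums being over ordered pairs $(x,y)$. Then $\gamma^\lambda(\rho,k)$ is the infimum of $\mathcal E^\lambda_\infty(v,\rho,k)$ over all $M>0$ and $v\in\mathcal A_{\rho,\infty}(\Omega_{k,\infty})$ with $\nabla v=I$ for $x_1\in(-\infty,-M)$ and $\nabla v=\frac\lambda\rho I$ for $x_1\in(M,+\infty)$. *)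

theory Defs
  imports "HOL-Analysis.Analysis"
begin

definition w1 :: "real^2" where
  "w1 = vector [1, 0]"

definition w2 :: "real^2" where
  "w2 = vector [1/2, sqrt 3 / 2]"

definition lattice_minus :: "(real^2) set" where
  "lattice_minus = {\<xi>1 *\<^sub>R w1 + \<xi>2 *\<^sub>R w2 | \<xi>1 \<xi>2. \<xi>1 \<in> \<int> \<and> \<xi>2 \<in> \<int> \<and> \<xi>1 < 0}"

definition lattice_plus :: "real \<Rightarrow> (real^2) set" where
  "lattice_plus \<rho> = {\<xi>1 *\<^sub>R w1 + \<xi>2 *\<^sub>R w2 | \<xi>1 \<xi>2.
     \<xi>1 \<in> (\<lambda>n. \<rho> * n) ` \<int> \<and> \<xi>2 \<in> (\<lambda>n. \<rho> * n) ` \<int> \<and> 0 \<le> \<xi>1}"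

definition lattice :: "real \<Rightarrow> (real^2) set" where
  "lattice \<rho> = lattice_minus \<union> lattice_plus \<rho>"

text \<open>A nondegenerate triangle is encoded by its set \<open>S\<close> of three vertices; the open triangle
  itself is \<open>interior (convex hull S)\<close>, and its closure is \<open>convex hull S\<close>.\<close>

definition open_triangle :: "(real^2) set \<Rightarrow> (real^2) set" where
  "open_triangle S = interior (convex hull S)"

definition triangulation :: "(real^2) set \<Rightarrow> (real^2) set set \<Rightarrow> bool" where
  "triangulation L \<T> \<longleftrightarrow>
     (\<forall>S\<in>\<T>. S \<subseteq> L \<and> card S = 3 \<and> \<not> collinear S) \<and>
     pairwise (\<lambda>S S'. disjnt (open_triangle S) (open_triangle S')) \<T> \<and>
     (\<Union>S\<in>\<T>. closure (open_triangle S)) = UNIV"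

definition delaunay :: "(real^2) set \<Rightarrow> (real^2) set set \<Rightarrow> bool" where
  "delaunay L \<T> \<longleftrightarrow> (\<forall>S\<in>\<T>. \<exists>c r. S \<subseteq> sphere c r \<and> ball c r \<inter> L = {})"

definition P :: "int \<Rightarrow> real^2" where
  "P i = - w1 + of_int i *\<^sub>R w2"

definition Q :: "real \<Rightarrow> int \<Rightarrow> real^2" where
  "Q \<rho> j = (of_int j * \<rho>) *\<^sub>R w2"

definition concyclic_convention :: "real \<Rightarrow> (real^2) set set \<Rightarrow> bool" where
  "concyclic_convention \<rho> \<T> \<longleftrightarrow>
     (\<forall>i j. (\<exists>c r. {P i, P (i + 1), Q \<rho> j, Q \<rho> (j + 1)} \<subseteq> sphere c r) \<longrightarrow>
        {P i, Q \<rho> j, Q \<rho> (j + 1)} \<in> \<T> \<and> {P i, P (i + 1), Q \<rho> (j + 1)} \<in> \<T>)"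

text \<open>For \<open>0 < \<rho> \<le> 1\<close> the only ambiguity of the Delaunay triangulation stems from the concyclic
  quadruples fixed by the convention, so the description below is definite. Hanging nodes need
  not be excluded separately: a lattice point inside an edge lies in the open circumdisc.\<close>

definition lattice_triangulation :: "real \<Rightarrow> (real^2) set set" where
  "lattice_triangulation \<rho> =
     (THE \<T>. triangulation (lattice \<rho>) \<T> \<and> delaunay (lattice \<rho>) \<T> \<and> concyclic_convention \<rho> \<T>)"

definition nearest_neighbours :: "real \<Rightarrow> real^2 \<Rightarrow> real^2 \<Rightarrow> bool" where
  "nearest_neighbours \<rho> x y \<longleftrightarrow> x \<noteq> y \<and> (\<exists>S\<in>lattice_triangulation \<rho>. x \<in> S \<and> y \<in> S)"

definition strip :: "nat \<Rightarrow> (real^2) set" where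
  "strip k = {x. 0 < x $ 2 \<and> x $ 2 < sqrt 3 / 2 * real k}"

definition has_gradient_on :: "(real^2 \<Rightarrow> real^2) \<Rightarrow> real^2^2 \<Rightarrow> (real^2) set \<Rightarrow> bool" where
  "has_gradient_on u A X \<longleftrightarrow> (\<forall>x\<in>X. (u has_derivative (\<lambda>h. A *v h)) (at x))"

text \<open>The deformations are total functions, but only their values on \<open>closure (strip k)\<close>
  matter below.\<close>

definition admissible :: "real \<Rightarrow> nat \<Rightarrow> (real^2 \<Rightarrow> real^2) set" where
  "admissible \<rho> k = {u.
     continuous_on (closure (strip k)) u \<and>
     (\<forall>S\<in>lattice_triangulation \<rho>. \<exists>A. has_gradient_on u A (strip k \<inter> open_triangle S)) \<and>
     (AE x in lebesgue_on (strip k). det (jacobian u (at x)) > 0)}"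

text \<open>The energy of a general admissible deformation may be infinite, hence the values in
  \<open>ennreal\<close>, where every unordered sum converges.\<close>

definition energy :: "real \<Rightarrow> (real^2 \<Rightarrow> real^2) \<Rightarrow> real \<Rightarrow> nat \<Rightarrow> ennreal" where
  "energy lam u \<rho> k =
     ennreal (1/2) *
       (\<Sum>\<^sub>\<infinity>(x, y) \<in> {(x, y). nearest_neighbours \<rho> x y \<and>
            x \<in> lattice_minus \<inter> closure (strip k) \<and> y \<in> lattice \<rho> \<inter> closure (strip k)}.
          ennreal ((norm (u x - u y) - 1)\<^sup>2)) +
     ennreal (1/2) *
       (\<Sum>\<^sub>\<infinity>(x, y) \<in> {(x, y). nearest_neighbours \<rho> x y \<and>
            x \<in> lattice_plus \<rho> \<inter> closure (strip k) \<and> y \<in> lattice \<rho> \<inter> closure (strip k)}.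
          ennreal ((norm (u x - u y) - lam)\<^sup>2))"

definition transition_cost :: "real \<Rightarrow> real \<Rightarrow> nat \<Rightarrow> ennreal" where
  "transition_cost lam \<rho> k =
     Inf {energy lam v \<rho> k | v M. M > 0 \<and> v \<in> admissible \<rho> k \<and>
            has_gradient_on v (mat 1) (strip k \<inter> {x. x $ 1 < - M}) \<and>
            has_gradient_on v (mat (lam / \<rho>)) (strip k \<inter> {x. x $ 1 > M})}"

end

theory Submission imports Defs "HOL-Complex_Analysis.Complex_Analysis" begin

text \<open>For \<open>\<rho> = lam\<close> the identity is admissible and only the \<open>O(k)\<close> bonds across the interface cost energy, so the
  infimum grows at most linearly in \<open>k\<close>. For \<open>\<rho> = 1\<close> a linear bound is impossible. If the energy is at most
  \<open>C k\<close>, then by Cauchy-Schwarz along lattice lines the deformations rescaled by \<open>1 / k\<close> are equi-Hoelder with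
  exponent \<open>1/2\<close>, hence subconverge uniformly. Since positively oriented triangles with nearly equal sides are
  nearly conformal, the limit is holomorphic across the interface. As the total signed area of the difference
  to an affine map is a boundary term, the derivative of the limit has modulus \<open>1\<close> on the left and \<open>lam\<close> on the
  right of the interface, which contradicts its continuity.

  The triangulations are made explicit by the empty circle property: two overlapping triangles with empty
  circumdiscs have the same circumcircle.\<close>

subsection \<open>Lattice coordinates\<close>

text \<open>The scaling decides: an energy of order k spread over about k^2 bonds leaves a mean
  square deviation of order 1/k, and the jump of the rest length at the interface adds only O(k) to
  the sum of squared Wirtinger defects. Both vanish after rescaling, so the limit equation does not
  see the interface, while the slopes on its two sides keep their moduli. Compactness gives uniform
  convergence only, so the modulus of the limit derivative cannot be read off the bond lengths
  directly. The area identity bridges this gap: for v = U - affine, the squared increments are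
  bounded by squared defects plus a multiple of the signed area, and the total area is at most sup
  |v| times a boundary length. On a rhombus of side h k, Taylor expansion gives sup |v| = O(h^2 k)
  and Cauchy-Schwarz gives length O(sqrt(h) k). Division by the (h k)^2 cells leaves an error
  O(sqrt(h)), which vanishes when h tends to 0 after k has been chosen large. Positive determinants
  exclude reflected triangles, whose sides may be perfect although they are anticonformal.\<close>

definition pt :: "real \<Rightarrow> real \<Rightarrow> real^2" where
  "pt a b = a *\<^sub>R w1 + b *\<^sub>R w2"

lemma pt_nth [simp]: "pt a b $ 1 = a + b / 2" "pt a b $ 2 = b * (sqrt 3 / 2)"
  by (simp_all add: pt_def w1_def w2_def)

lemma vec2_eq_iff: "x = y \<longleftrightarrow> x $ 1 = y $ 1 \<and> x $ 2 = (y :: real^2) $ 2"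
  by (auto simp: vec_eq_iff forall_2)

lemma pt_eq_iff [simp]: "pt a b = pt c d \<longleftrightarrow> a = c \<and> b = d"
  by (auto simp: vec2_eq_iff)

lemma pt_add: "pt a b + pt c d = pt (a + c) (b + d)"
  and pt_diff: "pt a b - pt c d = pt (a - c) (b - d)"
  and pt_scaleR: "r *\<^sub>R pt a b = pt (r * a) (r * b)"
  by (simp_all add: pt_def algebra_simps)

lemma pt_surj: obtains a b where "x = pt a b"
proof
  show "x = pt (x $ 1 - x $ 2 / sqrt 3) (2 * x $ 2 / sqrt 3)"
    by (simp add: vec2_eq_iff)
qed

lemma inner_pt: "pt a b \<bullet> pt c d = a * c + b * d + (a * d + b * c) / 2"
proof -
  have "sqrt 3 * sqrt 3 = (3::real)" by simp
  then have "b * (sqrt 3 / 2) * (d * (sqrt 3 / 2)) = 3 / 4 * b * d"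
    by (simp add: field_simps)
  then show ?thesis
    by (simp add: inner_vec_def sum_2 field_simps)
qed

lemma norm_pt: "(norm (pt a b))\<^sup>2 = a\<^sup>2 + a * b + b\<^sup>2"
  by (simp add: power2_norm_eq_inner inner_pt) (simp add: power2_eq_square)

lemma norm_pt_sqrt: "norm (pt a b) = sqrt (a\<^sup>2 + a * b + b\<^sup>2)"
  by (metis norm_ge_zero norm_pt real_sqrt_unique)

lemma P_pt: "P i = pt (- 1) (of_int i)"
  and Q_pt: "Q \<rho> j = pt 0 (of_int j * \<rho>)"
  by (simp_all add: P_def Q_def pt_def)

lemma lattice_minus_pt: "lattice_minus = {pt (of_int m) (of_int n) | m n. m < 0}"
  unfolding lattice_minus_def pt_def[symmetric] by (auto elim!: Ints_cases)

lemma lattice_plus_pt: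
  assumes "0 < \<rho>"
  shows "lattice_plus \<rho> = {pt (\<rho> * of_int m) (\<rho> * of_int n) | m n. 0 \<le> m}"
  unfolding lattice_plus_def pt_def[symmetric]
proof (intro equalityI subsetI)
  fix x assume "x \<in> {pt a b |a b. a \<in> (*) \<rho> ` \<int> \<and> b \<in> (*) \<rho> ` \<int> \<and> 0 \<le> a}"
  then obtain m n where "x = pt (\<rho> * of_int m) (\<rho> * of_int n)" "0 \<le> \<rho> * real_of_int m"
    by (auto elim!: Ints_cases simp: image_iff)
  moreover from this have "0 \<le> m" using assms by (simp add: zero_le_mult_iff)
  ultimately show "x \<in> {pt (\<rho> * of_int m) (\<rho> * of_int n) | m n. 0 \<le> m}" by blast
next
  fix x assume "x \<in> {pt (\<rho> * of_int m) (\<rho> * of_int n) | m n. 0 \<le> m}"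
  then obtain m n where "x = pt (\<rho> * of_int m) (\<rho> * of_int n)" "0 \<le> m" by blast
  then show "x \<in> {pt a b |a b. a \<in> (*) \<rho> ` \<int> \<and> b \<in> (*) \<rho> ` \<int> \<and> 0 \<le> a}"
    using assms by (auto intro!: exI)
qed

lemma not_collinear_pt:
  assumes "(c - a) * (f - b) \<noteq> (e - a) * (d - b)"
  shows "\<not> collinear {pt a b, pt c d, pt e f}"
proof
  assume "collinear {pt a b, pt c d, pt e f}"
  then consider "pt a b = pt e f" | u where "pt c d = u *\<^sub>R pt a b + (1 - u) *\<^sub>R pt e f"
    unfolding collinear_3_expand by blast
  then show False
  proof cases
    case 1
    then show False using assms by simp
  next
    case 2
    then have "c - e = u * (a - e)" "d - f = u * (b - f)"
      by (auto simp: pt_scaleR pt_add algebra_simps)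
    then have "(c - e) * (b - f) = (d - f) * (a - e)" by simp
    then show False using assms by (simp add: algebra_simps)
  qed
qed

subsection \<open>Empty circles\<close>

lemma open_triangle_halfspaces_disjnt:
  assumes "a \<noteq> (0 :: real^2)" and "S \<subseteq> {x. b \<le> a \<bullet> x}" and "S' \<subseteq> {x. a \<bullet> x \<le> b}"
  shows "disjnt (open_triangle S) (open_triangle S')"
proof -
  have "convex hull S \<subseteq> {x. b \<le> a \<bullet> x}" "convex hull S' \<subseteq> {x. a \<bullet> x \<le> b}"
    using assms by (simp_all add: hull_minimal convex_halfspace_ge convex_halfspace_le)
  then have "open_triangle S \<subseteq> interior {x. a \<bullet> x \<ge> b}" "open_triangle S' \<subseteq> interior {x. a \<bullet> x \<le> b}"
    unfolding open_triangle_def by (auto intro!: interior_mono)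
  then show ?thesis
    using assms(1) by (fastforce simp: disjnt_iff)
qed

text \<open>The difference of the powers of a point with respect to two circles is affine; it has opposite
  signs on the two triangles.\<close>

lemma empty_circles_overlap:
  fixes c c' :: "real^2"
  assumes "S \<subseteq> sphere c r" "S' \<subseteq> sphere c' r'" "S \<noteq> {}" "S' \<noteq> {}"
    and "S \<inter> ball c' r' = {}" "S' \<inter> ball c r = {}"
    and "\<not> disjnt (open_triangle S) (open_triangle S')"
  shows "c = c' \<and> r = r'"
proof -
  obtain s s' where s: "s \<in> S" "s' \<in> S'" using assms by auto
  have r: "0 \<le> r" "0 \<le> r'" using subsetD[OF assms(1) s(1)] subsetD[OF assms(2) s(2)] by auto
  define a where "a = 2 *\<^sub>R (c - c')"
  define b where "b = r'\<^sup>2 - r\<^sup>2 + c \<bullet> c - c' \<bullet> c'"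
  have power: "a \<bullet> x - b = ((dist c' x)\<^sup>2 - r'\<^sup>2) - ((dist c x)\<^sup>2 - r\<^sup>2)" for x
    unfolding a_def b_def dist_norm power2_norm_eq_inner
    by (simp add: inner_diff_left inner_diff_right inner_commute algebra_simps)
  have pos: "b \<le> a \<bullet> x" if "x \<in> S" for x
  proof -
    have "dist c x = r" "r' \<le> dist c' x" using that assms(1,5) by (auto simp: disjoint_iff not_less)
    then show ?thesis using power[of x] r by (smt (verit) power_mono)
  qed
  have neg: "a \<bullet> x \<le> b" if "x \<in> S'" for x
  proof -
    have "dist c' x = r'" "r \<le> dist c x" using that assms(2,6) by (auto simp: disjoint_iff not_less)
    then show ?thesis using power[of x] r by (smt (verit) power_mono)
  qed
  have "a = 0"
    using open_triangle_halfspaces_disjnt[of a S b S'] pos neg assms(7) by blast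
  moreover from this have "b = 0" using pos[OF s(1)] neg[OF s(2)] by simp
  ultimately show ?thesis using r by (simp add: a_def b_def)
qed

text \<open>Every polynomial whose quadratic part is the norm form \<open>a^2 + a * b + b^2\<close>
  is the power of a point with respect to a circle: completing the square gives the centre
  \<open>(u, v)\<close>. The known zero makes the squared radius nonnegative.\<close>

lemma power_of_point_circle:
  assumes "a0\<^sup>2 + a0 * b0 + b0\<^sup>2 + \<alpha> * a0 + \<beta> * b0 + \<gamma> = 0"
  obtains c r where
    "\<And>a b. pt a b \<in> sphere c r \<longleftrightarrow> a\<^sup>2 + a * b + b\<^sup>2 + \<alpha> * a + \<beta> * b + \<gamma> = 0"
    "\<And>a b. pt a b \<in> ball c r \<longleftrightarrow> a\<^sup>2 + a * b + b\<^sup>2 + \<alpha> * a + \<beta> * b + \<gamma> < 0"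
proof -
  define u v where "u = (\<beta> - 2 * \<alpha>) / 3" and "v = (\<alpha> - 2 * \<beta>) / 3"
  define R where "R = u\<^sup>2 + u * v + v\<^sup>2 - \<gamma>"
  have power: "(dist (pt u v) (pt a b))\<^sup>2 = a\<^sup>2 + a * b + b\<^sup>2 + \<alpha> * a + \<beta> * b + \<gamma> + R" for a b
    unfolding dist_norm pt_diff norm_pt R_def u_def v_def by (simp add: field_simps power2_eq_square)
  have "0 \<le> R" using power[of a0 b0] assms by (metis add_0 zero_le_power2)
  then have sq: "R = (sqrt R)\<^sup>2" by simp
  have "pt a b \<in> sphere (pt u v) (sqrt R) \<longleftrightarrow> a\<^sup>2 + a * b + b\<^sup>2 + \<alpha> * a + \<beta> * b + \<gamma> = 0" for a b
  proof -
    have "dist (pt u v) (pt a b) = sqrt R \<longleftrightarrow> (dist (pt u v) (pt a b))\<^sup>2 = R"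
      using \<open>0 \<le> R\<close> by (metis real_sqrt_abs abs_of_nonneg zero_le_dist sq)
    then show ?thesis using power[of a b] by simp
  qed
  moreover have "pt a b \<in> ball (pt u v) (sqrt R) \<longleftrightarrow> a\<^sup>2 + a * b + b\<^sup>2 + \<alpha> * a + \<beta> * b + \<gamma> < 0" for a b
  proof -
    have "dist (pt u v) (pt a b) < sqrt R \<longleftrightarrow> (dist (pt u v) (pt a b))\<^sup>2 < R"
      by (metis real_less_rsqrt real_sqrt_less_iff real_sqrt_abs abs_of_nonneg zero_le_dist)
    then show ?thesis using power[of a b] by simp
  qed
  ultimately show thesis by (rule that)
qed

lemma closure_open_triangle:
  assumes "\<not> collinear S" "card S = 3"
  shows "closure (open_triangle S) = convex hull S" and "open_triangle S \<noteq> {}"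
proof -
  obtain a b c where S: "S = {a, b, c}" using assms(2) by (auto simp: card_3_iff)
  have "(1/3) *\<^sub>R a + (1/3) *\<^sub>R b + (1/3) *\<^sub>R c \<in> open_triangle S"
    unfolding open_triangle_def S using assms(1) S
    by (subst interior_convex_hull_3_minimal) (auto intro!: exI[of _ "1/3"])
  then show "open_triangle S \<noteq> {}" by blast
  then have "closure (open_triangle S) = closure (convex hull S)"
    unfolding open_triangle_def by (intro convex_closure_interior) auto
  then show "closure (open_triangle S) = convex hull S"
    by (simp add: S finite_imp_compact_convex_hull compact_imp_closed)
qed

definition convention_pair :: "real \<Rightarrow> int \<Rightarrow> int \<Rightarrow> (real^2) set set" where
  "convention_pair \<rho> i j = {{P i, Q \<rho> j, Q \<rho> (j + 1)}, {P i, P (i + 1), Q \<rho> (j + 1)}}"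

definition quad :: "real \<Rightarrow> int \<Rightarrow> int \<Rightarrow> (real^2) set" where
  "quad \<rho> i j = {P i, P (i + 1), Q \<rho> j, Q \<rho> (j + 1)}"

text \<open>A certificate that can be checked for one triangle at a time: either its empty circle
  carries no further lattice point, or it carries exactly one ambiguous quadruple, for which the
  convention decides. Global uniqueness of the triangulation is reduced to this local
  condition.\<close>

definition circle_determined :: "real \<Rightarrow> (real^2) set \<Rightarrow> bool" where
  "circle_determined \<rho> S \<longleftrightarrow> (\<exists>c r. S \<subseteq> sphere c r \<and> ball c r \<inter> lattice \<rho> = {} \<and>
     (lattice \<rho> \<inter> sphere c r = S \<or>
      (\<exists>i j. lattice \<rho> \<inter> sphere c r = quad \<rho> i j \<and> S \<in> convention_pair \<rho> i j)))"

lemma quad_inj: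
  assumes "0 < \<rho>" "quad \<rho> i j = quad \<rho> i' j'"
  shows "i = i'" "j = j'"
proof -
  have "P i \<in> quad \<rho> i' j'" "P i' \<in> quad \<rho> i j" "Q \<rho> j \<in> quad \<rho> i' j'" "Q \<rho> j' \<in> quad \<rho> i j"
    using assms(2) by (auto simp: quad_def)
  then have "i = i' \<or> i = i' + 1" "i' = i \<or> i' = i + 1" "j = j' \<or> j = j' + 1" "j' = j \<or> j' = j + 1"
    using assms(1) by (auto simp: quad_def P_pt Q_pt of_int_eq_iff[symmetric, where 'a=real] simp del: of_int_eq_iff)
  then show "i = i'" "j = j'" by linarith+
qed

lemma convention_pair_disjnt:
  assumes "0 < \<rho>" "S \<in> convention_pair \<rho> i j" "S' \<in> convention_pair \<rho> i j" "S \<noteq> S'"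
  shows "disjnt (open_triangle S) (open_triangle S')"
proof -
  define d where "d = (of_int j + 1) * \<rho> - of_int i"
  \<comment> \<open>A normal vector of the diagonal from \<open>P i\<close> to
    \<open>Q \<rho> (j + 1)\<close>, whose direction is \<open>pt 1 d\<close>; the line of this
    diagonal separates the two triangles.\<close>
  define u where "u = pt (- (1 + 2 * d)) (2 + d)"
  define b where "b = u \<bullet> P i"
  have "u \<noteq> 0"
  proof
    assume "u = 0"
    then have "u $ 1 = 0" "u $ 2 = 0" by simp_all
    then have "1 + 2 * d = (2 + d) / 2" "2 + d = 0" by (auto simp: u_def)
    then have "d = - 2" "1 + 2 * d = 0" by simp_all
    then show False by simp
  qed
  have "b \<le> u \<bullet> x" if "x \<in> {P i, P (i + 1), Q \<rho> (j + 1)}" for x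
    using that unfolding b_def u_def d_def P_pt Q_pt inner_pt by (auto simp: inner_pt field_simps)
  moreover have "u \<bullet> x \<le> b" if "x \<in> {P i, Q \<rho> j, Q \<rho> (j + 1)}" for x
    using that assms(1) unfolding b_def u_def d_def P_pt Q_pt inner_pt by (auto simp: inner_pt field_simps)
  ultimately have "disjnt (open_triangle {P i, P (i + 1), Q \<rho> (j + 1)}) (open_triangle {P i, Q \<rho> j, Q \<rho> (j + 1)})"
    using open_triangle_halfspaces_disjnt[OF \<open>u \<noteq> 0\<close>] by (metis mem_Collect_eq subsetI)
  then show ?thesis
    using assms(2-4) by (auto simp: convention_pair_def disjnt_sym)
qed

text \<open>Overlap forces a common circle. Both triangles then use the same lattice points on it:
  either there are only three of them, or both are halves of the same quadruple, and the two halves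
  do not overlap.\<close>

lemma circle_determined_eq:
  assumes "0 < \<rho>" "circle_determined \<rho> S" "circle_determined \<rho> S'" "card S = 3" "card S' = 3"
    "S \<subseteq> lattice \<rho>" "S' \<subseteq> lattice \<rho>"
    "\<not> disjnt (open_triangle S) (open_triangle S')"
  shows "S = S'"
proof -
  have fin: "finite S" "finite S'" using assms by (simp_all add: card_ge_0_finite)
  obtain c r where c: "S \<subseteq> sphere c r" "ball c r \<inter> lattice \<rho> = {}"
    "lattice \<rho> \<inter> sphere c r = S \<or> (\<exists>i j. lattice \<rho> \<inter> sphere c r = quad \<rho> i j \<and> S \<in> convention_pair \<rho> i j)"
    using assms(2) unfolding circle_determined_def by blast
  obtain c' r' where c': "S' \<subseteq> sphere c' r'" "ball c' r' \<inter> lattice \<rho> = {}"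
    "lattice \<rho> \<inter> sphere c' r' = S' \<or> (\<exists>i j. lattice \<rho> \<inter> sphere c' r' = quad \<rho> i j \<and> S' \<in> convention_pair \<rho> i j)"
    using assms(3) unfolding circle_determined_def by blast
  have "c = c' \<and> r = r'"
    using assms c c' by (intro empty_circles_overlap[of S c r S' c' r']) auto
  then have sub: "S \<subseteq> lattice \<rho> \<inter> sphere c r" "S' \<subseteq> lattice \<rho> \<inter> sphere c r"
    and c'': "lattice \<rho> \<inter> sphere c r = S' \<or> (\<exists>i j. lattice \<rho> \<inter> sphere c r = quad \<rho> i j \<and> S' \<in> convention_pair \<rho> i j)"
    using c c' assms by auto
  from c(3) c'' sub show ?thesis
    using assms(1,4,5,8) fin quad_inj[OF assms(1)] convention_pair_disjnt[OF assms(1)]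
    by (metis card_subset_eq)
qed

text \<open>Uniqueness is the point. A triangle of a competitor overlaps some triangle of
  \<open>\<T>\<close> and so has its circle. If only three lattice points lie there, the triangles
  agree; otherwise the convention puts both halves of the quadruple into the competitor, whose
  triangles do not overlap. The converse inclusion follows, as every triangle of \<open>\<T>\<close>
  overlaps one of the competitor.\<close>

lemma lattice_triangulation_eqI:
  assumes "0 < \<rho>"
    and tri: "\<And>S. S \<in> \<T> \<Longrightarrow> S \<subseteq> lattice \<rho> \<and> card S = 3 \<and> \<not> collinear S \<and> circle_determined \<rho> S"
    and cover: "\<And>x. \<exists>S\<in>\<T>. x \<in> convex hull S"
    and conv: "concyclic_convention \<rho> \<T>"
  shows "lattice_triangulation \<rho> = \<T>"
  unfolding lattice_triangulation_def
proof (rule the_equality, intro conjI)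
  have cl: "closure (open_triangle S) = convex hull S" if "S \<in> \<T>" for S
    using tri[OF that] closure_open_triangle by blast
  show T: "triangulation (lattice \<rho>) \<T>"
    unfolding triangulation_def
  proof (intro conjI)
    show "\<forall>S\<in>\<T>. S \<subseteq> lattice \<rho> \<and> card S = 3 \<and> \<not> collinear S" using tri by blast
    show "pairwise (\<lambda>S S'. disjnt (open_triangle S) (open_triangle S')) \<T>"
      unfolding pairwise_def using tri circle_determined_eq[OF assms(1)] by blast
    show "(\<Union>S\<in>\<T>. closure (open_triangle S)) = UNIV" using cover cl by auto
  qed
  show "delaunay (lattice \<rho>) \<T>"
    unfolding delaunay_def using tri unfolding circle_determined_def by blast
  show "concyclic_convention \<rho> \<T>" by (rule conv)
  fix \<T>' assume T': "triangulation (lattice \<rho>) \<T>' \<and> delaunay (lattice \<rho>) \<T>' \<and> concyclic_convention \<rho> \<T>'"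
  then have tri': "S \<subseteq> lattice \<rho> \<and> card S = 3 \<and> \<not> collinear S" if "S \<in> \<T>'" for S
    using that unfolding triangulation_def by blast
  \<comment> \<open>An open triangle meets some closed triangle of the covering, and an open set
    that meets a closure meets the set itself.\<close>
  have overlap: "\<exists>S'\<in>\<U>. \<not> disjnt (open_triangle S) (open_triangle S')"
    if S: "card S = 3" "\<not> collinear S" and U: "triangulation (lattice \<rho>) \<U>" for S \<U>
  proof -
    obtain x where x: "x \<in> open_triangle S" using closure_open_triangle(2)[OF S(2,1)] by auto
    have "x \<in> (\<Union>S\<in>\<U>. closure (open_triangle S))" using U unfolding triangulation_def by simp
    then obtain S' where "S' \<in> \<U>" "x \<in> closure (open_triangle S')" by blast
    moreover have "open (open_triangle S)" by (simp add: open_triangle_def)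
    ultimately have "open_triangle S \<inter> open_triangle S' \<noteq> {}"
      using x open_Int_closure_eq_empty by fastforce
    then show ?thesis using \<open>S' \<in> \<U>\<close> by (auto simp: disjnt_def)
  qed
  have sub: "S' \<in> \<T>" if S': "S' \<in> \<T>'" for S'
  proof -
    obtain S where S: "S \<in> \<T>" "\<not> disjnt (open_triangle S') (open_triangle S)"
      using overlap[OF _ _ T] tri'[OF S'] by blast
    obtain c r where c: "S \<subseteq> sphere c r" "ball c r \<inter> lattice \<rho> = {}"
      "lattice \<rho> \<inter> sphere c r = S \<or> (\<exists>i j. lattice \<rho> \<inter> sphere c r = quad \<rho> i j \<and> S \<in> convention_pair \<rho> i j)"
      using tri[OF S(1)] unfolding circle_determined_def by blast
    obtain c' r' where c': "S' \<subseteq> sphere c' r'" "ball c' r' \<inter> lattice \<rho> = {}"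
      using T' S' unfolding delaunay_def by blast
    have "c' = c \<and> r' = r"
      using tri[OF S(1)] tri'[OF S'] c c' S(2) by (intro empty_circles_overlap[of S' c' r' S c r]) auto
    then have S'sub: "S' \<subseteq> lattice \<rho> \<inter> sphere c r" using c' tri'[OF S'] by auto
    from c(3) show ?thesis
    proof
      assume "lattice \<rho> \<inter> sphere c r = S"
      then have "S' = S" using S'sub tri[OF S(1)] tri'[OF S'] by (metis card.infinite card_subset_eq zero_neq_numeral)
      then show ?thesis using S by simp
    next
      assume "\<exists>i j. lattice \<rho> \<inter> sphere c r = quad \<rho> i j \<and> S \<in> convention_pair \<rho> i j"
      then obtain i j where ij: "lattice \<rho> \<inter> sphere c r = quad \<rho> i j" "S \<in> convention_pair \<rho> i j" by blast
      then have "quad \<rho> i j \<subseteq> sphere c r" by blast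
      then have "convention_pair \<rho> i j \<subseteq> \<T>'"
        using T' unfolding concyclic_convention_def convention_pair_def quad_def by blast
      then have "S \<in> \<T>'" using ij by blast
      then have "S = S'" using S(2) S' T' unfolding triangulation_def pairwise_def by (metis disjnt_sym)
      then show ?thesis using S by simp
    qed
  qed
  moreover have "S \<in> \<T>'" if S: "S \<in> \<T>" for S
  proof -
    obtain S' where S': "S' \<in> \<T>'" "\<not> disjnt (open_triangle S) (open_triangle S')"
      using overlap tri[OF S] T' by blast
    then have "S = S'" using sub[OF S'(1)] S T unfolding triangulation_def pairwise_def by blast
    then show ?thesis using S' by simp
  qed
  ultimately show "\<T>' = \<T>" by blast
qed

subsection \<open>The Delaunay triangulation\<close>

lemma pt_in_lattice:
  assumes "0 < \<rho>"
  shows "pt a b \<in> lattice \<rho> \<longleftrightarrow>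
    (\<exists>m n. m < 0 \<and> a = of_int m \<and> b = of_int n) \<or> (\<exists>m n. 0 \<le> m \<and> a = \<rho> * of_int m \<and> b = \<rho> * of_int n)"
  unfolding lattice_def lattice_minus_pt lattice_plus_pt[OF assms] by auto

lemma P_in_lattice: "0 < \<rho> \<Longrightarrow> P i \<in> lattice \<rho>"
  unfolding P_pt by (simp add: pt_in_lattice) (auto intro!: exI[of _ "- 1 :: int"])

lemma Q_in_lattice: "0 < \<rho> \<Longrightarrow> Q \<rho> j \<in> lattice \<rho>"
  unfolding Q_pt by (simp add: pt_in_lattice)

text \<open>Turns the certificate into sign conditions: \<open>f\<close> is the power of a point
  with respect to the circle, so it must vanish on \<open>S\<close>, be nonnegative on the lattice,
  and have only the permitted zeros there.\<close>

lemma circle_determinedI: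
  fixes f :: "real \<Rightarrow> real \<Rightarrow> real"
  assumes f: "\<And>a b. f a b = a\<^sup>2 + a * b + b\<^sup>2 + \<alpha> * a + \<beta> * b + \<gamma>"
    and S: "\<And>a b. pt a b \<in> S \<Longrightarrow> pt a b \<in> lattice \<rho> \<and> f a b = 0" "S \<noteq> {}"
    and nonneg: "\<And>a b. pt a b \<in> lattice \<rho> \<Longrightarrow> 0 \<le> f a b"
    and zero: "(\<forall>a b. pt a b \<in> lattice \<rho> \<longrightarrow> f a b = 0 \<longrightarrow> pt a b \<in> S) \<or>
      (\<exists>i j. (\<forall>a b. pt a b \<in> lattice \<rho> \<and> f a b = 0 \<longleftrightarrow> pt a b \<in> quad \<rho> i j) \<and> S \<in> convention_pair \<rho> i j)"
  shows "circle_determined \<rho> S"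
proof -
  obtain a0 b0 where ab0: "pt a0 b0 \<in> S" using S(2) pt_surj by (metis all_not_in_conv)
  then obtain c r where c:
    "\<And>a b. pt a b \<in> sphere c r \<longleftrightarrow> f a b = 0" "\<And>a b. pt a b \<in> ball c r \<longleftrightarrow> f a b < 0"
    using power_of_point_circle[of a0 b0 \<alpha> \<beta> \<gamma>] S(1)[OF ab0] unfolding f by metis
  have all_pt: "(\<forall>x. R x) \<longleftrightarrow> (\<forall>a b. R (pt a b))" for R by (metis pt_surj)
  have "S \<subseteq> sphere c r" unfolding subset_iff all_pt using S c by blast
  moreover have "ball c r \<inter> lattice \<rho> = {}"
    unfolding disjoint_iff all_pt using c nonneg by (metis not_less)
  moreover have "lattice \<rho> \<inter> sphere c r = S \<or>
      (\<exists>i j. lattice \<rho> \<inter> sphere c r = quad \<rho> i j \<and> S \<in> convention_pair \<rho> i j)"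
    unfolding set_eq_iff all_pt Int_iff c using zero S by blast
  ultimately show ?thesis unfolding circle_determined_def by blast
qed

section \<open>The explicit triangles and their circumcircles\<close>

definition grid_low :: "real \<Rightarrow> int \<Rightarrow> int \<Rightarrow> (real^2) set" where
  "grid_low s m n = {pt (s * m) (s * n), pt (s * (m + 1)) (s * n), pt (s * m) (s * (n + 1))}"

definition grid_up :: "real \<Rightarrow> int \<Rightarrow> int \<Rightarrow> (real^2) set" where
  "grid_up s m n = {pt (s * (m + 1)) (s * (n + 1)), pt (s * m) (s * (n + 1)), pt (s * (m + 1)) (s * n)}"

text \<open>The circles through \<open>P i\<close> and \<open>P (i + 1)\<close> have their chords on
  the column of the \<open>Q\<close> points centred at height \<open>i\<close>, so the apex is the
  multiple of \<open>\<rho>\<close> nearest to \<open>i\<close>. In a tie the rounding picks the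
  upper one, as the convention demands.\<close>

definition left_edge_triangle :: "real \<Rightarrow> int \<Rightarrow> (real^2) set" where
  "left_edge_triangle \<rho> i = {P i, P (i + 1), Q \<rho> \<lfloor>of_int i / \<rho> + 1 / 2\<rfloor>}"

text \<open>By the same symmetry the apex is the integer nearest to
  \<open>(j + 1 / 2) * \<rho> + 1 / 2\<close>. The ceiling picks the lower one in a tie, again as in
  the convention.\<close>

definition right_edge_triangle :: "real \<Rightarrow> int \<Rightarrow> (real^2) set" where
  "right_edge_triangle \<rho> j = {P \<lceil>(of_int j + 1 / 2) * \<rho>\<rceil>, Q \<rho> j, Q \<rho> (j + 1)}"

definition interface_triangles :: "real \<Rightarrow> (real^2) set set" where
  "interface_triangles \<rho> = range (left_edge_triangle \<rho>) \<union> range (right_edge_triangle \<rho>)"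

definition grid_triangles :: "real \<Rightarrow> int set \<Rightarrow> (real^2) set set" where
  "grid_triangles s I = {grid_low s m n | m n. m \<in> I} \<union> {grid_up s m n | m n. m \<in> I}"

definition lattice_triangles :: "real \<Rightarrow> (real^2) set set" where
  "lattice_triangles \<rho> = grid_triangles 1 {..-2} \<union> grid_triangles \<rho> {0..} \<union> interface_triangles \<rho>"

text \<open>With the third barycentric coordinate \<open>r = 1 - p - q\<close>, twice the power is
  \<open>p^2 + q^2 + r^2 - 1\<close>, and integers with sum 1 satisfy
  \<open>\<bar>p\<bar> + \<bar>q\<bar> + \<bar>r\<bar> \<ge> 1\<close>.\<close>

lemma equilateral_power_lattice:
  fixes p q :: int
  shows "0 \<le> p\<^sup>2 + p * q + q\<^sup>2 - (p + q)"
    and "p\<^sup>2 + p * q + q\<^sup>2 - (p + q) = 0 \<Longrightarrow> (p, q) \<in> {(0, 0), (1, 0), (0, 1)}"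
proof -
  define r where "r = 1 - p - q"
  define X where "X = p\<^sup>2 + p * q + q\<^sup>2 - (p + q)"
  have id: "2 * X = p\<^sup>2 + q\<^sup>2 + r\<^sup>2 - 1"
    unfolding X_def r_def by (simp add: power2_eq_square algebra_simps)
  have sq: "\<bar>x\<bar> \<le> x\<^sup>2" for x :: int
    by (metis abs_ge_zero abs_le_square_iff abs_of_nonneg int_one_le_iff_zero_less le_less mult_left_le
        one_le_power power2_abs power2_eq_square self_le_power zero_less_numeral zero_power2 pos2)
  have "1 \<le> \<bar>p\<bar> + \<bar>q\<bar> + \<bar>r\<bar>" using r_def by arith
  then show "0 \<le> p\<^sup>2 + p * q + q\<^sup>2 - (p + q)"
    unfolding X_def[symmetric] using id sq[of p] sq[of q] sq[of r] by linarith
  assume "p\<^sup>2 + p * q + q\<^sup>2 - (p + q) = 0"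
  then have "p\<^sup>2 + q\<^sup>2 + r\<^sup>2 = 1" using id unfolding X_def[symmetric] by linarith
  then show "(p, q) \<in> {(0, 0), (1, 0), (0, 1)}"
    using sq[of p] sq[of q] sq[of r] r_def by auto
qed

text \<open>The first oblique coordinate of the closed disc ranges over \<open>[- s / 3, s]\<close>.
  This handles lattice points across the interface, which do not lie on the grid of the
  triangle.\<close>

lemma equilateral_power_far:
  fixes x y s :: real
  assumes "0 < s" "x > s \<or> x < - s / 3"
  shows "0 < x\<^sup>2 + x * y + y\<^sup>2 - s * (x + y)"
proof -
  have "4 * (x\<^sup>2 + x * y + y\<^sup>2 - s * (x + y)) = (2 * y + x - s)\<^sup>2 + (3 * x + s) * (x - s)"
    by (simp add: power2_eq_square algebra_simps)
  moreover have "0 < (3 * x + s) * (x - s)"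
    using assms by (auto simp: zero_less_mult_iff)
  ultimately show ?thesis
    by (smt (verit) zero_le_power2)
qed

text \<open>\<open>grid_low\<close> and \<open>grid_up\<close> are exchanged by point reflections, accounted for by the sign \<open>e\<close>.\<close>

lemma grid_triangle_circle_determined:
  assumes "0 < \<rho>" "\<rho> \<le> 1" "s = 1 \<and> m \<le> -2 \<or> s = \<rho> \<and> 0 \<le> m"
  shows "grid_low s m n \<subseteq> lattice \<rho> \<and> circle_determined \<rho> (grid_low s m n)"
    and "grid_up s m n \<subseteq> lattice \<rho> \<and> circle_determined \<rho> (grid_up s m n)"
proof -
  have s: "0 < s" using assms by auto
  have in_lat: "pt (s * of_int i) (s * of_int j) \<in> lattice \<rho>" if "i = m \<or> i = m + 1" for i j
  proof (cases "s = 1 \<and> m \<le> -2")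
    case True
    then have "i < 0 \<and> s * of_int i = of_int i \<and> s * of_int j = of_int j" using that by auto
    then show ?thesis unfolding pt_in_lattice[OF assms(1)] by blast
  next
    case False
    then have "0 \<le> i \<and> s * of_int i = \<rho> * of_int i \<and> s * of_int j = \<rho> * of_int j" using that assms by auto
    then show ?thesis unfolding pt_in_lattice[OF assms(1)] by blast
  qed
  \<comment> \<open>A lattice point lies on the same scaled grid, where integrality decides, or
    across the interface, where the first coordinate alone places it outside the circle.\<close>
  have cases: "(\<exists>p q. a = s * of_int p \<and> b = s * of_int q) \<or> (s = 1 \<and> m \<le> -2 \<and> 0 \<le> a) \<or> (s = \<rho> \<and> 0 \<le> m \<and> a \<le> -1)"
    if ab: "pt a b \<in> lattice \<rho>" for a b
    using ab assms unfolding pt_in_lattice[OF assms(1)] by (force simp: zero_le_mult_iff)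
  define g where "g x y = x\<^sup>2 + x * y + y\<^sup>2 - s * (x + y)" for x y
  have g_int: "g (s * of_int p) (s * of_int q) = s\<^sup>2 * of_int (p\<^sup>2 + p * q + q\<^sup>2 - (p + q))" for p q
    unfolding g_def by (simp add: power2_eq_square algebra_simps)
  have g_nonneg: "0 \<le> g (s * of_int p) (s * of_int q)" for p q
    unfolding g_int using equilateral_power_lattice(1)[of p q] by (intro mult_nonneg_nonneg) (auto simp only: of_int_0_le_iff zero_le_power2)
  have g_zero: "(p, q) \<in> {(0, 0), (1, 0), (0, 1)}" if "g (s * of_int p) (s * of_int q) = 0" for p q
    using that s equilateral_power_lattice(2)[of p q] unfolding g_int by (metis mult_eq_0_iff of_int_eq_0_iff order_less_irrefl power_not_zero)
  have main: "T \<subseteq> lattice \<rho> \<and> circle_determined \<rho> T"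
    if T: "T = {pt (s * of_int u) (s * of_int v), pt (s * of_int (u + e)) (s * of_int v), pt (s * of_int u) (s * of_int (v + e))}"
      and e: "e = 1 \<and> u = m \<or> e = -1 \<and> u = m + 1" for T u v and e :: int
  proof
    define f where "f a b = g (of_int e * (a - s * of_int u)) (of_int e * (b - s * of_int v))" for a b
    have ee: "e * e = 1" using e by auto
    show sub: "T \<subseteq> lattice \<rho>" unfolding T using e by (auto simp del: of_int_add intro!: in_lat)
    have f_int: "f (s * of_int p) (s * of_int q) = g (s * of_int (e * (p - u))) (s * of_int (e * (q - v)))" for p q
      unfolding f_def by (simp add: algebra_simps)
    have lat: "0 \<le> f a b \<and> (f a b = 0 \<longrightarrow> pt a b \<in> T)" if "pt a b \<in> lattice \<rho>" for a b
      using cases[OF that]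
    proof
      assume "\<exists>p q. a = s * of_int p \<and> b = s * of_int q"
      then obtain p q where pq: "a = s * of_int p" "b = s * of_int q" by blast
      have "pt a b \<in> T" if "f a b = 0"
      proof -
        have "(e * (p - u), e * (q - v)) \<in> {(0, 0), (1, 0), (0, 1)}"
          using that unfolding pq f_int by (rule g_zero)
        then have "p = u \<and> q = v \<or> p = u + e \<and> q = v \<or> p = u \<and> q = v + e" using e by auto
        then show ?thesis unfolding T pq by auto
      qed
      then show ?thesis using g_nonneg unfolding pq f_int by blast
    next
      assume far: "(s = 1 \<and> m \<le> -2 \<and> 0 \<le> a) \<or> (s = \<rho> \<and> 0 \<le> m \<and> a \<le> -1)"
      have "of_int e * (a - s * of_int u) > s \<or> of_int e * (a - s * of_int u) < - s / 3"
      proof (cases "s = 1 \<and> m \<le> -2 \<and> 0 \<le> a")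
        case True
        then have "real_of_int m \<le> -2" by linarith
        then show ?thesis using True e by auto
      next
        case False
        then have "0 \<le> s * of_int m" "a \<le> -1" "s \<le> 1" using far assms by auto
        then show ?thesis using s e by (auto simp: algebra_simps)
      qed
      then have "0 < f a b" unfolding f_def g_def by (rule equilateral_power_far[OF s])
      then show ?thesis by simp
    qed
    show "circle_determined \<rho> T"
    proof (rule circle_determinedI)
      show "f a b = a\<^sup>2 + a * b + b\<^sup>2 + (- 2 * s * u - s * v - s * e) * a + (- 2 * s * v - s * u - s * e) * b
          + ((s * u)\<^sup>2 + (s * u) * (s * v) + (s * v)\<^sup>2 + s * e * (s * u + s * v))" for a b
        using e unfolding f_def g_def by (auto simp: power2_eq_square algebra_simps)
      show "T \<noteq> {}" unfolding T by simp
      show "pt a b \<in> lattice \<rho> \<and> f a b = 0" if "pt a b \<in> T" for a b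
        using that sub e unfolding T f_def g_def by (auto simp: power2_eq_square algebra_simps)
    qed (use lat in blast)+
  qed
  show "grid_low s m n \<subseteq> lattice \<rho> \<and> circle_determined \<rho> (grid_low s m n)"
    by (rule main[where u = m and v = n and e = 1]) (simp_all add: grid_low_def)
  show "grid_up s m n \<subseteq> lattice \<rho> \<and> circle_determined \<rho> (grid_up s m n)"
    by (rule main[where u = "m + 1" and v = "n + 1" and e = "-1"]) (simp_all add: grid_up_def)
qed

text \<open>Lower bound, uniform in the second coordinate, for the power of the columns left of the
  \<open>P\<close> points with respect to an interface circle.\<close>

lemma far_left_positive:
  fixes a k :: real
  assumes "a \<le> -2" "0 \<le> k" "k \<le> 1"
  shows "0 < 3 / 4 * a\<^sup>2 + (1 - k) * a - k"
proof -
  have "3 / 4 * a\<^sup>2 + (1 - k) * a - k = (a + 2) * (3 / 4 * a - 1/2) + 1 - k * (a + 1)"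
    by (simp add: power2_eq_square field_simps)
  moreover have "0 \<le> (a + 2) * (3 / 4 * a - 1/2)" using assms by (intro mult_nonpos_nonpos) auto
  moreover have "k * (a + 1) \<le> 0" using assms by (intro mult_nonneg_nonpos) auto
  ultimately show ?thesis by linarith
qed

text \<open>On one column the power is a quadratic with roots 0 and \<open>- 2 * d\<close>. These
  are at most one lattice step apart, so no lattice point lies strictly between them; a second
  lattice zero occurs exactly in the case of a tie.\<close>

lemma lattice_line_power:
  fixes s d :: real and n :: int
  assumes "0 < s" "\<bar>2 * d\<bar> \<le> s"
  shows "0 \<le> s * n * (s * n + 2 * d)"
    and "s * n * (s * n + 2 * d) = 0 \<longleftrightarrow> n = 0 \<or> n = -1 \<and> 2 * d = s \<or> n = 1 \<and> 2 * d = - s"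
proof -
  have far: "0 < s * n * (s * n + 2 * d)" if "2 \<le> \<bar>n\<bar>"
  proof -
    have "2 \<le> n \<or> n \<le> -2" using that by linarith
    then show ?thesis
    proof
      assume "2 \<le> n"
      then have "s * 2 \<le> s * n" using assms(1) by (intro mult_left_mono) auto
      then have "0 < s * n" "0 < s * n + 2 * d" using assms by linarith+
      then show ?thesis by (rule mult_pos_pos)
    next
      assume "n \<le> -2"
      then have "real_of_int n \<le> - 2" by linarith
      then have "s * n \<le> s * (- 2)" using assms(1) by (intro mult_left_mono) auto
      then have "s * n < 0" "s * n + 2 * d < 0" using assms by linarith+
      then show ?thesis by (rule mult_neg_neg)
    qed
  qed
  consider "n = 0" | "n = 1" | "n = -1" | "2 \<le> \<bar>n\<bar>" by linarith
  then have "0 \<le> s * n * (s * n + 2 * d) \<and>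
      (s * n * (s * n + 2 * d) = 0 \<longleftrightarrow> n = 0 \<or> n = -1 \<and> 2 * d = s \<or> n = 1 \<and> 2 * d = - s)"
  proof cases
    case 4
    with far show ?thesis by fastforce
  qed (use assms in \<open>auto simp: zero_le_mult_iff mult_le_0_iff\<close>)
  then show "0 \<le> s * n * (s * n + 2 * d)"
    and "s * n * (s * n + 2 * d) = 0 \<longleftrightarrow> n = 0 \<or> n = -1 \<and> 2 * d = s \<or> n = 1 \<and> 2 * d = - s"
    by blast+
qed

text \<open>The power is tested column by column: it equals \<open>(b - i) * (b - i - 1)\<close> on
  the column of the \<open>P\<close> points and \<open>(b - i)^2 - d^2\<close> on that of the
  \<open>Q\<close> points, and is positive on all others. A fourth zero appears only for
  \<open>2 * d = \<rho>\<close>, at the mirror image of the apex.\<close>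

lemma left_edge_triangle_circle_determined:
  assumes "0 < \<rho>" "\<rho> \<le> 1"
  shows "circle_determined \<rho> (left_edge_triangle \<rho> i)"
proof -
  define J where "J = \<lfloor>of_int i / \<rho> + 1 / 2\<rfloor>"
  define d where "d = of_int J * \<rho> - of_int i"
  define f where "f a b = (b + a / 2 - of_int i)\<^sup>2 + 3 / 4 * a\<^sup>2 + (1 - d\<^sup>2) * a - d\<^sup>2" for a b
  have "of_int J \<le> of_int i / \<rho> + 1 / 2" "of_int i / \<rho> + 1 / 2 < of_int J + 1"
    unfolding J_def by linarith+
  then have d: "d \<le> \<rho> / 2" "- \<rho> / 2 < d"
    using assms(1) unfolding d_def by (simp_all add: field_simps)
  have d2: "d\<^sup>2 \<le> \<rho>\<^sup>2 / 4"
    using d power2_le_iff_abs_le[of "\<rho>/2" d] assms(1) by (simp add: power_divide)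
  have r2: "\<rho>\<^sup>2 \<le> 1" "0 < \<rho>\<^sup>2" using assms by (simp_all add: power_le_one)
  have left1: "f (-1) b = (b - of_int i) * (b - of_int i - 1)" for b
    unfolding f_def by (simp add: power2_eq_square algebra_simps)
  have right0: "f 0 b = (b - of_int i)\<^sup>2 - d\<^sup>2" for b unfolding f_def by simp
  have far: "0 < f a b" if "a \<le> -2 \<or> \<rho> \<le> a" for a b
    using that
  proof
    assume "a \<le> -2"
    then show ?thesis unfolding f_def
      using far_left_positive[of a "d\<^sup>2"] d2 r2 zero_le_power2[of "b + a / 2 - of_int i"] zero_le_power2[of d] by linarith
  next
    assume a: "\<rho> \<le> a"
    then have "\<rho>\<^sup>2 \<le> a\<^sup>2" using assms by (intro power_mono) auto
    moreover have "0 \<le> (1 - d\<^sup>2) * a" using d2 r2 a assms by (intro mult_nonneg_nonneg) auto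
    ultimately show ?thesis unfolding f_def
      using d2 r2 zero_le_power2[of "b + a / 2 - of_int i"] by linarith
  qed
  have lat: "0 \<le> f a b \<and> (f a b = 0 \<longleftrightarrow> pt a b \<in> {P i, P (i + 1), Q \<rho> J} \<or> 2 * d = \<rho> \<and> pt a b = Q \<rho> (J - 1))"
    if ab: "pt a b \<in> lattice \<rho>" for a b
  proof -
    consider m n where "m < 0" "a = of_int m" "b = of_int n"
      | m n where "0 \<le> m" "a = \<rho> * of_int m" "b = \<rho> * of_int n"
      using ab unfolding pt_in_lattice[OF assms(1)] by blast
    then show ?thesis
    proof cases
      case (1 m n)
      show ?thesis
      proof (cases "m = -1")
        case True
        have "f a b = 1 * of_int (n - i) * (1 * of_int (n - i) + 2 * (- 1 / 2))" using left1[of b] 1 True by simp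
        then show ?thesis using 1 True lattice_line_power[of 1 "- 1 / 2" "n - i"] by (auto simp: P_pt Q_pt)
      next
        case False
        then have "m \<le> -2" using 1 by linarith
        then have "a \<le> -2" using 1 by linarith
        then show ?thesis using far[of a b] by (auto simp: P_pt Q_pt)
      qed
    next
      case (2 m n)
      show ?thesis
      proof (cases "m = 0")
        case True
        then have a: "a = 0" using 2 by simp
        have fe: "f a b = \<rho> * of_int (n - J) * (\<rho> * of_int (n - J) + 2 * d)"
          unfolding a right0 2 d_def by (simp add: power2_eq_square algebra_simps)
        show ?thesis
          using lattice_line_power[OF assms(1), of d "n - J"] d a 2 assms(1) unfolding fe by (auto simp: P_pt Q_pt)
      next
        case False
        then have "1 \<le> m" using 2 by linarith
        then have "\<rho> * 1 \<le> a" unfolding 2 using assms(1) by (intro mult_left_mono) auto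
        then show ?thesis using far[of a b] assms(1) by (auto simp: P_pt Q_pt)
      qed
    qed
  qed
  note PL = P_in_lattice[OF assms(1)] and QL = Q_in_lattice[OF assms(1)]
  have S: "left_edge_triangle \<rho> i = {P i, P (i + 1), Q \<rho> J}" unfolding left_edge_triangle_def J_def ..
  show ?thesis
  proof (rule circle_determinedI)
    show "f a b = a\<^sup>2 + a * b + b\<^sup>2 + (1 - d\<^sup>2 - of_int i) * a + (- 2 * of_int i) * b + ((of_int i)\<^sup>2 - d\<^sup>2)" for a b
      unfolding f_def by (simp add: power2_eq_square field_simps)
    show "left_edge_triangle \<rho> i \<noteq> {}" unfolding S by simp
    show "pt a b \<in> lattice \<rho> \<and> f a b = 0" if "pt a b \<in> left_edge_triangle \<rho> i" for a b
      using that lat[of a b] PL QL unfolding S by auto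
    show "0 \<le> f a b" if "pt a b \<in> lattice \<rho>" for a b using lat[OF that] by blast
    show "(\<forall>a b. pt a b \<in> lattice \<rho> \<longrightarrow> f a b = 0 \<longrightarrow> pt a b \<in> left_edge_triangle \<rho> i) \<or>
      (\<exists>k j. (\<forall>a b. pt a b \<in> lattice \<rho> \<and> f a b = 0 \<longleftrightarrow> pt a b \<in> quad \<rho> k j) \<and> left_edge_triangle \<rho> i \<in> convention_pair \<rho> k j)"
    proof (cases "2 * d = \<rho>")
      case True
      have "pt a b \<in> lattice \<rho> \<and> f a b = 0 \<longleftrightarrow> pt a b \<in> quad \<rho> i (J - 1)" for a b
        using lat[of a b] True PL QL unfolding quad_def by auto
      moreover have "left_edge_triangle \<rho> i \<in> convention_pair \<rho> i (J - 1)"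
        unfolding S convention_pair_def by simp
      ultimately show ?thesis by blast
    qed (use lat in \<open>auto simp: S\<close>)
  qed
qed

lemma right_edge_triangle_circle_determined:
  assumes "0 < \<rho>" "\<rho> \<le> 1"
  shows "circle_determined \<rho> (right_edge_triangle \<rho> j)"
proof -
  define t where "t = (of_int j + 1 / 2) * \<rho>"
  define i where "i = \<lceil>t\<rceil>"
  define e where "e = of_int i - 1 / 2 - t"
  \<comment> \<open>This value makes the power \<open>f\<close> vanish at the apex
    \<open>P i\<close>; the two points of the edge are zeros for every \<open>k\<close>.\<close>
  define k where "k = 1 / 4 - e\<^sup>2 + \<rho>\<^sup>2 / 4"
  define f where "f a b = (b + a / 2 - t)\<^sup>2 + 3 / 4 * a\<^sup>2 + (1 - k) * a - \<rho>\<^sup>2 / 4" for a b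
  have e: "e < 1 / 2" "- 1 / 2 \<le> e"
    unfolding e_def i_def by linarith+
  have e2: "e\<^sup>2 \<le> 1 / 4"
    using e power2_le_iff_abs_le[of "1/2" e] by (simp add: power_divide)
  have r2: "\<rho>\<^sup>2 \<le> 1" "0 < \<rho>\<^sup>2" using assms by (simp_all add: power_le_one)
  have k: "\<rho>\<^sup>2 / 4 \<le> k" "k \<le> 1" using e2 r2 zero_le_power2[of e] unfolding k_def by linarith+
  have right0: "f 0 b = (b - of_int j * \<rho>) * (b - (of_int j + 1) * \<rho>)" for b
    unfolding f_def t_def by (simp add: power2_eq_square field_simps)
  have left1: "f (-1) b = (b - of_int i) * (b - of_int i + 2 * e)" for b
    unfolding f_def k_def e_def by (simp add: power2_eq_square algebra_simps)
  have far: "0 < f a b" if "a \<le> -2 \<or> \<rho> \<le> a" for a b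
    using that
  proof
    assume "a \<le> -2"
    then show ?thesis unfolding f_def
      using far_left_positive[of a k] k r2 zero_le_power2[of "b + a / 2 - t"] by linarith
  next
    assume a: "\<rho> \<le> a"
    then have "\<rho>\<^sup>2 \<le> a\<^sup>2" using assms by (intro power_mono) auto
    moreover have "0 \<le> (1 - k) * a" using k a assms by (intro mult_nonneg_nonneg) auto
    ultimately show ?thesis unfolding f_def
      using r2 zero_le_power2[of "b + a / 2 - t"] by linarith
  qed
  have lat: "0 \<le> f a b \<and> (f a b = 0 \<longleftrightarrow> pt a b \<in> {P i, Q \<rho> j, Q \<rho> (j + 1)} \<or> 2 * e = -1 \<and> pt a b = P (i + 1))"
    if ab: "pt a b \<in> lattice \<rho>" for a b
  proof -
    consider m n where "m < 0" "a = of_int m" "b = of_int n"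
      | m n where "0 \<le> m" "a = \<rho> * of_int m" "b = \<rho> * of_int n"
      using ab unfolding pt_in_lattice[OF assms(1)] by blast
    then show ?thesis
    proof cases
      case (1 m n)
      show ?thesis
      proof (cases "m = -1")
        case True
        then have a: "a = -1" using 1 by simp
        have fe: "f a b = 1 * of_int (n - i) * (1 * of_int (n - i) + 2 * e)" unfolding a left1 1 by simp
        show ?thesis using lattice_line_power[of 1 e "n - i"] e a 1 unfolding fe by (auto simp: P_pt Q_pt)
      next
        case False
        then have "m \<le> -2" using 1 by linarith
        then have "a \<le> -2" using 1 by linarith
        then show ?thesis using far[of a b] by (auto simp: P_pt Q_pt)
      qed
    next
      case (2 m n)
      show ?thesis
      proof (cases "m = 0")
        case True
        have "f a b = \<rho> * of_int (n - j) * (\<rho> * of_int (n - j) + 2 * (- \<rho> / 2))" using right0[of b] 2 True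
          by (simp add: power2_eq_square algebra_simps)
        then show ?thesis using 2 True assms(1) lattice_line_power[of \<rho> "- \<rho> / 2" "n - j"] by (auto simp: P_pt Q_pt mult.commute)
      next
        case False
        then have "1 \<le> m" using 2 by linarith
        then have "\<rho> * 1 \<le> a" unfolding 2 using assms(1) by (intro mult_left_mono) auto
        then show ?thesis using far[of a b] assms(1) by (auto simp: P_pt Q_pt)
      qed
    qed
  qed
  note PL = P_in_lattice[OF assms(1)] and QL = Q_in_lattice[OF assms(1)]
  have S: "right_edge_triangle \<rho> j = {P i, Q \<rho> j, Q \<rho> (j + 1)}" unfolding right_edge_triangle_def i_def t_def ..
  show ?thesis
  proof (rule circle_determinedI)
    show "f a b = a\<^sup>2 + a * b + b\<^sup>2 + (1 - k - t) * a + (- 2 * t) * b + (t\<^sup>2 - \<rho>\<^sup>2 / 4)" for a b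
      unfolding f_def by (simp add: power2_eq_square field_simps)
    show "right_edge_triangle \<rho> j \<noteq> {}" unfolding S by simp
    show "pt a b \<in> lattice \<rho> \<and> f a b = 0" if "pt a b \<in> right_edge_triangle \<rho> j" for a b
      using that lat[of a b] PL QL unfolding S by auto
    show "0 \<le> f a b" if "pt a b \<in> lattice \<rho>" for a b using lat[OF that] by blast
    show "(\<forall>a b. pt a b \<in> lattice \<rho> \<longrightarrow> f a b = 0 \<longrightarrow> pt a b \<in> right_edge_triangle \<rho> j) \<or>
      (\<exists>k l. (\<forall>a b. pt a b \<in> lattice \<rho> \<and> f a b = 0 \<longleftrightarrow> pt a b \<in> quad \<rho> k l) \<and> right_edge_triangle \<rho> j \<in> convention_pair \<rho> k l)"
    proof (cases "2 * e = -1")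
      case True
      have "pt a b \<in> lattice \<rho> \<and> f a b = 0 \<longleftrightarrow> pt a b \<in> quad \<rho> i j" for a b
        using lat[of a b] True PL QL unfolding quad_def by auto
      moreover have "right_edge_triangle \<rho> j \<in> convention_pair \<rho> i j"
        unfolding S convention_pair_def by simp
      ultimately show ?thesis by blast
    qed (use lat in \<open>auto simp: S\<close>)
  qed
qed

section \<open>The triangles cover the plane\<close>

lemma convex_hull_3I:
  assumes "0 \<le> u" "0 \<le> v" "0 \<le> w" "u + v + w = 1" "x = u *\<^sub>R a + v *\<^sub>R b + w *\<^sub>R c"
  shows "x \<in> convex hull {a, b, c}"
  unfolding convex_hull_3 using assms by blast

lemma mult_floor_divide_bounds:
  assumes "0 < (s::real)"
  shows "s * of_int \<lfloor>x / s\<rfloor> \<le> x" "x \<le> s * (of_int \<lfloor>x / s\<rfloor> + 1)"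
proof -
  have "of_int \<lfloor>x / s\<rfloor> \<le> x / s" "x / s \<le> of_int \<lfloor>x / s\<rfloor> + 1" by linarith+
  then have "s * of_int \<lfloor>x / s\<rfloor> \<le> s * (x / s)" "s * (x / s) \<le> s * (of_int \<lfloor>x / s\<rfloor> + 1)"
    using assms by (metis mult_left_mono less_imp_le)+
  moreover have "s * (x / s) = x" using assms by simp
  ultimately show "s * of_int \<lfloor>x / s\<rfloor> \<le> x" "x \<le> s * (of_int \<lfloor>x / s\<rfloor> + 1)"
    by metis+
qed

lemma cover_grid:
  assumes "0 < s" "s * m \<le> a" "a \<le> s * (real_of_int m + 1)"
  shows "\<exists>n. pt a b \<in> convex hull (grid_low s m n) \<union> convex hull (grid_up s m n)"
proof -
  define n where "n = \<lfloor>b / s\<rfloor>"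
  define x y where "x = a / s - m" and "y = b / s - n"
  have xy: "0 \<le> x" "x \<le> 1"
    using assms unfolding x_def by (simp_all add: field_simps)
  have y: "0 \<le> y" "y \<le> 1"
    unfolding y_def n_def by linarith+
  have ab: "a = s * (m + x)" "b = s * (n + y)" using assms(1) by (auto simp: x_def y_def)
  show ?thesis
  proof (cases "x + y \<le> 1")
    case True
    have "pt a b = (1 - x - y) *\<^sub>R pt (s * m) (s * n) + x *\<^sub>R pt (s * (m + 1)) (s * n) + y *\<^sub>R pt (s * m) (s * (n + 1))"
      unfolding pt_scaleR pt_add ab by (simp add: algebra_simps)
    then have "pt a b \<in> convex hull (grid_low s m n)"
      unfolding grid_low_def using xy y True by (intro convex_hull_3I[of "1 - x - y" x y]) auto
    then show ?thesis by blast
  next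
    case False
    have "pt a b = (x + y - 1) *\<^sub>R pt (s * (m + 1)) (s * (n + 1)) + (1 - x) *\<^sub>R pt (s * m) (s * (n + 1)) + (1 - y) *\<^sub>R pt (s * (m + 1)) (s * n)"
      unfolding pt_scaleR pt_add ab by (simp add: algebra_simps)
    then have "pt a b \<in> convex hull (grid_up s m n)"
      unfolding grid_up_def using xy y False by (intro convex_hull_3I[of "x + y - 1" "1 - x" "1 - y"]) auto
    then show ?thesis by blast
  qed
qed

text \<open>The column at ratio \<open>\<mu>\<close> between apex and edge cuts the triangle in a
  segment, whose end points are the two bounds for \<open>y\<close>.\<close>

lemma pt_in_hull_edge:
  assumes "0 < \<mu>" "\<mu> < 1" "p < q" "\<mu> * p + (1 - \<mu>) * z \<le> y" "y \<le> \<mu> * q + (1 - \<mu>) * z"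
  shows "pt (\<mu> * h + (1 - \<mu>) * h') y \<in> convex hull {pt h p, pt h q, pt h' z}"
proof -
  define u where "u = (y - (1 - \<mu>) * z - \<mu> * p) / (q - p)"
  have u: "0 \<le> u" "u \<le> \<mu>" and y: "y = \<mu> * p + (1 - \<mu>) * z + u * (q - p)"
    using assms unfolding u_def by (auto simp: field_simps)
  have "pt (\<mu> * h + (1 - \<mu>) * h') y = (\<mu> - u) *\<^sub>R pt h p + u *\<^sub>R pt h q + (1 - \<mu>) *\<^sub>R pt h' z"
    unfolding pt_scaleR pt_add y by (simp add: algebra_simps)
  then show ?thesis
    using u assms by (intro convex_hull_3I[of "\<mu> - u" u "1 - \<mu>"]) auto
qed

text \<open>Between the edges \<open>P i Q (J i)\<close> and \<open>P (i + 1) Q (J (i + 1))\<close>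
  lie one triangle on the edge \<open>P i P (i + 1)\<close> and a fan of triangles with apex
  \<open>P (i + 1)\<close> over the \<open>Q\<close> points from \<open>J i\<close> to
  \<open>J (i + 1)\<close>. The point is located first between two such edges, then inside the
  fan.\<close>

lemma cover_interface:
  assumes "0 < \<rho>" "-1 < a" "a < 0"
  shows "\<exists>S\<in>interface_triangles \<rho>. pt a b \<in> convex hull S"
proof -
  define \<mu> where "\<mu> = - a"
  have mu: "0 < \<mu>" "\<mu> < 1" using assms by (simp_all add: \<mu>_def)
  define J where "J i = \<lfloor>of_int i / \<rho> + 1 / 2\<rfloor>" for i
  \<comment> \<open>The height at which the edge from \<open>P i\<close> to its apex on the
    \<open>Q\<close> column crosses the column \<open>a\<close>.\<close>
  define g where "g i = \<mu> * of_int i + (1 - \<mu>) * (\<rho> * of_int (J i))" for i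
  have J: "of_int i - \<rho> / 2 < \<rho> * of_int (J i)" "\<rho> * of_int (J i) \<le> of_int i + \<rho> / 2" for i
  proof -
    have "of_int (J i) \<le> of_int i / \<rho> + 1 / 2" "of_int i / \<rho> + 1 / 2 < of_int (J i) + 1"
      unfolding J_def by linarith+
    then show "of_int i - \<rho> / 2 < \<rho> * of_int (J i)" "\<rho> * of_int (J i) \<le> of_int i + \<rho> / 2"
      using assms(1) by (simp_all add: field_simps)
  qed
  have g: "of_int i - \<rho> \<le> g i" "g i \<le> of_int i + \<rho>" for i
  proof -
    have "g i - of_int i = (1 - \<mu>) * (\<rho> * of_int (J i) - of_int i)"
      unfolding g_def by (simp add: algebra_simps)
    moreover have "\<bar>(1 - \<mu>) * (\<rho> * of_int (J i) - of_int i)\<bar> \<le> 1 * \<rho>"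
      unfolding abs_mult using mu J[of i] by (intro mult_mono) auto
    ultimately show "of_int i - \<rho> \<le> g i" "g i \<le> of_int i + \<rho>" by linarith+
  qed
  obtain i where i: "g i \<le> b" "b < g (i + 1)"
  proof -
    \<comment> \<open>\<open>I\<close> is unbounded below, so the maximum is taken from
      \<open>\<lfloor>b - \<rho>\<rfloor>\<close> upwards; this index belongs to \<open>I\<close>
      because \<open>g i\<close> differs from \<open>i\<close> by at most
      \<open>\<rho>\<close>.\<close>
    define I where "I = {i. g i \<le> b}"
    have "\<lfloor>b - \<rho>\<rfloor> \<in> I" unfolding I_def using g(2)[of "\<lfloor>b - \<rho>\<rfloor>"] by simp linarith
    moreover have bound: "i \<le> \<lceil>b + \<rho>\<rceil>" if "i \<in> I" for i
      using that g(1)[of i] unfolding I_def by simp linarith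
    have "finite (I \<inter> {\<lfloor>b - \<rho>\<rfloor>..})"
      by (rule finite_subset[of _ "{\<lfloor>b - \<rho>\<rfloor>..\<lceil>b + \<rho>\<rceil>}"]) (use bound in auto)
    define i where "i = Max (I \<inter> {\<lfloor>b - \<rho>\<rfloor>..})"
    have "i \<in> I \<inter> {\<lfloor>b - \<rho>\<rfloor>..}"
      unfolding i_def using \<open>finite _\<close> \<open>\<lfloor>b - \<rho>\<rfloor> \<in> I\<close> by (intro Max_in) auto
    moreover have "i + 1 \<notin> I"
    proof
      assume "i + 1 \<in> I"
      then have "i + 1 \<in> I \<inter> {\<lfloor>b - \<rho>\<rfloor>..}" using \<open>i \<in> I \<inter> {\<lfloor>b - \<rho>\<rfloor>..}\<close> by auto
      then have "i + 1 \<le> i" unfolding i_def by (rule Max_ge[OF \<open>finite _\<close>])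
      then show False by simp
    qed
    ultimately show thesis using that[of i] unfolding I_def by auto
  qed
  have a: "a = \<mu> * (-1) + (1 - \<mu>) * 0" "a = (1 - \<mu>) * 0 + (1 - (1 - \<mu>)) * (-1)" by (auto simp: \<mu>_def)
  show ?thesis
  proof (cases "b \<le> \<mu> * of_int (i + 1) + (1 - \<mu>) * (\<rho> * of_int (J i))")
    case True
    then have "pt a b \<in> convex hull {pt (-1) (of_int i), pt (-1) (of_int (i + 1)), pt 0 (\<rho> * of_int (J i))}"
      unfolding a(1) using mu i(1) unfolding g_def by (intro pt_in_hull_edge) auto
    then have "pt a b \<in> convex hull (left_edge_triangle \<rho> i)"
      unfolding left_edge_triangle_def P_pt Q_pt J_def by (simp add: mult.commute)
    then show ?thesis unfolding interface_triangles_def by blast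
  next
    case False
    \<comment> \<open>Projection of the point from \<open>P (i + 1)\<close> onto the
      \<open>Q\<close> column; it selects the triangle of the fan.\<close>
    define Y where "Y = (b - \<mu> * of_int (i + 1)) / (1 - \<mu>)"
    define j where "j = \<lfloor>Y / \<rho>\<rfloor>"
    have b: "b = (1 - \<mu>) * Y + \<mu> * of_int (i + 1)" using mu unfolding Y_def by simp
    have Y: "\<rho> * of_int (J i) < Y" "Y < \<rho> * of_int (J (i + 1))"
      using False i(2) mu unfolding b g_def by auto
    have j: "\<rho> * of_int j \<le> Y" "Y \<le> \<rho> * (of_int j + 1)"
      unfolding j_def by (rule mult_floor_divide_bounds[OF assms(1)])+
    have "\<rho> * of_int (J i) < \<rho> * of_int (j + 1)" "\<rho> * of_int j < \<rho> * of_int (J (i + 1))"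
      using Y j by simp_all
    then have "J i \<le> j" "j + 1 \<le> J (i + 1)" using assms(1) by simp_all
    then have "\<rho> * of_int (J i) \<le> \<rho> * of_int j" "\<rho> * of_int (j + 1) \<le> \<rho> * of_int (J (i + 1))"
      using assms(1) by (auto intro!: mult_left_mono)
    then have "of_int i < (of_int j + 1 / 2) * \<rho>" "(of_int j + 1 / 2) * \<rho> \<le> of_int (i + 1)"
      using J(1)[of i] J(2)[of "i + 1"] by (auto simp: algebra_simps)
    \<comment> \<open>Both apices are nearest multiples of \<open>\<rho>\<close>, which confines
      \<open>(j + 1 / 2) * \<rho>\<close> to the interval from \<open>i\<close> to
      \<open>i + 1\<close>; the fan triangle over \<open>Q j\<close> is therefore the right edge
      triangle of \<open>j\<close>.\<close>
    then have ceil: "\<lceil>(of_int j + 1 / 2) * \<rho>\<rceil> = i + 1" by (intro ceiling_unique) auto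
    have "pt a b \<in> convex hull {pt 0 (\<rho> * of_int j), pt 0 (\<rho> * of_int (j + 1)), pt (-1) (of_int (i + 1))}"
      unfolding a(2)
    proof (rule pt_in_hull_edge)
      show "(1 - \<mu>) * (\<rho> * of_int j) + (1 - (1 - \<mu>)) * of_int (i + 1) \<le> b"
        "b \<le> (1 - \<mu>) * (\<rho> * of_int (j + 1)) + (1 - (1 - \<mu>)) * of_int (i + 1)"
        unfolding b using mu j by (auto intro!: mult_left_mono)
    qed (use mu assms(1) in auto)
    then have "pt a b \<in> convex hull (right_edge_triangle \<rho> j)"
      unfolding right_edge_triangle_def P_pt Q_pt ceil by (simp add: mult.commute insert_commute)
    then show ?thesis unfolding interface_triangles_def by blast
  qed
qed

lemma lattice_triangles_nondegenerate:
  assumes "0 < \<rho>" "S \<in> lattice_triangles \<rho>"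
  shows "card S = 3" "\<not> collinear S"
proof -
  have grid: "card (grid_low s m n) = 3 \<and> \<not> collinear (grid_low s m n)"
     "card (grid_up s m n) = 3 \<and> \<not> collinear (grid_up s m n)" if "0 < s" for s m n
    unfolding grid_low_def grid_up_def using that
    by (auto simp: card_insert_if algebra_simps intro!: not_collinear_pt)
  have "card (left_edge_triangle \<rho> i) = 3 \<and> \<not> collinear (left_edge_triangle \<rho> i)"
     "card (right_edge_triangle \<rho> i) = 3 \<and> \<not> collinear (right_edge_triangle \<rho> i)" for i
    unfolding left_edge_triangle_def right_edge_triangle_def P_pt Q_pt using assms(1)
    by (auto simp: card_insert_if algebra_simps intro!: not_collinear_pt)
  then have "card S = 3 \<and> \<not> collinear S"
    using assms grid unfolding lattice_triangles_def grid_triangles_def interface_triangles_def by auto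
  then show "card S = 3" "\<not> collinear S" by auto
qed

lemma lattice_triangulation_eq:
  assumes "0 < \<rho>" "\<rho> \<le> 1"
  shows "lattice_triangulation \<rho> = lattice_triangles \<rho>"
proof (rule lattice_triangulation_eqI[OF assms(1)])
  fix S assume S: "S \<in> lattice_triangles \<rho>"
  note L = P_in_lattice[OF assms(1)] Q_in_lattice[OF assms(1)]
  have interface: "left_edge_triangle \<rho> i \<subseteq> lattice \<rho> \<and> circle_determined \<rho> (left_edge_triangle \<rho> i)"
    "right_edge_triangle \<rho> i \<subseteq> lattice \<rho> \<and> circle_determined \<rho> (right_edge_triangle \<rho> i)" for i
    using left_edge_triangle_circle_determined[OF assms] right_edge_triangle_circle_determined[OF assms] L
    by (auto simp: left_edge_triangle_def right_edge_triangle_def)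
  have grid: "S \<subseteq> lattice \<rho> \<and> circle_determined \<rho> S"
    if "S \<in> grid_triangles 1 {..-2} \<or> S \<in> grid_triangles \<rho> {0..}"
    using that grid_triangle_circle_determined[OF assms]
    unfolding grid_triangles_def mem_Collect_eq Un_iff atMost_iff atLeast_iff by metis
  show "S \<subseteq> lattice \<rho> \<and> card S = 3 \<and> \<not> collinear S \<and> circle_determined \<rho> S"
    using lattice_triangles_nondegenerate[OF assms(1) S] S grid interface
    unfolding lattice_triangles_def interface_triangles_def by blast
next
  fix x
  obtain a b where x: "x = pt a b" by (rule pt_surj)
  consider "a \<le> -1" | "-1 < a" "a < 0" | "0 \<le> a" by linarith
  then show "\<exists>S\<in>lattice_triangles \<rho>. x \<in> convex hull S"
  proof cases
    case 1
    \<comment> \<open>The ceiling instead of the floor sends the border column \<open>a = -1\<close>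
      to the cell \<open>m = -2\<close>, the last one left of the interface.\<close>
    define m where "m = \<lceil>a\<rceil> - 1"
    have "of_int m \<le> a" "a \<le> of_int m + 1" "m \<in> {..-2}" using 1 unfolding m_def by (auto; linarith)+
    then obtain n where "pt a b \<in> convex hull (grid_low 1 m n) \<union> convex hull (grid_up 1 m n)"
      using cover_grid[of 1 m a b] by auto
    with \<open>m \<in> {..-2}\<close> show ?thesis unfolding x lattice_triangles_def grid_triangles_def by blast
  next
    case 2
    then show ?thesis using cover_interface[OF assms(1) 2] unfolding x lattice_triangles_def by blast
  next
    case 3
    define m where "m = \<lfloor>a / \<rho>\<rfloor>"
    have "\<rho> * of_int m \<le> a" "a \<le> \<rho> * (of_int m + 1)" "m \<in> {0..}"
      using 3 assms(1) unfolding m_def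
      by (auto simp: mult_floor_divide_bounds)
    then obtain n where "pt a b \<in> convex hull (grid_low \<rho> m n) \<union> convex hull (grid_up \<rho> m n)"
      using cover_grid[OF assms(1), of m a b] by auto
    with \<open>m \<in> {0..}\<close> show ?thesis unfolding x lattice_triangles_def grid_triangles_def by blast
  qed
next
  show "concyclic_convention \<rho> (lattice_triangles \<rho>)"
    unfolding concyclic_convention_def
  proof (intro allI impI)
    fix i j assume "\<exists>c r. {P i, P (i + 1), Q \<rho> j, Q \<rho> (j + 1)} \<subseteq> sphere c r"
    then obtain c r where c: "{P i, P (i + 1), Q \<rho> j, Q \<rho> (j + 1)} \<subseteq> sphere c r" by blast
    obtain u v where uv: "c = pt u v" by (rule pt_surj)
    have dist_eq: "(dist c (P i))\<^sup>2 = (dist c (P (i + 1)))\<^sup>2" "(dist c (Q \<rho> j))\<^sup>2 = (dist c (Q \<rho> (j + 1)))\<^sup>2"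
      using c by auto
    \<comment> \<open>The centre lies on the perpendicular bisectors of both edges. Equating the two
      conditions shows that a quadruple is concyclic only if
      \<open>i = (j + 1 / 2) * \<rho>\<close>, which is exactly the tie in both rounding
      rules.\<close>
    have "2 * v + u = 2 * of_int i"
      using dist_eq(1) unfolding uv P_pt Q_pt dist_norm pt_diff norm_pt by (simp add: power2_eq_square algebra_simps)
    moreover have "\<rho> * (2 * v + u) = \<rho> * (\<rho> * (2 * of_int j + 1))"
      using dist_eq(2) unfolding uv P_pt Q_pt dist_norm pt_diff norm_pt by (simp add: power2_eq_square algebra_simps)
    then have "2 * v + u = \<rho> * (2 * of_int j + 1)"
      using assms(1) mult_left_cancel[of \<rho> "2 * v + u"] by blast
    ultimately have "2 * of_int i = \<rho> * (2 * of_int j + 1)" by simp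
    then have i: "of_int i = (of_int j + 1 / 2) * \<rho>" by (simp add: algebra_simps)
    have "\<lceil>(of_int j + 1 / 2) * \<rho>\<rceil> = i" unfolding i[symmetric] by simp
    then have "{P i, Q \<rho> j, Q \<rho> (j + 1)} = right_edge_triangle \<rho> j"
      unfolding right_edge_triangle_def by simp
    moreover have "of_int i / \<rho> + 1 / 2 = of_int (j + 1)" using assms(1) i by simp
    then have "{P i, P (i + 1), Q \<rho> (j + 1)} = left_edge_triangle \<rho> i"
      unfolding left_edge_triangle_def by (metis floor_of_int)
    ultimately show "{P i, Q \<rho> j, Q \<rho> (j + 1)} \<in> lattice_triangles \<rho> \<and> {P i, P (i + 1), Q \<rho> (j + 1)} \<in> lattice_triangles \<rho>"
      unfolding lattice_triangles_def interface_triangles_def by auto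
  qed
qed

subsection \<open>The cost of the matched lattices\<close>

lemma norm_pt_axis: "0 \<le> s \<Longrightarrow> norm (pt s 0) = s" "0 \<le> s \<Longrightarrow> norm (pt 0 s) = s"
  "0 \<le> s \<Longrightarrow> norm (pt s (- s)) = s" "norm (pt (- a) (- b)) = norm (pt a b)"
  by (auto simp: norm_pt_sqrt power2_eq_square)

lemma grid_triangles_edge:
  assumes "0 < s" "S \<in> grid_triangles s I" "x \<in> S" "y \<in> S" "x \<noteq> y"
  shows "norm (x - y) = s"
proof -
  have "norm (pt (- s) 0) = s" "norm (pt 0 (- s)) = s" "norm (pt (- s) s) = s"
    using norm_pt_axis(4)[of s 0] norm_pt_axis(4)[of 0 s] norm_pt_axis(4)[of s "- s"] norm_pt_axis(1-3)[of s] assms(1) by auto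
  then show ?thesis
    using assms norm_pt_axis[of s]
    by (auto simp: grid_triangles_def grid_low_def grid_up_def pt_diff algebra_simps)
qed

text \<open>Bonds of the first two kinds have the rest length belonging to the half lattice of
  \<open>x\<close>, so they cost nothing under the identity with \<open>lam = \<rho>\<close>. What
  remains are the bonds across the interface, and the crude bound 2 on their offset suffices for
  counting them.\<close>

lemma nearest_neighbours_cases:
  assumes rho: "0 < \<rho>" "\<rho> \<le> 1" and nn: "nearest_neighbours \<rho> x y"
  obtains "norm (x - y) = 1" "x \<notin> lattice_plus \<rho>" | "norm (x - y) = \<rho>" "x \<notin> lattice_minus"
    | i j where "{x, y} = {P i, Q \<rho> j}" "\<bar>of_int j * \<rho> - of_int i\<bar> \<le> 2"
proof -
  obtain S where S: "S \<in> lattice_triangles \<rho>" "x \<in> S" "y \<in> S" "x \<noteq> y"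
    using nn unfolding nearest_neighbours_def lattice_triangulation_eq[OF rho] by blast
  have minus: "a < 0" if "pt a b \<in> lattice_minus" for a b
    using that unfolding lattice_minus_pt by auto
  have plus: "0 \<le> a" if "pt a b \<in> lattice_plus \<rho>" for a b
    using that rho unfolding lattice_plus_pt[OF rho(1)] by auto
  consider "S \<in> grid_triangles 1 {..-2}" | "S \<in> grid_triangles \<rho> {0..}" | "S \<in> interface_triangles \<rho>"
    using S(1) unfolding lattice_triangles_def by blast
  then show thesis
  proof cases
    case 1
    have "x \<notin> lattice_plus \<rho>"
      using 1 S(2) by (auto simp: grid_triangles_def grid_low_def grid_up_def dest!: plus)
    then show thesis using that(1) grid_triangles_edge[OF _ 1 S(2-4)] by simp
  next
    case 2
    have "x \<notin> lattice_minus"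
      using 2 S(2) rho by (auto simp: grid_triangles_def grid_low_def grid_up_def mult_less_0_iff dest!: minus)
    then show thesis using that(2) grid_triangles_edge[OF rho(1) 2 S(2-4)] by simp
  next
    case 3
    have minus_plus: "P i \<notin> lattice_plus \<rho>" "Q \<rho> j \<notin> lattice_minus" for i j
      by (auto simp: P_pt Q_pt dest!: plus minus)
    have dist_P: "norm (P i - P (i + 1)) = 1" "norm (P (i + 1) - P i) = 1" for i
      using norm_pt_axis(4)[of 0 1] norm_pt_axis(2)[of 1] by (auto simp: P_pt pt_diff)
    have dist_Q: "norm (Q \<rho> j - Q \<rho> (j + 1)) = \<rho>" "norm (Q \<rho> (j + 1) - Q \<rho> j) = \<rho>" for j
      using norm_pt_axis(4)[of 0 \<rho>] norm_pt_axis(2)[of \<rho>] rho by (auto simp: Q_pt pt_diff algebra_simps)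
    from 3 consider i where "S = left_edge_triangle \<rho> i" | j where "S = right_edge_triangle \<rho> j"
      unfolding interface_triangles_def by blast
    then show thesis
    proof cases
      case (1 i)
      define J where "J = \<lfloor>of_int i / \<rho> + 1 / 2\<rfloor>"
      have "of_int J \<le> of_int i / \<rho> + 1 / 2" "of_int i / \<rho> + 1 / 2 < of_int J + 1"
        unfolding J_def by linarith+
      then have "of_int i - \<rho> / 2 < of_int J * \<rho>" "of_int J * \<rho> \<le> of_int i + \<rho> / 2"
        using rho(1) by (simp_all add: field_simps)
      then have J: "\<bar>of_int J * \<rho> - of_int i\<bar> \<le> 2" "\<bar>of_int J * \<rho> - of_int (i + 1)\<bar> \<le> 2"
        using rho by auto
      consider "{x, y} = {P i, P (i + 1)}" | "{x, y} = {P i, Q \<rho> J}" | "{x, y} = {P (i + 1), Q \<rho> J}"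
        using S(2-4) unfolding 1 left_edge_triangle_def J_def by auto
      then show thesis
      proof cases
        case 1
        then show thesis using that(1) dist_P minus_plus by (auto simp: doubleton_eq_iff)
      qed (use that(3) J in blast)+
    next
      case (2 j)
      define i where "i = \<lceil>(of_int j + 1 / 2) * \<rho>\<rceil>"
      have "(of_int j + 1 / 2) * \<rho> \<le> of_int i" "of_int i < (of_int j + 1 / 2) * \<rho> + 1" unfolding i_def by linarith+
      then have i: "\<bar>of_int j * \<rho> - of_int i\<bar> \<le> 2" "\<bar>of_int (j + 1) * \<rho> - of_int i\<bar> \<le> 2"
        using rho by (auto simp: algebra_simps)
      consider "{x, y} = {Q \<rho> j, Q \<rho> (j + 1)}" | "{x, y} = {P i, Q \<rho> j}" | "{x, y} = {P i, Q \<rho> (j + 1)}"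
        using S(2-4) unfolding 2 right_edge_triangle_def i_def by auto
      then show thesis
      proof cases
        case 1
        then show thesis using that(2) dist_Q minus_plus by (auto simp: doubleton_eq_iff)
      qed (use that(3) i in blast)+
    qed
  qed
qed

lemma closure_strip_bounds:
  fixes x :: "real^2"
  assumes "x \<in> closure (strip k)"
  shows "0 \<le> x $ 2" "x $ 2 \<le> sqrt 3 / 2 * real k"
proof -
  have "closure (strip k) \<subseteq> {x :: real^2. 0 \<le> x $ 2} \<inter> {x :: real^2. x $ 2 \<le> sqrt 3 / 2 * real k}"
    by (intro closure_minimal closed_Int closed_Collect_le continuous_intros) (auto simp: strip_def)
  then show "0 \<le> x $ 2" "x $ 2 \<le> sqrt 3 / 2 * real k" using assms by auto
qed

lemma infsum_ennreal_le:
  fixes f :: "'a \<Rightarrow> ennreal"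
  assumes "finite B" "\<And>x. x \<in> A - B \<Longrightarrow> f x = 0" "\<And>x. x \<in> A \<inter> B \<Longrightarrow> f x \<le> c"
  shows "infsum f A \<le> of_nat (card B) * c"
proof -
  have "infsum f A = infsum f (A \<inter> B)"
    by (rule infsum_cong_neutral) (use assms(2) in auto)
  also have "\<dots> = sum f (A \<inter> B)" using assms(1) by simp
  also have "\<dots> \<le> of_nat (card (A \<inter> B)) * c" by (rule sum_bounded_above) (use assms(3) in auto)
  also have "\<dots> \<le> of_nat (card B) * c"
    using assms(1) by (intro mult_right_mono) (auto intro!: card_mono)
  finally show ?thesis .
qed

lemma identity_admissible:
  "(\<lambda>x. x) \<in> admissible \<rho> k" "has_gradient_on (\<lambda>x. x) (mat 1) X"
proof -
  show grad: "has_gradient_on (\<lambda>x. x) (mat 1) X" for X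
    by (simp add: has_gradient_on_def)
  have "frechet_derivative (\<lambda>x. x) (at x) = (\<lambda>h. h)" for x :: "real^2"
    by (rule frechet_derivative_at[symmetric]) (rule has_derivative_ident)
  then have "jacobian (\<lambda>x. x) (at x) = mat 1" for x :: "real^2"
    by (simp add: jacobian_def matrix_id_mat_1[unfolded id_def])
  then show "(\<lambda>x. x) \<in> admissible \<rho> k"
    using grad by (auto simp: admissible_def)
qed

abbreviation bonds :: "real \<Rightarrow> nat \<Rightarrow> (real^2) set \<Rightarrow> ((real^2) \<times> (real^2)) set" where
  "bonds \<rho> k L \<equiv> {(x, y). nearest_neighbours \<rho> x y \<and> x \<in> L \<inter> closure (strip k) \<and> y \<in> lattice \<rho> \<inter> closure (strip k)}"

lemma energy_identity_le:
  assumes rho: "0 < \<rho>" "\<rho> \<le> 1"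
  shows "\<exists>C>0. \<forall>k. energy \<rho> (\<lambda>x. x) \<rho> k \<le> ennreal (C * (real k + 1))"
proof -
  \<comment> \<open>The offset bound puts \<open>j\<close> within \<open>2 / \<rho>\<close> of
    \<open>i / \<rho>\<close>; the additional 1 pays for the floor in \<open>B\<close>.\<close>
  define N where "N = \<lceil>2 / \<rho>\<rceil> + 1"
  have "0 < 2 / \<rho>" using rho by simp
  then have N: "1 \<le> N" "2 / \<rho> + 1 \<le> of_int N" unfolding N_def by linarith+
  define B where "B k = (\<lambda>(i, l). (P i, Q \<rho> (\<lfloor>of_int i / \<rho>\<rfloor> + l))) ` ({0..int k} \<times> {-N..N})" for k
  have B_fin: "finite (B k)" for k unfolding B_def by simp
  have B_card: "card (B k) \<le> (k + 1) * nat (2 * N + 1)" for k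
    unfolding B_def by (rule order.trans[OF card_image_le]) (auto simp: card_cartesian_product nat_add_distrib)
  have B_mem: "(P i, Q \<rho> j) \<in> B k" if "P i \<in> closure (strip k)" "\<bar>of_int j * \<rho> - of_int i\<bar> \<le> 2" for i j k
  proof -
    have "0 \<le> real_of_int i * (sqrt 3 / 2)" "real_of_int i * (sqrt 3 / 2) \<le> real k * (sqrt 3 / 2)"
      using closure_strip_bounds[OF that(1)] unfolding P_pt by (auto simp: mult.commute)
    then have i: "0 \<le> i" "i \<le> int k" by (auto simp: zero_le_mult_iff)
    have "\<bar>of_int j - of_int i / \<rho>\<bar> = \<bar>of_int j * \<rho> - of_int i\<bar> / \<rho>"
      using rho(1) by (simp add: field_simps abs_divide)
    also have "\<dots> \<le> 2 / \<rho>" using that(2) rho(1) by (intro divide_right_mono) auto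
    finally have "\<bar>of_int j - of_int i / \<rho>\<bar> \<le> 2 / \<rho>" .
    then have "\<bar>j - \<lfloor>of_int i / \<rho>\<rfloor>\<bar> \<le> N" using N(2) by linarith
    then show ?thesis unfolding B_def using i
      by (intro image_eqI[of _ _ "(i, j - \<lfloor>of_int i / \<rho>\<rfloor>)"]) auto
  qed
  have norm_PQ: "norm (P i - Q \<rho> j) \<le> 3" if "\<bar>of_int j * \<rho> - of_int i\<bar> \<le> 2" for i j
  proof -
    have "P i - Q \<rho> j = pt (-1) 0 + (of_int i - of_int j * \<rho>) *\<^sub>R pt 0 1"
      by (simp add: P_pt Q_pt pt_diff pt_scaleR pt_add)
    then have "norm (P i - Q \<rho> j) \<le> norm (pt (-1) 0) + \<bar>of_int i - of_int j * \<rho>\<bar> * norm (pt 0 1)"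
      by (metis norm_triangle_ineq norm_scaleR)
    then show ?thesis using that norm_pt_axis(4)[of 1 0] norm_pt_axis(1,2)[of 1] by auto
  qed
  have cost: "ennreal ((r - c)\<^sup>2) \<le> 9" if "0 \<le> r" "r \<le> 3" "0 < c" "c \<le> 1" for r c :: real
  proof -
    have "\<bar>r - c\<bar> \<le> 3" using that by auto
    then have "(r - c)\<^sup>2 \<le> 3\<^sup>2" using power2_le_iff_abs_le[of 3 "r - c"] by simp
    then have "ennreal ((r - c)\<^sup>2) \<le> ennreal 9" by (intro ennreal_leI) simp
    then show ?thesis by simp
  qed
  \<comment> \<open>The energy sums over ordered pairs, so every bond across the interface may occur
    in both directions.\<close>
  define B' where "B' k = B k \<union> prod.swap ` B k" for k
  have B'_fin: "finite (B' k)" for k using B_fin by (simp add: B'_def)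
  have half: "infsum (\<lambda>(x, y). ennreal ((norm (x - y) - c)\<^sup>2)) (bonds \<rho> k L) \<le> of_nat (card (B' k)) * 9"
    if L: "L = lattice_minus \<and> c = 1 \<or> L = lattice_plus \<rho> \<and> c = \<rho>" for L c k
  proof (rule infsum_ennreal_le[OF B'_fin])
    fix p assume p: "p \<in> bonds \<rho> k L - B' k"
    obtain x y where xy: "p = (x, y)" by (cases p)
    have nn: "nearest_neighbours \<rho> x y" using p xy by simp
    have "norm (x - y) = c"
      using nearest_neighbours_cases[OF rho nn]
    proof cases
      case (3 i j)
      then have "P i \<in> closure (strip k)" using p unfolding xy by (auto simp: doubleton_eq_iff)
      then have "(P i, Q \<rho> j) \<in> B k" using 3(2) by (rule B_mem)
      then have "(x, y) \<in> B' k" using 3(1)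
        by (auto simp: B'_def doubleton_eq_iff intro: image_eqI[of _ prod.swap "(P i, Q \<rho> j)"])
      then show ?thesis using p xy by simp
    qed (use p xy L in auto)
    then show "(case p of (x, y) \<Rightarrow> ennreal ((norm (x - y) - c)\<^sup>2)) = 0" by (simp add: xy)
  next
    fix p assume p: "p \<in> bonds \<rho> k L \<inter> B' k"
    obtain x y where xy: "p = (x, y)" by (cases p)
    have nn: "nearest_neighbours \<rho> x y" using p xy by simp
    have "norm (x - y) \<le> 3"
      using nearest_neighbours_cases[OF rho nn]
    proof cases
      case (3 i j)
      then show ?thesis using norm_PQ[of j i] by (auto simp: doubleton_eq_iff norm_minus_commute)
    qed (use rho in auto)
    then show "(case p of (x, y) \<Rightarrow> ennreal ((norm (x - y) - c)\<^sup>2)) \<le> 9" using cost[of "norm (x - y)" c] L rho by (auto simp: xy)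
  qed
  have B'_card: "card (B' k) \<le> 2 * ((k + 1) * nat (2 * N + 1))" for k
  proof -
    have "card (B' k) \<le> card (B k) + card (prod.swap ` B k)" unfolding B'_def by (rule card_Un_le)
    also have "\<dots> \<le> card (B k) + card (B k)" using B_fin by (intro add_left_mono card_image_le)
    finally show ?thesis using B_card[of k] by linarith
  qed
  \<comment> \<open>Each exceptional pair costs at most 9, and \<open>B' k\<close> has at most
    \<open>2 * (k + 1) * (2 * N + 1)\<close> elements.\<close>
  define C where "C = 18 * (2 * real_of_int N + 1)"
  have "energy \<rho> (\<lambda>x. x) \<rho> k \<le> ennreal (C * (real k + 1))" for k
  proof -
    let ?b = "card (B' k)"
    have "energy \<rho> (\<lambda>x. x) \<rho> k \<le> ennreal (1/2) * (of_nat ?b * 9) + ennreal (1/2) * (of_nat ?b * 9)"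
      unfolding energy_def by (intro add_mono mult_left_mono half) auto
    also have "\<dots> = ennreal (9 * real ?b)"
    proof -
      have "of_nat ?b * (9 :: ennreal) = ennreal (real ?b * 9)"
        by (subst ennreal_mult) (simp_all add: ennreal_of_nat_eq_real_of_nat)
      moreover have "ennreal (1/2) * ennreal (real ?b * 9) = ennreal (1/2 * (real ?b * 9))"
        by (rule ennreal_mult[symmetric]) auto
      ultimately show ?thesis
        using ennreal_plus[of "1/2 * (real ?b * 9)" "1/2 * (real ?b * 9)"] by (simp add: mult.commute)
    qed
    also have "\<dots> \<le> ennreal (C * (real k + 1))"
    proof (rule ennreal_leI)
      have "real ?b \<le> real (2 * ((k + 1) * nat (2 * N + 1)))" using B'_card by (intro of_nat_mono)
      also have "\<dots> = 2 * ((real k + 1) * (2 * real_of_int N + 1))" using N(1) by (simp add: algebra_simps)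
      finally show "9 * real ?b \<le> C * (real k + 1)" unfolding C_def by (simp add: algebra_simps)
    qed
    finally show ?thesis .
  qed
  moreover have "C > 0" using N(1) by (simp add: C_def)
  ultimately show ?thesis by blast
qed

lemma transition_cost_matched_le:
  assumes "0 < lam" "lam < 1"
  shows "\<exists>C>0. \<forall>k. (INF \<rho>\<in>{0<..1}. transition_cost lam \<rho> k) \<le> ennreal (C * (real k + 1))"
proof -
  obtain C where C: "C > 0" "\<And>k. energy lam (\<lambda>x. x) lam k \<le> ennreal (C * (real k + 1))"
    using energy_identity_le[of lam] assms by auto
  have "(INF \<rho>\<in>{0<..1}. transition_cost lam \<rho> k) \<le> ennreal (C * (real k + 1))" for k
  proof -
    have "(INF \<rho>\<in>{0<..1}. transition_cost lam \<rho> k) \<le> transition_cost lam lam k"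
      using assms by (intro INF_lower) auto
    also have "\<dots> \<le> energy lam (\<lambda>x. x) lam k"
      unfolding transition_cost_def using identity_admissible assms
      by (intro Inf_lower) (auto intro!: exI[of _ "\<lambda>x. x"] exI[of _ "1 :: real"])
    finally show ?thesis using C(2) order.trans by blast
  qed
  then show ?thesis using C(1) by blast
qed

subsection \<open>Deformations of the triangular lattice\<close>

text \<open>The vector \<open>w2\<close> as a complex number. Multiplication by it rotates by 60
  degrees, so \<open>e2 = zeta * e1\<close> singles out the positively oriented equilateral
  triangles.\<close>

definition zeta :: complex where
  "zeta = Complex (1 / 2) (sqrt 3 / 2)"

lemma zeta_simps [simp]: "Re zeta = 1 / 2" "Im zeta = sqrt 3 / 2" "cmod zeta = 1"
  by (simp_all add: zeta_def cmod_def power_divide)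

text \<open>With side lengths \<open>a\<close>, \<open>b\<close>, \<open>c\<close> and area \<open>A\<close>, the left-hand side is
  \<open>(a\<^sup>2 + b\<^sup>2 + c\<^sup>2) / 2 - 2 * sqrt 3 * A\<close> (Weitzenboeck); multiplying by the conjugate
  expression, Heron's formula turns it into a sum of squares of differences.\<close>

lemma triangle_wirtinger_le:
  assumes "0 < Im (cnj e1 * e2)"
  shows "(cmod (e2 - zeta * e1))\<^sup>2
    \<le> 8 * ((cmod e1 - m)\<^sup>2 + (cmod e2 - m)\<^sup>2 + (cmod (e2 - e1) - m)\<^sup>2)"
proof -
  define a b c where "a = cmod e1" and "b = cmod e2" and "c = cmod (e2 - e1)"
  define p K where "p = Re (cnj e1 * e2)" and "K = Im (cnj e1 * e2)"
  define D where "D = (cmod (e2 - zeta * e1))\<^sup>2"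
  define D' where "D' = a\<^sup>2 + b\<^sup>2 - p + sqrt 3 * K"
  define S where "S = a\<^sup>2 + b\<^sup>2 + c\<^sup>2"
  have c2: "c\<^sup>2 = a\<^sup>2 + b\<^sup>2 - 2 * p"
    unfolding a_def b_def c_def p_def cmod_power2 by (simp add: power2_eq_square algebra_simps)
  have K2: "K\<^sup>2 = a\<^sup>2 * b\<^sup>2 - p\<^sup>2"
    unfolding a_def b_def p_def K_def cmod_power2 by (simp add: power2_eq_square algebra_simps)
  have s3: "sqrt 3 * (sqrt 3 * x) = 3 * x" for x :: real
    by (simp flip: mult.assoc)
  have D: "D = a\<^sup>2 + b\<^sup>2 - p - sqrt 3 * K"
    unfolding D_def a_def b_def p_def K_def cmod_power2
    by (simp add: power2_eq_square field_simps s3)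
  have "0 < a\<^sup>2" using assms unfolding a_def by auto
  then have "0 < S" unfolding S_def by (smt (verit) zero_le_power2)
  \<comment> \<open>Orientation enters here: for a reflected equilateral triangle \<open>D'\<close>
    would vanish, and the bound on \<open>D * D'\<close> would say nothing about
    \<open>D\<close>.\<close>
  have "S / 2 \<le> D'"
    unfolding S_def D'_def c2 using assms K_def by (simp add: field_simps)
  have "D * D' = (a\<^sup>2 + b\<^sup>2 - p)\<^sup>2 - 3 * K\<^sup>2"
    unfolding D D'_def by (simp add: power2_eq_square algebra_simps s3)
  also have "\<dots> = ((a\<^sup>2 - b\<^sup>2)\<^sup>2 + (b\<^sup>2 - c\<^sup>2)\<^sup>2 + (c\<^sup>2 - a\<^sup>2)\<^sup>2) / 2"
    unfolding K2 c2 by (simp add: power2_eq_square field_simps)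
  also have "\<dots> \<le> S * ((a - b)\<^sup>2 + (b - c)\<^sup>2 + (c - a)\<^sup>2)"
  proof -
    have sq: "(x\<^sup>2 - y\<^sup>2)\<^sup>2 \<le> 2 * S * (x - y)\<^sup>2" if "x\<^sup>2 + y\<^sup>2 \<le> S" for x y
    proof -
      have "(x + y)\<^sup>2 \<le> 2 * S" using that zero_le_power2[of "x - y"] by (simp add: power2_eq_square algebra_simps)
      then have "(x + y)\<^sup>2 * (x - y)\<^sup>2 \<le> 2 * S * (x - y)\<^sup>2" by (intro mult_right_mono) auto
      moreover have "(x\<^sup>2 - y\<^sup>2)\<^sup>2 = (x + y)\<^sup>2 * (x - y)\<^sup>2" by (simp add: power2_eq_square algebra_simps)
      ultimately show ?thesis by simp
    qed
    show ?thesis using sq[of a b] sq[of b c] sq[of c a] unfolding S_def by (simp add: algebra_simps)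
  qed
  finally have "D * D' \<le> S * ((a - b)\<^sup>2 + (b - c)\<^sup>2 + (c - a)\<^sup>2)" .
  moreover have "D * (S / 2) \<le> D * D'" using \<open>S / 2 \<le> D'\<close> by (intro mult_left_mono) (auto simp: D_def)
  ultimately have "S * D \<le> S * (2 * ((a - b)\<^sup>2 + (b - c)\<^sup>2 + (c - a)\<^sup>2))" by (simp add: algebra_simps)
  then have "D \<le> 2 * ((a - b)\<^sup>2 + (b - c)\<^sup>2 + (c - a)\<^sup>2)" using \<open>0 < S\<close> by (rule mult_left_le_imp_le)
  also have "\<dots> \<le> 8 * ((a - m)\<^sup>2 + (b - m)\<^sup>2 + (c - m)\<^sup>2)"
  proof -
    have "(x - y)\<^sup>2 \<le> 2 * (x - m)\<^sup>2 + 2 * (y - m)\<^sup>2" for x y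
      using zero_le_power2[of "x + y - 2 * m"] by (simp add: power2_eq_square algebra_simps)
    from this[of a b] this[of b c] this[of c a] show ?thesis by argo
  qed
  finally show ?thesis unfolding D_def a_def b_def c_def .
qed

section \<open>Energy, Wirtinger defects and areas on a lattice window\<close>

definition bond_length :: "real \<Rightarrow> int \<Rightarrow> real" where
  "bond_length lam i = (if i < 0 then 1 else lam)"

definition dev_h :: "real \<Rightarrow> (int \<Rightarrow> int \<Rightarrow> complex) \<Rightarrow> int \<Rightarrow> int \<Rightarrow> real" where
  "dev_h lam U i j = cmod (U (i + 1) j - U i j) - bond_length lam i"

definition dev_v :: "real \<Rightarrow> (int \<Rightarrow> int \<Rightarrow> complex) \<Rightarrow> int \<Rightarrow> int \<Rightarrow> real" where
  "dev_v lam U i j = cmod (U i (j + 1) - U i j) - bond_length lam i"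

text \<open>The diagonal bond is read from its right end point \<open>(i + 1, j)\<close>, which
  therefore determines the rest length. The energy contains both orderings of this bond, so the
  choice is free but has to be matched later.\<close>

definition dev_d :: "real \<Rightarrow> (int \<Rightarrow> int \<Rightarrow> complex) \<Rightarrow> int \<Rightarrow> int \<Rightarrow> real" where
  "dev_d lam U i j = cmod (U i (j + 1) - U (i + 1) j) - bond_length lam (i + 1)"

text \<open>The window grows with \<open>k\<close> in both directions, so that rescaling by
  \<open>1 / k\<close> turns it into the fixed domain \<open>[-1, 1] x [0, 1]\<close>.\<close>

definition window_energy :: "real \<Rightarrow> (int \<Rightarrow> int \<Rightarrow> complex) \<Rightarrow> nat \<Rightarrow> real" where
  "window_energy lam U k =
     (\<Sum>(i, j)\<in>{- int k..int k} \<times> {0..int k}. (dev_h lam U i j)\<^sup>2) +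
     (\<Sum>(i, j)\<in>{- int k..int k} \<times> {0..<int k}. (dev_v lam U i j)\<^sup>2) +
     (\<Sum>(i, j)\<in>{- int k..int k} \<times> {0..<int k}. (dev_d lam U i j)\<^sup>2)"

text \<open>Discrete versions of the d-bar derivative on the two triangles of a cell: zero means
  that the image is a positively oriented equilateral triangle or a point. They vanish on the maps
  \<open>w + c * (i + j * zeta)\<close>.\<close>

definition dbar_up :: "(int \<Rightarrow> int \<Rightarrow> complex) \<Rightarrow> int \<Rightarrow> int \<Rightarrow> complex" where
  "dbar_up U i j = (U i (j + 1) - U i j) - zeta * (U (i + 1) j - U i j)"

definition dbar_down :: "(int \<Rightarrow> int \<Rightarrow> complex) \<Rightarrow> int \<Rightarrow> int \<Rightarrow> complex" where
  "dbar_down U i j = (U (i + 1) j - U (i + 1) (j + 1)) - zeta * (U i (j + 1) - U (i + 1) (j + 1))"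

text \<open>Twice the signed area of the image triangle.\<close>

definition area_up :: "(int \<Rightarrow> int \<Rightarrow> complex) \<Rightarrow> int \<Rightarrow> int \<Rightarrow> real" where
  "area_up U i j = Im (cnj (U (i + 1) j - U i j) * (U i (j + 1) - U i j))"

definition area_down :: "(int \<Rightarrow> int \<Rightarrow> complex) \<Rightarrow> int \<Rightarrow> int \<Rightarrow> real" where
  "area_down U i j = Im (cnj (U i (j + 1) - U (i + 1) (j + 1)) * (U (i + 1) j - U (i + 1) (j + 1)))"

definition orientation_preserving :: "(int \<Rightarrow> int \<Rightarrow> complex) \<Rightarrow> nat \<Rightarrow> bool" where
  "orientation_preserving U k \<longleftrightarrow> (\<forall>i j. 0 \<le> j \<longrightarrow> j < int k \<longrightarrow> 0 < area_up U i j \<and> 0 < area_down U i j)"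

lemma sum_inj_on_le:
  fixes f :: "'b \<Rightarrow> real"
  assumes "finite B" "inj_on h A" "h ` A \<subseteq> B" "\<And>x. 0 \<le> f x"
  shows "(\<Sum>x\<in>A. f (h x)) \<le> sum f B"
proof -
  have "(\<Sum>x\<in>A. f (h x)) = sum f (h ` A)" using assms(2) by (simp add: sum.reindex)
  also have "\<dots> \<le> sum f B" using assms by (intro sum_mono2) auto
  finally show ?thesis .
qed

lemma window_energy_components:
  "(\<Sum>(i, j)\<in>{- int k..int k} \<times> {0..int k}. (dev_h lam U i j)\<^sup>2) \<le> window_energy lam U k"
  "(\<Sum>(i, j)\<in>{- int k..int k} \<times> {0..<int k}. (dev_v lam U i j)\<^sup>2) \<le> window_energy lam U k"
  "(\<Sum>(i, j)\<in>{- int k..int k} \<times> {0..<int k}. (dev_d lam U i j)\<^sup>2) \<le> window_energy lam U k"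
  "0 \<le> window_energy lam U k"
  unfolding window_energy_def
  by (auto intro!: add_nonneg_nonneg sum_nonneg simp: add.commute add_increasing add_increasing2)

text \<open>The reindexing \<open>h\<close> makes rows, shifted cells and subrectangles accessible
  to one and the same energy bound.\<close>

lemma dev_h_sum_le:
  assumes "inj_on h A" "h ` A \<subseteq> {- int k..int k} \<times> {0..int k}"
  shows "(\<Sum>x\<in>A. case h x of (i, j) \<Rightarrow> (dev_h lam U i j)\<^sup>2) \<le> window_energy lam U k"
  by (rule order.trans[OF sum_inj_on_le[OF _ assms] window_energy_components(1)]) (auto split: prod.split)

lemma dev_v_sum_le:
  assumes "inj_on h A" "h ` A \<subseteq> {- int k..int k} \<times> {0..<int k}"
  shows "(\<Sum>x\<in>A. case h x of (i, j) \<Rightarrow> (dev_v lam U i j)\<^sup>2) \<le> window_energy lam U k"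
  by (rule order.trans[OF sum_inj_on_le[OF _ assms] window_energy_components(2)]) (auto split: prod.split)

lemma dev_d_sum_le:
  assumes "inj_on h A" "h ` A \<subseteq> {- int k..int k} \<times> {0..<int k}"
  shows "(\<Sum>x\<in>A. case h x of (i, j) \<Rightarrow> (dev_d lam U i j)\<^sup>2) \<le> window_energy lam U k"
  by (rule order.trans[OF sum_inj_on_le[OF _ assms] window_energy_components(3)]) (auto split: prod.split)

text \<open>The triangle estimate needs one reference length per triangle, whereas triangles at the
  interface have bonds of two rest lengths. The correction \<open>jump\<close> is nonzero only for
  \<open>i = -1\<close> and at most 1 there, which yields the term \<open>32 * k\<close>; the factor
  96 comes from six sums with weight 16.\<close>

lemma dbar_sum_le:
  assumes lam: "0 < lam" "lam \<le> 1" and U: "orientation_preserving U k"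
    and A: "A \<subseteq> {- int k..<int k} \<times> {0..<int k}"
  shows "(\<Sum>(i, j)\<in>A. (cmod (dbar_up U i j))\<^sup>2 + (cmod (dbar_down U i j))\<^sup>2) \<le> 96 * window_energy lam U k + 32 * real k"
proof -
  let ?R = "{- int k..<int k} \<times> {0..<int k}"
  define jump where "jump i = bond_length lam i - bond_length lam (i + 1)" for i
  have jump: "(jump i)\<^sup>2 \<le> (if i = -1 then 1 else 0)" for i
    using lam by (auto simp: jump_def bond_length_def power_le_one)
  have sq: "(x + y)\<^sup>2 \<le> 2 * x\<^sup>2 + 2 * y\<^sup>2" for x y :: real
    using zero_le_power2[of "x - y"] by (simp add: power2_eq_square algebra_simps)
  have term_le: "(cmod (dbar_up U i j))\<^sup>2 + (cmod (dbar_down U i j))\<^sup>2 \<le>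
      16 * ((dev_h lam U i j)\<^sup>2 + (dev_v lam U i j)\<^sup>2 + (dev_d lam U i j)\<^sup>2 +
        (dev_d lam U i j)\<^sup>2 + (dev_h lam U i (j + 1))\<^sup>2 + (dev_v lam U (i + 1) j)\<^sup>2) + 32 * (jump i)\<^sup>2"
    if "0 \<le> j" "j < int k" for i j
  proof -
    have pos: "0 < Im (cnj (U (i + 1) j - U i j) * (U i (j + 1) - U i j))"
       "0 < Im (cnj (U i (j + 1) - U (i + 1) (j + 1)) * (U (i + 1) j - U (i + 1) (j + 1)))"
      using U that unfolding orientation_preserving_def area_up_def area_down_def by blast+
    have "(cmod (dbar_up U i j))\<^sup>2 \<le> 8 * ((dev_h lam U i j)\<^sup>2 + (dev_v lam U i j)\<^sup>2 + (dev_d lam U i j + - jump i)\<^sup>2)"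
      using triangle_wirtinger_le[OF pos(1), of "bond_length lam i"]
      unfolding dbar_up_def dev_h_def dev_v_def dev_d_def jump_def by (simp add: norm_minus_commute algebra_simps)
    moreover have "(cmod (dbar_down U i j))\<^sup>2 \<le> 8 * ((dev_h lam U i (j + 1) + jump i)\<^sup>2 + (dev_v lam U (i + 1) j)\<^sup>2 + (dev_d lam U i j)\<^sup>2)"
      using triangle_wirtinger_le[OF pos(2), of "bond_length lam (i + 1)"]
      unfolding dbar_down_def dev_h_def dev_v_def dev_d_def jump_def by (simp add: norm_minus_commute algebra_simps)
    ultimately show ?thesis
      using sq[of "dev_d lam U i j" "- jump i"] sq[of "dev_h lam U i (j + 1)" "jump i"]
        zero_le_power2[of "dev_v lam U (i + 1) j"] zero_le_power2[of "dev_v lam U i j"] zero_le_power2[of "dev_h lam U i j"]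
        zero_le_power2[of "dev_d lam U i j"] unfolding power2_minus by argo
  qed
  have "(\<Sum>(i, j)\<in>A. (cmod (dbar_up U i j))\<^sup>2 + (cmod (dbar_down U i j))\<^sup>2) \<le>
    (\<Sum>(i, j)\<in>?R. (cmod (dbar_up U i j))\<^sup>2 + (cmod (dbar_down U i j))\<^sup>2)"
    using A by (intro sum_mono2) auto
  also have "\<dots> \<le> (\<Sum>(i, j)\<in>?R. 16 * ((dev_h lam U i j)\<^sup>2 + (dev_v lam U i j)\<^sup>2 + (dev_d lam U i j)\<^sup>2 +
        (dev_d lam U i j)\<^sup>2 + (dev_h lam U i (j + 1))\<^sup>2 + (dev_v lam U (i + 1) j)\<^sup>2) + 32 * (jump i)\<^sup>2)"
    using term_le by (intro sum_mono) auto
  also have "\<dots> = 16 * ((\<Sum>(i, j)\<in>?R. (dev_h lam U i j)\<^sup>2) + (\<Sum>(i, j)\<in>?R. (dev_v lam U i j)\<^sup>2) +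
      (\<Sum>(i, j)\<in>?R. (dev_d lam U i j)\<^sup>2) + (\<Sum>(i, j)\<in>?R. (dev_d lam U i j)\<^sup>2) +
      (\<Sum>(i, j)\<in>?R. (dev_h lam U i (j + 1))\<^sup>2) + (\<Sum>(i, j)\<in>?R. (dev_v lam U (i + 1) j)\<^sup>2)) +
      32 * (\<Sum>(i, j)\<in>?R. (jump i)\<^sup>2)"
    by (simp add: case_prod_unfold sum.distrib sum_distrib_left)
  also have "\<dots> \<le> 16 * (6 * window_energy lam U k) + 32 * real k"
  proof -
    have sub: "?R \<subseteq> {- int k..int k} \<times> {0..int k}" "?R \<subseteq> {- int k..int k} \<times> {0..<int k}"
      by auto
    have "(\<Sum>(i, j)\<in>?R. (jump i)\<^sup>2) \<le> (\<Sum>(i, j)\<in>?R. if i = -1 then 1 else 0)"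
      using jump by (intro sum_mono) auto
    also have "\<dots> = (\<Sum>i\<in>{- int k..<int k}. \<Sum>j\<in>{0..<int k}. if i = -1 then 1 else 0)"
      by (rule sum.cartesian_product[symmetric])
    also have "\<dots> = (\<Sum>i\<in>{- int k..<int k}. if i = -1 then real k else 0)"
      by (intro sum.cong) auto
    also have "\<dots> \<le> real k" by (subst sum.delta) auto
    finally have "(\<Sum>(i, j)\<in>?R. (jump i)\<^sup>2) \<le> real k" .
    moreover have "(\<Sum>(i, j)\<in>?R. (dev_h lam U i (j + 1))\<^sup>2) \<le> window_energy lam U k"
      using dev_h_sum_le[of "\<lambda>(i, j). (i, j + 1)" ?R k lam U]
      by (simp add: case_prod_unfold inj_on_def) force
    moreover have "(\<Sum>(i, j)\<in>?R. (dev_v lam U (i + 1) j)\<^sup>2) \<le> window_energy lam U k"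
      using dev_v_sum_le[of "\<lambda>(i, j). (i + 1, j)" ?R k lam U]
      by (simp add: case_prod_unfold inj_on_def) force
    moreover have "(\<Sum>(i, j)\<in>?R. (dev_h lam U i j)\<^sup>2) \<le> window_energy lam U k"
      using dev_h_sum_le[of "\<lambda>x. x" ?R k lam U] sub by simp
    moreover have "(\<Sum>(i, j)\<in>?R. (dev_v lam U i j)\<^sup>2) \<le> window_energy lam U k"
      using dev_v_sum_le[of "\<lambda>x. x" ?R k lam U] sub by simp
    moreover have "(\<Sum>(i, j)\<in>?R. (dev_d lam U i j)\<^sup>2) \<le> window_energy lam U k"
      using dev_d_sum_le[of "\<lambda>x. x" ?R k lam U] sub by simp
    ultimately show ?thesis by argo
  qed
  finally show ?thesis by argo
qed

section \<open>Discrete Green formula and lengths of lattice paths\<close>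

lemma sum_telescope_int:
  fixes f :: "int \<Rightarrow> 'a :: ab_group_add"
  assumes "a \<le> b"
  shows "(\<Sum>l\<in>{a..<b}. f (l + 1) - f l) = f b - f a"
  using assms
proof (induction b rule: int_ge_induct)
  case (step b)
  have "{a..<b + 1} = insert b {a..<b}" using step by auto
  then show ?case using step by simp
qed simp

text \<open>A discrete Green formula: inner edges belong to two cells with opposite signs and
  cancel. It serves both for the form \<open>F dz\<close> and for the signed area.\<close>

lemma sum_cells_eq_boundary:
  fixes h v :: "int \<Rightarrow> int \<Rightarrow> 'a :: ab_group_add"
  assumes "i0 \<le> i1" "j0 \<le> j1"
  shows "(\<Sum>(i, j)\<in>{i0..<i1} \<times> {j0..<j1}. (h i j - h i (j + 1)) + (v (i + 1) j - v i j)) =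
    (\<Sum>i\<in>{i0..<i1}. h i j0 - h i j1) + (\<Sum>j\<in>{j0..<j1}. v i1 j - v i0 j)"
proof -
  have "(\<Sum>(i, j)\<in>{i0..<i1} \<times> {j0..<j1}. (h i j - h i (j + 1)) + (v (i + 1) j - v i j)) =
    (\<Sum>i\<in>{i0..<i1}. \<Sum>j\<in>{j0..<j1}. h i j - h i (j + 1)) + (\<Sum>i\<in>{i0..<i1}. \<Sum>j\<in>{j0..<j1}. v (i + 1) j - v i j)"
    by (simp add: case_prod_unfold sum.distrib sum.cartesian_product)
  also have "(\<Sum>i\<in>{i0..<i1}. \<Sum>j\<in>{j0..<j1}. h i j - h i (j + 1)) = (\<Sum>i\<in>{i0..<i1}. h i j0 - h i j1)"
  proof (intro sum.cong refl)
    fix i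
    have "(\<Sum>j\<in>{j0..<j1}. h i j - h i (j + 1)) = - (\<Sum>j\<in>{j0..<j1}. h i (j + 1) - h i j)"
      by (simp flip: sum_negf)
    then show "(\<Sum>j\<in>{j0..<j1}. h i j - h i (j + 1)) = h i j0 - h i j1"
      using sum_telescope_int[OF assms(2), of "h i"] by simp
  qed
  also have "(\<Sum>i\<in>{i0..<i1}. \<Sum>j\<in>{j0..<j1}. v (i + 1) j - v i j) = (\<Sum>j\<in>{j0..<j1}. v i1 j - v i0 j)"
    by (subst sum.swap) (intro sum.cong refl sum_telescope_int assms)
  finally show ?thesis .
qed

lemma sum_abs_le_sqrt:
  fixes f :: "'a \<Rightarrow> real"
  assumes "finite A" "(\<Sum>x\<in>A. (f x)\<^sup>2) \<le> D"
  shows "(\<Sum>x\<in>A. \<bar>f x\<bar>) \<le> sqrt (real (card A) * D)"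
proof (rule real_le_rsqrt)
  have "(\<Sum>x\<in>A. \<bar>f x\<bar>)\<^sup>2 \<le> real (card A) * (\<Sum>x\<in>A. \<bar>f x\<bar>\<^sup>2)"
    using Cauchy_Schwarz_ineq_sum[of "\<lambda>_. 1" "\<lambda>x. \<bar>f x\<bar>" A] by simp
  also have "\<dots> \<le> real (card A) * D" using assms by (intro mult_left_mono) auto
  finally show "(\<Sum>x\<in>A. \<bar>f x\<bar>)\<^sup>2 \<le> real (card A) * D" .
qed

text \<open>A bond exceeds its rest length, which is at most 1, by at most its deviation, and
  Cauchy-Schwarz sums the deviations. The whole length is bounded, not only the displacement of the
  end points, because the boundary term of the area needs it.\<close>

lemma row_length_le:
  assumes "0 < lam" "lam \<le> 1" "- int k \<le> i" "i \<le> i'" "i' \<le> int k" "0 \<le> j" "j \<le> int k"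
  shows "(\<Sum>l\<in>{i..<i'}. cmod (U (l + 1) j - U l j)) \<le> of_int (i' - i) + sqrt (of_int (i' - i) * window_energy lam U k)"
proof -
  have "(\<Sum>l\<in>{i..<i'}. (dev_h lam U l j)\<^sup>2) \<le> window_energy lam U k"
    using dev_h_sum_le[of "\<lambda>l. (l, j)" "{i..<i'}" k lam U] assms by (simp add: inj_on_def) force
  then have "(\<Sum>l\<in>{i..<i'}. \<bar>dev_h lam U l j\<bar>) \<le> sqrt (of_int (i' - i) * window_energy lam U k)"
    using sum_abs_le_sqrt[of "{i..<i'}"] assms by fastforce
  moreover have "(\<Sum>l\<in>{i..<i'}. cmod (U (l + 1) j - U l j)) \<le> (\<Sum>l\<in>{i..<i'}. 1 + \<bar>dev_h lam U l j\<bar>)"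
    using assms by (intro sum_mono) (auto simp: dev_h_def bond_length_def)
  ultimately show ?thesis using assms by (simp add: sum.distrib)
qed

lemma column_length_le:
  assumes "0 < lam" "lam \<le> 1" "- int k \<le> i" "i \<le> int k" "0 \<le> j" "j \<le> j'" "j' \<le> int k"
  shows "(\<Sum>l\<in>{j..<j'}. cmod (U i (l + 1) - U i l)) \<le> of_int (j' - j) + sqrt (of_int (j' - j) * window_energy lam U k)"
proof -
  have "(\<Sum>l\<in>{j..<j'}. (dev_v lam U i l)\<^sup>2) \<le> window_energy lam U k"
    using dev_v_sum_le[of "\<lambda>l. (i, l)" "{j..<j'}" k lam U] assms by (simp add: inj_on_def) force
  then have "(\<Sum>l\<in>{j..<j'}. \<bar>dev_v lam U i l\<bar>) \<le> sqrt (of_int (j' - j) * window_energy lam U k)"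
    using sum_abs_le_sqrt[of "{j..<j'}"] assms by fastforce
  moreover have "(\<Sum>l\<in>{j..<j'}. cmod (U i (l + 1) - U i l)) \<le> (\<Sum>l\<in>{j..<j'}. 1 + \<bar>dev_v lam U i l\<bar>)"
    using assms by (intro sum_mono) (auto simp: dev_v_def bond_length_def)
  ultimately show ?thesis using assms by (simp add: sum.distrib)
qed

lemma path_length_bound:
  fixes f :: "int \<Rightarrow> complex"
  assumes "a \<le> b"
  shows "cmod (f b - f a) \<le> (\<Sum>l\<in>{a..<b}. cmod (f (l + 1) - f l))"
  using norm_sum[of "\<lambda>l. f (l + 1) - f l" "{a..<b}"] sum_telescope_int[OF assms, of f] by simp

text \<open>The path runs along row \<open>j\<close> and then along column \<open>i'\<close>. With
  energy at most \<open>C * k\<close>, a path of \<open>d\<close> bonds contributes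
  \<open>d + sqrt (d * C * k)\<close>, and division by \<open>k\<close> turns this into
  \<open>w (d / k)\<close>, a modulus independent of \<open>k\<close>.\<close>

lemma lattice_holder:
  assumes "0 < lam" "lam \<le> 1" "window_energy lam U k \<le> C * real k" "0 < k"
    and ij: "i \<in> {- int k..int k}" "i' \<in> {- int k..int k}" "j \<in> {0..int k}" "j' \<in> {0..int k}"
  defines "w \<equiv> \<lambda>x. x + sqrt (C * x)"
  shows "cmod (U i' j' - U i j) / real k \<le> w (\<bar>of_int i' - of_int i\<bar> / real k) + w (\<bar>of_int j' - of_int j\<bar> / real k)"
proof -
  let ?k = "real k" and ?E = "window_energy lam U k"
  have w: "(d + sqrt (d * ?E)) / ?k \<le> w (d / ?k)" if "0 \<le> d" for d
  proof -
    have "d * ?E \<le> d * (C * ?k)" using that assms(3) by (intro mult_left_mono)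
    then have "sqrt (d * ?E) \<le> sqrt (d * (C * ?k))" by simp
    also have "d * (C * ?k) = ?k\<^sup>2 * (C * (d / ?k))" using assms(4) by (simp add: power2_eq_square)
    also have "sqrt \<dots> = ?k * sqrt (C * (d / ?k))" by (subst real_sqrt_mult) simp
    finally show ?thesis using assms(4) unfolding w_def by (simp add: field_simps)
  qed
  have row: "cmod (U a j - U b j) / ?k \<le> w (\<bar>of_int a - of_int b\<bar> / ?k)"
    if "a \<in> {- int k..int k}" "b \<in> {- int k..int k}" "b \<le> a" for a b
  proof -
    have "cmod (U a j - U b j) \<le> of_int (a - b) + sqrt (of_int (a - b) * ?E)"
      using path_length_bound[OF that(3), of "\<lambda>l. U l j"] row_length_le[of lam k b a j U] that ij assms(1,2) by auto
    then have "cmod (U a j - U b j) / ?k \<le> (of_int (a - b) + sqrt (of_int (a - b) * ?E)) / ?k"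
      by (intro divide_right_mono) auto
    also have "\<dots> \<le> w (of_int (a - b) / ?k)" using that by (intro w) auto
    finally show ?thesis using that by simp
  qed
  have column: "cmod (U i' a - U i' b) / ?k \<le> w (\<bar>of_int a - of_int b\<bar> / ?k)"
    if "a \<in> {0..int k}" "b \<in> {0..int k}" "b \<le> a" for a b
  proof -
    have "cmod (U i' a - U i' b) \<le> of_int (a - b) + sqrt (of_int (a - b) * ?E)"
      using path_length_bound[OF that(3), of "\<lambda>l. U i' l"] column_length_le[of lam k i' b a U] that ij assms(1,2) by auto
    then have "cmod (U i' a - U i' b) / ?k \<le> (of_int (a - b) + sqrt (of_int (a - b) * ?E)) / ?k"
      by (intro divide_right_mono) auto
    also have "\<dots> \<le> w (of_int (a - b) / ?k)" using that by (intro w) auto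
    finally show ?thesis using that by simp
  qed
  have "cmod (U i' j - U i j) / ?k \<le> w (\<bar>of_int i' - of_int i\<bar> / ?k)"
    using row[of i' i] row[of i i'] ij by (cases "i \<le> i'") (auto simp: norm_minus_commute abs_minus_commute)
  moreover have "cmod (U i' j' - U i' j) / ?k \<le> w (\<bar>of_int j' - of_int j\<bar> / ?k)"
    using column[of j' j] column[of j j'] ij by (cases "j \<le> j'") (auto simp: norm_minus_commute abs_minus_commute)
  moreover have "cmod (U i' j' - U i j) \<le> cmod (U i' j - U i j) + cmod (U i' j' - U i' j)"
    using norm_triangle_ineq[of "U i' j - U i j" "U i' j' - U i' j"] by simp
  then have "cmod (U i' j' - U i j) / ?k \<le> cmod (U i' j - U i j) / ?k + cmod (U i' j' - U i' j) / ?k"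
    unfolding add_divide_distrib[symmetric] by (rule divide_right_mono) simp
  ultimately show ?thesis by linarith
qed

subsection \<open>Admissible deformations on the undeformed lattice\<close>

lemma convex_horizontal_slab: "convex ({x :: real^2. a \<le> x $ 2} \<inter> {x. x $ 2 \<le> b})"
  using convex_Int[OF convex_halfspace_ge convex_halfspace_le, of a "axis 2 1 :: real^2" "axis 2 1" b]
  by (simp add: inner_axis')

lemma closure_strip:
  assumes "1 \<le> k"
  shows "closure (strip k) = {x :: real^2. 0 \<le> x $ 2} \<inter> {x. x $ 2 \<le> sqrt 3 / 2 * real k}"
proof -
  let ?S = "{x :: real^2. 0 \<le> x $ 2} \<inter> {x. x $ 2 \<le> sqrt 3 / 2 * real k}"
  have int: "interior ?S = strip k"
    unfolding interior_Int interior_halfspace_component_ge interior_halfspace_component_le strip_def by blast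
  have "pt 0 (1/2) \<in> strip k" using assms by (simp add: strip_def)
  moreover have "convex ?S"
    by (rule convex_horizontal_slab)
  ultimately have "closure (strip k) = closure ?S"
    using convex_closure_interior[of ?S] unfolding int by blast
  also have "closed ?S" by (intro closed_Int closed_Collect_le continuous_intros)
  then have "closure ?S = ?S" by simp
  finally show ?thesis .
qed

lemma pt_in_closure_strip: "1 \<le> k \<Longrightarrow> 0 \<le> b \<Longrightarrow> b \<le> real k \<Longrightarrow> pt a b \<in> closure (strip k)"
  by (simp add: closure_strip mult.commute)

lemma open_triangle_subset_strip:
  assumes "1 \<le> k" "S \<subseteq> closure (strip k)"
  shows "open_triangle S \<subseteq> strip k" "convex hull S \<subseteq> closure (strip k)"
proof -
  let ?S = "{x :: real^2. 0 \<le> x $ 2} \<inter> {x. x $ 2 \<le> sqrt 3 / 2 * real k}"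
  have "convex ?S"
    by (rule convex_horizontal_slab)
  then have hull: "convex hull S \<subseteq> ?S" using assms unfolding closure_strip[OF assms(1)] by (intro hull_minimal)
  then show "convex hull S \<subseteq> closure (strip k)" unfolding closure_strip[OF assms(1)] .
  have "open_triangle S \<subseteq> interior ?S" unfolding open_triangle_def by (rule interior_mono[OF hull])
  then show "open_triangle S \<subseteq> strip k"
    unfolding interior_Int interior_halfspace_component_ge interior_halfspace_component_le strip_def by blast
qed

text \<open>On the open triangle \<open>u\<close> minus its linear part has zero derivative, hence
  is constant, and continuity carries this to the vertices. The almost everywhere condition gives
  \<open>det A > 0\<close> because the Jacobian is constant on the triangle, which is not a null
  set.\<close>

lemma admissible_affine_on_triangle:
  assumes u: "u \<in> admissible \<rho> k" and "1 \<le> k" and S: "S \<in> lattice_triangulation \<rho>" "S \<subseteq> closure (strip k)"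
    "card S = 3" "\<not> collinear S"
  shows "\<exists>A. 0 < det A \<and> (\<forall>x\<in>S. \<forall>y\<in>S. u y - u x = A *v (y - x))"
proof -
  define T where "T = open_triangle S"
  have T: "open T" "convex T" "T \<noteq> {}" "closure T = convex hull S"
    using closure_open_triangle[OF S(4,3)] by (auto simp: T_def open_triangle_def convex_interior)
  have T_strip: "T \<subseteq> strip k" "closure T \<subseteq> closure (strip k)"
    using open_triangle_subset_strip[OF assms(2) S(2)] T unfolding T_def by auto
  obtain A where "has_gradient_on u A (strip k \<inter> T)"
    using u S(1) unfolding admissible_def T_def by blast
  then have A: "(u has_derivative (\<lambda>h. A *v h)) (at x)" if "x \<in> T" for x
    using that T_strip unfolding has_gradient_on_def by blast
  define g where "g x = u x - A *v x" for x
  have "(g has_derivative (\<lambda>h. 0)) (at x within T)" if "x \<in> T" for x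
  proof -
    have "(g has_derivative (\<lambda>h. A *v h - A *v h)) (at x)"
      unfolding g_def by (intro has_derivative_diff A that bounded_linear_imp_has_derivative matrix_vector_mul_bounded_linear)
    then show ?thesis by (simp add: has_derivative_at_withinI)
  qed
  then obtain c where c: "\<And>x. x \<in> T \<Longrightarrow> g x = c"
    using has_derivative_zero_constant[OF T(2), of g] by auto
  have "continuous_on (closure T) u"
    using u T_strip unfolding admissible_def by (blast intro: continuous_on_subset)
  then have "continuous_on (closure T) g"
    unfolding g_def
    by (rule continuous_on_diff[OF _ linear_continuous_on[OF matrix_vector_mul_bounded_linear]])
  then have gS: "g x = c" if "x \<in> S" for x
    using continuous_constant_on_closure[of T g c x] c hull_inc[OF that, of convex] by (simp add: T(4))
  have "u y - u x = A *v (y - x)" if "x \<in> S" "y \<in> S" for x y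
    using gS[OF that(1)] gS[OF that(2)] unfolding g_def by (simp add: matrix_vector_mult_diff_distrib algebra_simps)
  moreover have "0 < det A"
  proof (rule ccontr)
    assume neg: "\<not> 0 < det A"
    have jac: "jacobian u (at x) = A" if "x \<in> T" for x
      using frechet_derivative_at[OF A[OF that], symmetric] by (simp add: jacobian_def)
    have "open (strip k)"
      unfolding strip_def by (intro open_Collect_conj open_Collect_less continuous_intros)
    then have "strip k \<in> sets lebesgue" by auto
    have "AE x in lebesgue_on (strip k). det (jacobian u (at x)) > 0"
      using u unfolding admissible_def by blast
    then have "AE x in lebesgue. x \<in> strip k \<longrightarrow> det (jacobian u (at x)) > 0"
      using \<open>strip k \<in> sets lebesgue\<close> by (simp add: AE_restrict_space_iff)
    then have "AE x in lebesgue. x \<notin> T"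
      by eventually_elim (use jac neg T_strip in auto)
    moreover have "T \<in> sets lebesgue" using T(1) by auto
    ultimately have "T \<in> null_sets lebesgue" by (simp add: AE_iff_null_sets)
    then have "negligible T" by (simp add: negligible_iff_null_sets)
    then show False using open_not_negligible T by blast
  qed
  ultimately show ?thesis by blast
qed

text \<open>For \<open>\<rho> = 1\<close> neither rounding rule meets a tie, and the interface
  triangles are the ordinary grid triangles of column -1.\<close>

lemma grid_in_unit_triangulation:
  "grid_low 1 i j \<in> lattice_triangulation 1" "grid_up 1 i j \<in> lattice_triangulation 1"
proof -
  have eq: "lattice_triangulation 1 = lattice_triangles 1" by (rule lattice_triangulation_eq) auto
  have "grid_low 1 i j \<in> lattice_triangles 1 \<and> grid_up 1 i j \<in> lattice_triangles 1"
  proof (cases "i = -1")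
    case True
    have "\<lfloor>real_of_int j + 1 / 2\<rfloor> = j" "\<lceil>real_of_int j + 1 / 2\<rceil> = j + 1" by linarith+
    then have "grid_low 1 i j = left_edge_triangle 1 j" "grid_up 1 i j = right_edge_triangle 1 j"
      using True by (auto simp: grid_low_def grid_up_def left_edge_triangle_def right_edge_triangle_def P_pt Q_pt)
    then show ?thesis unfolding lattice_triangles_def interface_triangles_def by auto
  next
    case False
    have "grid_low s i j \<in> grid_triangles s I \<and> grid_up s i j \<in> grid_triangles s I" if "i \<in> I" for s I
      using that unfolding grid_triangles_def by fast
    from this[of "{..-2}" 1] this[of "{0..}" 1] show ?thesis
      using False unfolding lattice_triangles_def by (cases "0 \<le> i") auto
  qed
  then show "grid_low 1 i j \<in> lattice_triangulation 1" "grid_up 1 i j \<in> lattice_triangulation 1"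
    unfolding eq by auto
qed

definition vec_complex :: "real^2 \<Rightarrow> complex" where
  "vec_complex x = Complex (x $ 1) (x $ 2)"

lemma cmod_vec_complex: "cmod (vec_complex x - vec_complex y) = norm (x - y)"
  by (simp add: vec_complex_def cmod_def norm_vec_def L2_set_def sum_2)

definition lattice_map :: "(real^2 \<Rightarrow> real^2) \<Rightarrow> int \<Rightarrow> int \<Rightarrow> complex" where
  "lattice_map u i j = vec_complex (u (pt (of_int i) (of_int j)))"

lemma cross_linear_image:
  fixes A :: "real^2^2" and v w x y z :: "real^2"
  assumes "y - x = A *v v" "z - x = A *v w"
  shows "Im (cnj (vec_complex y - vec_complex x) * (vec_complex z - vec_complex x)) =
    det A * (v $ 1 * w $ 2 - v $ 2 * w $ 1)"
proof -
  have "Im (cnj (vec_complex y - vec_complex x) * (vec_complex z - vec_complex x)) =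
    (y - x) $ 1 * (z - x) $ 2 - (y - x) $ 2 * (z - x) $ 1"
    by (simp add: vec_complex_def algebra_simps)
  also have "\<dots> = det A * (v $ 1 * w $ 2 - v $ 2 * w $ 1)"
    unfolding assms det_2 by (simp add: matrix_vector_mult_def sum_2 algebra_simps)
  finally show ?thesis .
qed

lemma lattice_map_orientation_preserving:
  assumes u: "u \<in> admissible 1 k" and k: "1 \<le> k"
  shows "orientation_preserving (lattice_map u) k"
  unfolding orientation_preserving_def
proof (intro allI impI)
  fix i j assume j: "0 \<le> j" "j < int k"
  then have jk: "0 \<le> real_of_int j" "real_of_int j + 1 \<le> real k" by linarith+
  have in_strip: "pt a (of_int j) \<in> closure (strip k)" "pt a (of_int j + 1) \<in> closure (strip k)" for a
    using jk k by (auto intro!: pt_in_closure_strip)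
  have "grid_low 1 i j \<in> lattice_triangles 1" "grid_up 1 i j \<in> lattice_triangles 1"
    using grid_in_unit_triangulation lattice_triangulation_eq[of 1] by auto
  note nondeg = this[THEN lattice_triangles_nondegenerate(1)[OF zero_less_one]]
    this[THEN lattice_triangles_nondegenerate(2)[OF zero_less_one]]
  have sub: "grid_low 1 i j \<subseteq> closure (strip k)" "grid_up 1 i j \<subseteq> closure (strip k)"
    using in_strip by (auto simp: grid_low_def grid_up_def)
  obtain A where A: "0 < det A" "\<And>x y. x \<in> grid_low 1 i j \<Longrightarrow> y \<in> grid_low 1 i j \<Longrightarrow> u y - u x = A *v (y - x)"
    using admissible_affine_on_triangle[OF u k grid_in_unit_triangulation(1) sub(1)] nondeg by blast
  have "area_up (lattice_map u) i j = det A * (sqrt 3 / 2)"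
    unfolding area_up_def lattice_map_def of_int_add of_int_1
    by (subst cross_linear_image[OF A(2) A(2)]) (auto simp: grid_low_def pt_diff)
  moreover have "0 < det A * (sqrt 3 / 2)" using A(1) by simp
  ultimately have up: "0 < area_up (lattice_map u) i j" by metis
  obtain A' where A': "0 < det A'" "\<And>x y. x \<in> grid_up 1 i j \<Longrightarrow> y \<in> grid_up 1 i j \<Longrightarrow> u y - u x = A' *v (y - x)"
    using admissible_affine_on_triangle[OF u k grid_in_unit_triangulation(2) sub(2)] nondeg by blast
  have "area_down (lattice_map u) i j = det A' * (sqrt 3 / 2)"
    unfolding area_down_def lattice_map_def of_int_add of_int_1
    by (subst cross_linear_image[OF A'(2) A'(2)]) (auto simp: grid_up_def pt_diff)
  moreover have "0 < det A' * (sqrt 3 / 2)" using A'(1) by simp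
  ultimately show "0 < area_up (lattice_map u) i j \<and> 0 < area_down (lattice_map u) i j" using up by metis
qed

lemma infsum_ennreal_ge_sum:
  fixes f :: "'a \<Rightarrow> ennreal"
  assumes "finite F" "F \<subseteq> A"
  shows "sum f F \<le> infsum f A"
proof -
  have "sum f F = infsum f F" using assms(1) by simp
  also have "\<dots> \<le> infsum f A"
    by (rule infsum_mono_neutral) (use assms(2) in \<open>auto intro: nonneg_summable_on_complete\<close>)
  finally show ?thesis .
qed

text \<open>The injective listing is a finite part of the ordered pairs in the energy, and its first
  points decide in which of the two sums each pair occurs. The factor 2 cancels the 1/2 in the
  energy.\<close>

lemma bond_sum_le_energy:
  fixes X Y :: "int \<Rightarrow> int \<Rightarrow> real^2"
  assumes A: "finite A" "inj (\<lambda>(i, j). (X i j, Y i j))"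
    and nn: "\<And>i j. (i, j) \<in> A \<Longrightarrow> nearest_neighbours \<rho> (X i j) (Y i j) \<and>
      X i j \<in> lattice \<rho> \<inter> closure (strip k) \<and> Y i j \<in> lattice \<rho> \<inter> closure (strip k)"
    and f: "\<And>i j. (i, j) \<in> A \<Longrightarrow>
      f i j = (norm (u (X i j) - u (Y i j)) - (if X i j \<in> lattice_minus then 1 else lam))\<^sup>2"
  shows "ennreal (\<Sum>(i, j)\<in>A. f i j) \<le> 2 * energy lam u \<rho> k"
proof -
  let ?c = "\<lambda>m (x, y). ennreal ((norm (u x - u y) - m)\<^sup>2)"
  let ?g = "\<lambda>(i, j). (X i j, Y i j)"
  define A1 where "A1 = {(i, j) \<in> A. X i j \<in> lattice_minus}"
  define A2 where "A2 = {(i, j) \<in> A. X i j \<notin> lattice_minus}"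
  have A12: "A = A1 \<union> A2" "A1 \<inter> A2 = {}" "A1 \<subseteq> A" "A2 \<subseteq> A" by (auto simp: A1_def A2_def)
  have fin: "finite A1" "finite A2" "inj_on ?g A1" "inj_on ?g A2"
    using A A12 by (auto intro: finite_subset inj_on_subset)
  have nonneg: "0 \<le> (case t of (i, j) \<Rightarrow> f i j)" if "t \<in> A" for t using f that by (cases t) auto
  have "ennreal (\<Sum>(i, j)\<in>A. f i j) = (\<Sum>t\<in>A. ennreal (case t of (i, j) \<Rightarrow> f i j))"
    using nonneg by (subst sum_ennreal) auto
  also have "\<dots> = (\<Sum>t\<in>A1. ennreal (case t of (i, j) \<Rightarrow> f i j)) + (\<Sum>t\<in>A2. ennreal (case t of (i, j) \<Rightarrow> f i j))"
    unfolding A12(1) by (rule sum.union_disjoint[OF fin(1,2) A12(2)])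
  also have "(\<Sum>t\<in>A1. ennreal (case t of (i, j) \<Rightarrow> f i j)) = sum (?c 1) (?g ` A1)"
    unfolding sum.reindex[OF fin(3)] by (intro sum.cong) (auto simp: f A1_def)
  also have "(\<Sum>t\<in>A2. ennreal (case t of (i, j) \<Rightarrow> f i j)) = sum (?c lam) (?g ` A2)"
    unfolding sum.reindex[OF fin(4)] by (intro sum.cong) (auto simp: f A2_def)
  also have "sum (?c 1) (?g ` A1) + sum (?c lam) (?g ` A2) \<le> infsum (?c 1) (bonds \<rho> k lattice_minus) + infsum (?c lam) (bonds \<rho> k (lattice_plus \<rho>))"
  proof (intro add_mono infsum_ennreal_ge_sum)
    show "?g ` A1 \<subseteq> bonds \<rho> k lattice_minus" using nn by (auto simp: A1_def)
    show "?g ` A2 \<subseteq> bonds \<rho> k (lattice_plus \<rho>)" using nn by (fastforce simp: A2_def lattice_def)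
  qed (use fin in auto)
  also have "infsum (?c 1) (bonds \<rho> k lattice_minus) + infsum (?c lam) (bonds \<rho> k (lattice_plus \<rho>)) = 2 * energy lam u \<rho> k"
  proof -
    have half: "2 * (ennreal (1/2) * x) = x" for x
    proof -
      have "2 * ennreal (1/2) = ennreal (2 * (1/2))" by (subst ennreal_mult) auto
      then have "2 * ennreal (1/2) = 1" by simp
      then show ?thesis by (metis mult.assoc mult_1)
    qed
    show ?thesis unfolding energy_def distrib_left half ..
  qed
  finally show ?thesis .
qed

lemma window_energy_le_energy:
  assumes k: "1 \<le> k"
  shows "ennreal (window_energy lam (lattice_map u) k) \<le> 6 * energy lam u 1 k"
proof -
  define p where "p i j = pt (of_int i) (of_int j)" for i j
  have p_eq: "p i j = p i' j' \<longleftrightarrow> i = i' \<and> j = j'" for i j i' j' by (simp add: p_def)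
  have in_lat: "p i j \<in> lattice 1" for i j
    unfolding p_def by (subst pt_in_lattice) (auto simp: not_less)
  have in_minus: "p i j \<in> lattice_minus \<longleftrightarrow> i < 0" for i j
    unfolding p_def lattice_minus_pt by auto
  have in_strip: "p i j \<in> closure (strip k)" if "0 \<le> j" "j \<le> int k" for i j
  proof -
    have "0 \<le> real_of_int j" "real_of_int j \<le> real k" using that by linarith+
    then show ?thesis unfolding p_def using k by (intro pt_in_closure_strip)
  qed
  have low: "{p i j, p (i + 1) j, p i (j + 1)} \<in> lattice_triangulation 1" for i j
    using grid_in_unit_triangulation(1)[of i j] by (simp add: p_def grid_low_def)
  have nn: "nearest_neighbours 1 (p i j) (p (i + 1) j)" "nearest_neighbours 1 (p i j) (p i (j + 1))"
    "nearest_neighbours 1 (p (i + 1) j) (p i (j + 1))" for i j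
    unfolding nearest_neighbours_def p_eq by (auto intro!: bexI[OF _ low[of i j]])
  have cmod: "cmod (lattice_map u i j - lattice_map u i' j') = norm (u (p i' j') - u (p i j))" for i j i' j'
    by (simp add: lattice_map_def cmod_vec_complex p_def norm_minus_commute)
  have h: "ennreal (\<Sum>(i, j)\<in>{- int k..int k} \<times> {0..int k}. (dev_h lam (lattice_map u) i j)\<^sup>2) \<le> 2 * energy lam u 1 k"
    by (rule bond_sum_le_energy[where X = p and Y = "\<lambda>i j. p (i + 1) j"])
      (auto simp: inj_def p_eq nn in_lat in_strip dev_h_def cmod bond_length_def in_minus)
  have v: "ennreal (\<Sum>(i, j)\<in>{- int k..int k} \<times> {0..<int k}. (dev_v lam (lattice_map u) i j)\<^sup>2) \<le> 2 * energy lam u 1 k"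
    by (rule bond_sum_le_energy[where X = p and Y = "\<lambda>i j. p i (j + 1)"])
      (auto simp: inj_def p_eq nn in_lat in_strip dev_v_def cmod bond_length_def in_minus)
  \<comment> \<open>The diagonals start at their right end point, in agreement with
    \<open>dev_d\<close>.\<close>
  have d: "ennreal (\<Sum>(i, j)\<in>{- int k..int k} \<times> {0..<int k}. (dev_d lam (lattice_map u) i j)\<^sup>2) \<le> 2 * energy lam u 1 k"
    by (rule bond_sum_le_energy[where X = "\<lambda>i j. p (i + 1) j" and Y = "\<lambda>i j. p i (j + 1)"])
      (auto simp: inj_def p_eq nn in_lat in_strip dev_d_def cmod bond_length_def in_minus)
  have plus3: "ennreal (a + b + c) = ennreal a + ennreal b + ennreal c" if "0 \<le> a" "0 \<le> b" "0 \<le> c" for a b c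
    using that by simp
  have "ennreal (window_energy lam (lattice_map u) k) \<le> 2 * energy lam u 1 k + 2 * energy lam u 1 k + 2 * energy lam u 1 k"
    unfolding window_energy_def
    using add_mono[OF add_mono[OF h v] d] by (subst plus3) (auto intro!: sum_nonneg)
  also have "\<dots> = 6 * energy lam u 1 k" unfolding distrib_right[symmetric] by simp
  finally show ?thesis .
qed

subsection \<open>Compactness of rescaled lattice functions\<close>

text \<open>The extension is the infimum of \<open>g a + d x (p a)\<close> over the nodes. It turns
  functions on changing lattices into functions on one domain with a common modulus of continuity,
  as Arzela-Ascoli requires.\<close>

lemma finite_McShane_extension:
  fixes d :: "'a \<Rightarrow> 'a \<Rightarrow> real" and g :: "'b \<Rightarrow> real"
  assumes I: "finite I" "I \<noteq> {}"
    and d: "\<And>x. d x x = 0" "\<And>x y. d x y = d y x" "\<And>x y z. d x z \<le> d x y + d y z"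
    and g: "\<And>a b. a \<in> I \<Longrightarrow> b \<in> I \<Longrightarrow> \<bar>g a - g b\<bar> \<le> d (p a) (p b)"
  obtains G where "\<And>a. a \<in> I \<Longrightarrow> G (p a) = g a" "\<And>x y. \<bar>G x - G y\<bar> \<le> d x y"
proof
  define G where "G x = Min ((\<lambda>a. g a + d x (p a)) ` I)" for x
  have le: "G x \<le> g a + d x (p a)" if "a \<in> I" for a x
    unfolding G_def using I that by (intro Min_le) auto
  have ge: "c \<le> G x" if "\<And>a. a \<in> I \<Longrightarrow> c \<le> g a + d x (p a)" for c x
    unfolding G_def using I that by (subst Min_ge_iff) auto
  show "G (p a) = g a" if "a \<in> I" for a
  proof (rule antisym)
    show "G (p a) \<le> g a" using le[OF that, of "p a"] d by simp
    show "g a \<le> G (p a)" using g[OF that] by (intro ge) (fastforce simp: abs_le_iff)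
  qed
  have "G x - d x y \<le> G y" for x y
  proof (rule ge)
    fix a assume "a \<in> I"
    then show "G x - d x y \<le> g a + d y (p a)" using le[of a x] d(3)[of x "p a" y] by linarith
  qed
  from this[of x y for x y] this[of y x for x y] show "\<bar>G x - G y\<bar> \<le> d x y" for x y
    using d(2)[of x y] by (metis abs_diff_le_iff diff_le_eq le_diff_eq add.commute)
qed

lemma lattice_functions_subconverge:
  fixes g :: "nat \<Rightarrow> int \<Rightarrow> int \<Rightarrow> complex" and k :: "nat \<Rightarrow> nat" and C :: real
  defines "w \<equiv> \<lambda>x. x + sqrt (C * x)"
  assumes C: "0 \<le> C"
    and zero: "\<And>n. g n 0 0 = 0"
    and holder: "\<And>n i i' j j'. \<lbrakk>i \<in> {- int (k n)..int (k n)}; i' \<in> {- int (k n)..int (k n)};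
        j \<in> {0..int (k n)}; j' \<in> {0..int (k n)}\<rbrakk> \<Longrightarrow>
      cmod (g n i' j' - g n i j) \<le>
        w (\<bar>of_int i' - of_int i\<bar> / real (k n)) + w (\<bar>of_int j' - of_int j\<bar> / real (k n))"
  obtains F :: "real \<times> real \<Rightarrow> complex" and r :: "nat \<Rightarrow> nat"
  where "continuous_on ({-1..1} \<times> {0..1}) F" "strict_mono r"
    "\<And>e. 0 < e \<Longrightarrow> \<exists>N. \<forall>n\<ge>N. \<forall>i\<in>{- int (k (r n))..int (k (r n))}. \<forall>j\<in>{0..int (k (r n))}.
        cmod (g (r n) i j - F (of_int i / real (k (r n)), of_int j / real (k (r n)))) < e"
proof -
  \<comment> \<open>Since \<open>w\<close> is increasing and subadditive, the modulus of continuity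
    itself is a metric, and the extension applies with Lipschitz constant 1.\<close>
  define d :: "real \<times> real \<Rightarrow> real \<times> real \<Rightarrow> real"
    where "d x y = w \<bar>fst x - fst y\<bar> + w \<bar>snd x - snd y\<bar>" for x y
  have w_mono: "w x \<le> w y" if "0 \<le> x" "x \<le> y" for x y
    unfolding w_def using that C by (intro add_mono real_sqrt_le_mono mult_left_mono) auto
  have w_sub: "w (x + y) \<le> w x + w y" if "0 \<le> x" "0 \<le> y" for x y
    unfolding w_def using that C sqrt_add_le_add_sqrt[of "C * x" "C * y"] by (simp add: algebra_simps)
  have w0: "w 0 = 0" by (simp add: w_def)
  have w_tri: "w \<bar>x - z\<bar> \<le> w \<bar>x - y\<bar> + w \<bar>y - z\<bar>" for x y z
    using w_mono[of "\<bar>x - z\<bar>" "\<bar>x - y\<bar> + \<bar>y - z\<bar>"] w_sub[of "\<bar>x - y\<bar>" "\<bar>y - z\<bar>"] by linarith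
  have d: "d x x = 0" "d x y = d y x" "d x z \<le> d x y + d y z" for x y z
    unfolding d_def using w_tri[of "fst x" "fst z" "fst y"] w_tri[of "snd x" "snd z" "snd y"] w0
    by (auto simp: abs_minus_commute)
  define I where "I n = {- int (k n)..int (k n)} \<times> {0..int (k n)}" for n
  define p where "p n a = (of_int (fst a) / real (k n), of_int (snd a) / real (k n))" for n and a :: "int \<times> int"
  have I: "finite (I n)" "I n \<noteq> {}" for n unfolding I_def by auto
  have hold: "cmod (g n (fst a) (snd a) - g n (fst b) (snd b)) \<le> d (p n a) (p n b)"
    if "a \<in> I n" "b \<in> I n" for a b n
  proof -
    have "\<bar>real_of_int u / real (k n) - real_of_int v / real (k n)\<bar> = \<bar>of_int u - of_int v\<bar> / real (k n)" for u v
      by (simp add: diff_divide_distrib[symmetric] abs_divide)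
    then show ?thesis
      using holder[of "fst b" n "fst a" "snd b" "snd a"] that unfolding d_def p_def I_def by auto
  qed
  have "\<exists>G. (\<forall>a\<in>I n. G (p n a) = g n (fst a) (snd a)) \<and> (\<forall>x y. cmod (G x - G y) \<le> 2 * d x y)" for n
  proof -
    \<comment> \<open>Real and imaginary part are extended separately, at the price of a factor 2 in
      the modulus.\<close>
    have Re: "\<bar>Re (g n (fst a) (snd a)) - Re (g n (fst b) (snd b))\<bar> \<le> d (p n a) (p n b)"
      and Im: "\<bar>Im (g n (fst a) (snd a)) - Im (g n (fst b) (snd b))\<bar> \<le> d (p n a) (p n b)"
      if "a \<in> I n" "b \<in> I n" for a b
      using hold[OF that] abs_Re_le_cmod[of "g n (fst a) (snd a) - g n (fst b) (snd b)"]
        abs_Im_le_cmod[of "g n (fst a) (snd a) - g n (fst b) (snd b)"] by simp_all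
    obtain R where R: "\<And>a. a \<in> I n \<Longrightarrow> R (p n a) = Re (g n (fst a) (snd a))" "\<And>x y. \<bar>R x - R y\<bar> \<le> d x y"
      using finite_McShane_extension[where d = d and I = "I n" and g = "\<lambda>a. Re (g n (fst a) (snd a))" and p = "p n",
        OF I d Re] by blast
    obtain J where J: "\<And>a. a \<in> I n \<Longrightarrow> J (p n a) = Im (g n (fst a) (snd a))" "\<And>x y. \<bar>J x - J y\<bar> \<le> d x y"
      using finite_McShane_extension[where d = d and I = "I n" and g = "\<lambda>a. Im (g n (fst a) (snd a))" and p = "p n",
        OF I d Im] by blast
    have "cmod (Complex (R x) (J x) - Complex (R y) (J y)) \<le> 2 * d x y" for x y
      using cmod_le[of "Complex (R x) (J x) - Complex (R y) (J y)"] R(2)[of x y] J(2)[of x y] by simp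
    then show ?thesis using R(1) J(1) by (intro exI[of _ "\<lambda>x. Complex (R x) (J x)"]) (auto simp: complex_eq_iff)
  qed
  then obtain G where G: "\<And>n a. a \<in> I n \<Longrightarrow> G n (p n a) = g n (fst a) (snd a)"
    "\<And>n x y. cmod (G n x - G n y) \<le> 2 * d x y" by metis
  define S :: "(real \<times> real) set" where "S = {-1..1} \<times> {0..1}"
  have "compact S" unfolding S_def by (intro compact_Times) auto
  have d_small: "\<exists>\<delta>>0. \<forall>x y. norm (x - y) < \<delta> \<longrightarrow> 2 * d x y < e" if "0 < e" for e
  proof -
    have "(w \<longlongrightarrow> w 0) (at 0)"
      unfolding w_def by (intro tendsto_intros)
    then have "\<forall>\<^sub>F x in at 0. dist (w x) (w 0) < e / 4" using that by (intro tendstoD) auto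
    then obtain \<delta> where "\<delta> > 0" "\<forall>x\<in>UNIV. x \<noteq> 0 \<and> dist x 0 < \<delta> \<longrightarrow> dist (w x) (w 0) < e / 4"
      unfolding eventually_at by blast
    then have \<delta>: "\<delta> > 0" "\<And>x. x \<noteq> 0 \<Longrightarrow> \<bar>x\<bar> < \<delta> \<Longrightarrow> \<bar>w x\<bar> < e / 4"
      by (auto simp: w0 dist_real_def)
    have w_small: "w \<bar>x\<bar> < e / 4" if "\<bar>x\<bar> < \<delta>" for x
      using \<delta>(2)[of "\<bar>x\<bar>"] that \<open>0 < e\<close> by (cases "x = 0") (auto simp: w0)
    have "2 * d x y < e" if "norm (x - y) < \<delta>" for x y
    proof -
      have "\<bar>fst x - fst y\<bar> < \<delta>" "\<bar>snd x - snd y\<bar> < \<delta>"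
        using that dist_fst_le[of x y] dist_snd_le[of x y] unfolding dist_norm real_norm_def by linarith+
      moreover have "2 * (A + B) < e" if "A < e / 4" "B < e / 4" for A B using that by argo
      ultimately show ?thesis unfolding d_def using w_small by blast
    qed
    then show ?thesis using \<delta>(1) by blast
  qed
  obtain F r where F: "continuous_on S F" "strict_mono (r :: nat \<Rightarrow> nat)"
    "\<And>e. 0 < e \<Longrightarrow> \<exists>N. \<forall>n x. n \<ge> N \<and> x \<in> S \<longrightarrow> norm (G (r n) x - F x) < e"
  proof (rule Arzela_Ascoli[OF \<open>compact S\<close>, of G "4 * w 1"])
    fix n x assume "x \<in> S"
    have "(0, 0) \<in> I n" by (simp add: I_def)
    then have "G n (0, 0) = 0" using G(1)[of "(0, 0)" n] zero by (simp add: p_def)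
    then have "norm (G n x) \<le> 2 * d x (0, 0)" using G(2)[of n x "(0, 0)"] by simp
    also have "\<dots> \<le> 4 * w 1"
    proof -
      have "\<bar>fst x\<bar> \<le> 1" "\<bar>snd x\<bar> \<le> 1" using \<open>x \<in> S\<close> unfolding S_def by auto
      then have "w \<bar>fst x\<bar> \<le> w 1" "w \<bar>snd x\<bar> \<le> w 1" by (simp_all add: w_mono)
      then show ?thesis unfolding d_def fst_conv snd_conv diff_zero by argo
    qed
    finally show "norm (G n x) \<le> 4 * w 1" .
  next
    fix x and e :: real assume "0 < e"
    then obtain \<delta> where "\<delta> > 0" "\<forall>x y. norm (x - y) < \<delta> \<longrightarrow> 2 * d x y < e" using d_small by blast
    then show "\<exists>\<delta>. 0 < \<delta> \<and> (\<forall>n y. y \<in> S \<and> norm (x - y) < \<delta> \<longrightarrow> norm (G n x - G n y) < e)"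
      using G(2) by (meson le_less_trans)
  qed blast
  show thesis
  proof (rule that[OF F(1)[unfolded S_def] F(2)])
    fix e :: real assume "0 < e"
    then obtain N where N: "\<And>n x. n \<ge> N \<Longrightarrow> x \<in> S \<Longrightarrow> norm (G (r n) x - F x) < e" using F(3) by blast
    have "cmod (g (r n) i j - F (of_int i / real (k (r n)), of_int j / real (k (r n)))) < e"
      if "n \<ge> N" "i \<in> {- int (k (r n))..int (k (r n))}" "j \<in> {0..int (k (r n))}" for n i j
    proof -
      have "- real (k (r n)) \<le> of_int i" "of_int i \<le> real (k (r n))" "of_int j \<le> real (k (r n))" "0 \<le> real_of_int j"
        using that by auto
      \<comment> \<open>If \<open>k (r n) = 0\<close>, division by zero yields the node
        \<open>(0, 0)\<close>, which also lies in \<open>S\<close>.\<close>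
      then have "p (r n) (i, j) \<in> S"
        unfolding S_def p_def by (cases "k (r n) = 0") (auto simp: field_simps)
      then show ?thesis using N[OF that(1), of "p (r n) (i, j)"] G(1)[of "(i, j)" "r n"] that by (simp add: I_def p_def)
    qed
    then show "\<exists>N. \<forall>n\<ge>N. \<forall>i\<in>{- int (k (r n))..int (k (r n))}. \<forall>j\<in>{0..int (k (r n))}.
        cmod (g (r n) i j - F (of_int i / real (k (r n)), of_int j / real (k (r n)))) < e" by blast
  qed
qed

subsection \<open>Line integrals and holomorphy\<close>

text \<open>The constant \<open>c\<close> is free: a nearby value of \<open>\<phi>\<close> gives a
  quantitative fundamental theorem of calculus, and \<open>c = 0\<close> bounds the integral over a
  short interval.\<close>

lemma integral_diff_approx:
  fixes \<phi> :: "real \<Rightarrow> complex"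
  assumes "continuous_on {a..b} \<phi>" "y \<in> {a..b}" "z \<in> {a..b}"
    and "\<And>t. t \<in> {min y z..max y z} \<Longrightarrow> cmod (\<phi> t - c) \<le> e"
  shows "cmod (integral {a..z} \<phi> - integral {a..y} \<phi> - of_real (z - y) * c) \<le> e * \<bar>z - y\<bar>"
proof -
  have ordered: "cmod (integral {a..z} \<phi> - integral {a..y} \<phi> - of_real (z - y) * c) \<le> e * (z - y)"
    if "y \<in> {a..b}" "z \<in> {a..b}" "y \<le> z" "\<And>t. t \<in> {y..z} \<Longrightarrow> cmod (\<phi> t - c) \<le> e" for y z
  proof -
    have cont: "continuous_on {y..z} \<phi>" "continuous_on {a..z} \<phi>"
      using assms(1) that by (auto intro: continuous_on_subset)
    then have "integral {a..z} \<phi> = integral {a..y} \<phi> + integral {y..z} \<phi>"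
      using that by (intro Henstock_Kurzweil_Integration.integral_combine[symmetric] integrable_continuous_real) auto
    moreover have "integral {y..z} (\<lambda>t. \<phi> t - c) = integral {y..z} \<phi> - of_real (z - y) * c"
      using that cont by (subst Henstock_Kurzweil_Integration.integral_diff) (auto intro: integrable_continuous_real simp: scaleR_conv_of_real)
    moreover have "norm (integral {y..z} (\<lambda>t. \<phi> t - c)) \<le> e * (z - y)"
      using that cont by (intro integral_bound continuous_intros) auto
    ultimately show ?thesis by simp
  qed
  show ?thesis
  proof (cases "y \<le> z")
    case True
    then show ?thesis using ordered[of y z] assms by (simp add: min_def max_def)
  next
    case False
    then have "cmod (integral {a..y} \<phi> - integral {a..z} \<phi> - of_real (y - z) * c) \<le> e * (y - z)"
      using ordered[of z y] assms by (simp add: min_def max_def)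
    moreover have "integral {a..y} \<phi> - integral {a..z} \<phi> - of_real (y - z) * c =
      - (integral {a..z} \<phi> - integral {a..y} \<phi> - of_real (z - y) * c)" by (simp add: algebra_simps)
    ultimately show ?thesis using False by (simp only: norm_minus_cancel) auto
  qed
qed

text \<open>Each term is compared with the increment of the primitive \<open>\<Phi>\<close> over one
  cell, so the main part telescopes. Rounding \<open>x * k n\<close> down loses an interval of
  length at most \<open>1 / k n\<close>.\<close>

lemma lattice_riemann_sum:
  fixes \<phi> :: "real \<Rightarrow> complex" and h :: "nat \<Rightarrow> int \<Rightarrow> complex" and k :: "nat \<Rightarrow> nat" and a0 :: int
  defines "a \<equiv> real_of_int a0"
  assumes \<phi>: "continuous_on {a..b} \<phi>" and x: "x \<in> {a..b}"
    and k: "filterlim k at_top sequentially"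
    and h: "\<And>e. 0 < e \<Longrightarrow> \<forall>\<^sub>F n in sequentially. \<forall>i. a * real (k n) \<le> of_int i \<and> of_int i \<le> b * real (k n) \<longrightarrow>
      cmod (h n i - \<phi> (of_int i / real (k n))) \<le> e"
  shows "(\<lambda>n. (\<Sum>i\<in>{a0 * int (k n)..<\<lfloor>x * real (k n)\<rfloor>}. h n i) / of_nat (k n)) \<longlonglongrightarrow> integral {a..x} \<phi>"
proof (rule LIMSEQ_I)
  fix e :: real assume "0 < e"
  define \<Phi> where "\<Phi> y = integral {a..y} \<phi>" for y
  \<comment> \<open>One \<open>e1\<close> covers the sampling error of \<open>h\<close>, another the
    oscillation of \<open>\<phi>\<close> in a cell; together they use half of \<open>e\<close>. The
    summand 1 admits \<open>a = b\<close>.\<close>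
  define e1 where "e1 = e / (4 * (b - a + 1))"
  have "a \<le> b" using x by simp
  then have e1: "0 < e1" "2 * e1 * (b - a) < e / 2" using \<open>0 < e\<close> unfolding e1_def by (auto simp: field_simps)
  have "bounded (\<phi> ` {a..b})"
    by (rule compact_imp_bounded[OF compact_continuous_image[OF \<phi> compact_Icc]])
  then obtain B where "0 < B" "\<forall>y\<in>\<phi> ` {a..b}. cmod y \<le> B" unfolding bounded_pos by blast
  then have B: "\<And>t. t \<in> {a..b} \<Longrightarrow> cmod (\<phi> t) \<le> B" "0 < B" by blast+
  have "uniformly_continuous_on {a..b} \<phi>" using \<phi> by (intro compact_uniformly_continuous) auto
  then obtain \<delta> where \<delta>: "0 < \<delta>" "\<And>s t. s \<in> {a..b} \<Longrightarrow> t \<in> {a..b} \<Longrightarrow> \<bar>s - t\<bar> < \<delta> \<Longrightarrow> cmod (\<phi> s - \<phi> t) \<le> e1"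
    unfolding uniformly_continuous_on_def dist_norm using e1(1) by (metis less_imp_le real_norm_def)
  \<comment> \<open>Makes cells shorter than \<open>\<delta>\<close> and the integral over the
    rounded-off interval smaller than \<open>e / 2\<close>.\<close>
  define K where "K = nat \<lceil>max (1 / \<delta>) (2 * B / e)\<rceil> + 1"
  have "\<forall>\<^sub>F n in sequentially. K \<le> k n" using k by (simp add: filterlim_at_top)
  then have "\<forall>\<^sub>F n in sequentially. cmod ((\<Sum>i\<in>{a0 * int (k n)..<\<lfloor>x * real (k n)\<rfloor>}. h n i) / of_nat (k n) - \<Phi> x) < e"
    using h[OF e1(1)]
  proof eventually_elim
    case (elim n)
    define kn where "kn = real (k n)"
    define m where "m = \<lfloor>x * kn\<rfloor>"
    have "max (1 / \<delta>) (2 * B / e) < real K" unfolding K_def by linarith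
    then have kn: "1 / \<delta> < kn" "2 * B / e < kn" using elim(1) unfolding kn_def by auto
    have "0 < 1 / \<delta>" using \<delta>(1) by simp
    then have "0 < kn" using kn(1) by linarith
    have inv: "1 / kn < \<delta>" "B / kn < e / 2" using kn \<open>0 < kn\<close> \<delta>(1) \<open>0 < e\<close> by (simp_all add: field_simps)
    have "a * kn \<le> x * kn" using x \<open>0 < kn\<close> by simp
    then have "of_int (a0 * int (k n)) \<le> x * kn" by (simp add: a_def kn_def)
    then have m: "a0 * int (k n) \<le> m" "of_int m \<le> x * kn" "x * kn < of_int m + 1"
      unfolding m_def by (auto simp: le_floor_iff)
    have cell: "i / kn \<in> {a..b} \<and> (i + 1) / kn \<in> {a..b} \<and> a * kn \<le> of_int i \<and> of_int i \<le> b * kn"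
      if "i \<in> {a0 * int (k n)..<m}" for i
    proof -
      have "a0 * int (k n) \<le> i" "i + 1 \<le> m" using that by auto
      then have "of_int (a0 * int (k n)) \<le> real_of_int i" "real_of_int (i + 1) \<le> of_int m"
        by (simp_all only: of_int_le_iff)
      then have "a * kn \<le> of_int i" "of_int i + 1 \<le> x * kn" using m unfolding a_def kn_def by auto
      moreover have "x * kn \<le> b * kn" using x \<open>0 < kn\<close> by simp
      ultimately have "a * kn \<le> of_int i" "of_int i + 1 \<le> b * kn" by linarith+
      then show ?thesis using \<open>0 < kn\<close> by (auto simp: field_simps)
    qed
    have bound: "cmod (h n i / of_real kn - (\<Phi> (of_int (i + 1) / kn) - \<Phi> (of_int i / kn))) \<le> 2 * e1 / kn"
      if i: "i \<in> {a0 * int (k n)..<m}" for i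
    proof -
      have "cmod (\<Phi> ((i + 1) / kn) - \<Phi> (i / kn) - of_real ((i + 1) / kn - i / kn) * \<phi> (i / kn)) \<le> e1 * \<bar>(i + 1) / kn - i / kn\<bar>"
        unfolding \<Phi>_def
      proof (rule integral_diff_approx[OF \<phi>])
        fix t assume "t \<in> {min (i / kn) ((i + 1) / kn)..max (i / kn) ((i + 1) / kn)}"
        moreover have "i / kn \<le> (i + 1) / kn" "(i + 1) / kn = i / kn + 1 / kn"
          using \<open>0 < kn\<close> by (auto simp: divide_right_mono add_divide_distrib)
        ultimately have "t \<in> {i / kn..(i + 1) / kn}" "\<bar>t - i / kn\<bar> < \<delta>" using inv by (auto simp: min_def max_def)
        then show "cmod (\<phi> t - \<phi> (i / kn)) \<le> e1" using cell[OF i] by (intro \<delta>(2)) auto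
      qed (use cell[OF i] in auto)
      moreover have step: "(i + 1) / kn - i / kn = 1 / kn" by (simp add: add_divide_distrib)
      ultimately have "cmod (\<Phi> ((i + 1) / kn) - \<Phi> (i / kn) - of_real (1 / kn) * \<phi> (i / kn)) \<le> e1 * \<bar>1 / kn\<bar>"
        by (simp only: step)
      then have "cmod (\<Phi> ((i + 1) / kn) - \<Phi> (i / kn) - \<phi> (i / kn) / of_real kn) \<le> e1 / kn"
        using \<open>0 < kn\<close> by simp
      moreover have "cmod (h n i / of_real kn - \<phi> (i / kn) / of_real kn) \<le> e1 / kn"
        using elim(2) cell[OF i] \<open>0 < kn\<close> unfolding kn_def
        by (simp add: diff_divide_distrib[symmetric] norm_divide divide_right_mono)
      moreover have "cmod (X - (W - Z)) \<le> cmod (X - Y) + cmod (W - Z - Y)" for X Y Z W :: complex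
        using norm_triangle_ineq4[of "X - Y" "W - Z - Y"] by (simp add: algebra_simps)
      then have "cmod (h n i / of_real kn - (\<Phi> ((i + 1) / kn) - \<Phi> (i / kn))) \<le>
        cmod (h n i / of_real kn - \<phi> (i / kn) / of_real kn) + cmod (\<Phi> ((i + 1) / kn) - \<Phi> (i / kn) - \<phi> (i / kn) / of_real kn)" .
      ultimately show ?thesis by simp
    qed
    have "(\<Sum>i\<in>{a0 * int (k n)..<m}. h n i / of_real kn - (\<Phi> (of_int (i + 1) / kn) - \<Phi> (of_int i / kn)))
      = (\<Sum>i\<in>{a0 * int (k n)..<m}. h n i) / of_real kn - (\<Phi> (m / kn) - \<Phi> (of_int (a0 * int (k n)) / kn))"
      using sum_telescope_int[OF m(1), of "\<lambda>i. \<Phi> (of_int i / kn)"] by (simp add: sum_subtractf sum_divide_distrib)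
    also have "of_int (a0 * int (k n)) / kn = a" using \<open>0 < kn\<close> by (simp add: a_def kn_def)
    also have "\<Phi> a = 0" by (simp add: \<Phi>_def)
    finally have "cmod ((\<Sum>i\<in>{a0 * int (k n)..<m}. h n i) / of_real kn - \<Phi> (m / kn)) \<le> (\<Sum>i\<in>{a0 * int (k n)..<m}. 2 * e1 / kn)"
      using bound by (metis (mono_tags, lifting) diff_zero sum_norm_le)
    also have "\<dots> = of_int (m - a0 * int (k n)) * (2 * e1 / kn)" using m(1) by simp
    also have "\<dots> \<le> ((b - a) * kn) * (2 * e1 / kn)"
    proof (rule mult_right_mono)
      have "x * kn \<le> b * kn" using x \<open>0 < kn\<close> by simp
      then show "of_int (m - a0 * int (k n)) \<le> (b - a) * kn" using m(2) by (simp add: a_def kn_def algebra_simps)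
    qed (use e1 \<open>0 < kn\<close> in auto)
    also have "\<dots> = 2 * e1 * (b - a)" using \<open>0 < kn\<close> by simp
    also have "\<dots> < e / 2" by (rule e1(2))
    finally have sum: "cmod ((\<Sum>i\<in>{a0 * int (k n)..<m}. h n i) / of_real kn - \<Phi> (m / kn)) < e / 2" .
    have mk: "a \<le> m / kn" "m / kn \<le> x" "x - m / kn \<le> 1 / kn"
    proof -
      have "of_int (a0 * int (k n)) \<le> real_of_int m" using m(1) by (simp only: of_int_le_iff)
      then show "a \<le> m / kn" using \<open>0 < kn\<close> by (simp add: a_def kn_def field_simps)
      have "x \<le> (of_int m + 1) / kn" using m(3) \<open>0 < kn\<close> by (simp add: pos_le_divide_eq)
      then show "x - m / kn \<le> 1 / kn" by (simp add: add_divide_distrib)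
      show "m / kn \<le> x" using m(2) \<open>0 < kn\<close> by (simp add: pos_divide_le_eq)
    qed
    have "cmod (\<Phi> x - \<Phi> (m / kn) - of_real (x - m / kn) * 0) \<le> B * \<bar>x - m / kn\<bar>"
      unfolding \<Phi>_def using mk x B by (intro integral_diff_approx[OF \<phi>]) (auto simp: min_def max_def)
    also have "\<dots> \<le> B * (1 / kn)" using mk B(2) by (intro mult_left_mono) auto
    also have "\<dots> < e / 2" using inv by simp
    finally have "cmod (\<Phi> x - \<Phi> (m / kn)) < e / 2" by simp
    with sum have "cmod ((\<Sum>i\<in>{a0 * int (k n)..<m}. h n i) / of_real kn - \<Phi> x) < e"
      by (metis dist_norm dist_triangle_half_l)
    then show ?case by (simp add: m_def kn_def)
  qed
  then show "\<exists>N. \<forall>n\<ge>N. cmod ((\<Sum>i\<in>{a0 * int (k n)..<\<lfloor>x * real (k n)\<rfloor>}. h n i) / of_nat (k n) - integral {a..x} \<phi>) < e"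
    unfolding \<Phi>_def eventually_sequentially .
qed

section \<open>Holomorphy in oblique coordinates\<close>

definition oblique :: "complex \<Rightarrow> real \<times> real" where
  "oblique z = (Re z - Im z / sqrt 3, 2 * Im z / sqrt 3)"

lemma oblique_inverse: "of_real (fst (oblique z)) + of_real (snd (oblique z)) * zeta = z"
  by (simp add: oblique_def complex_eq_iff)

lemma oblique_combination [simp]: "oblique (of_real s + of_real t * zeta) = (s, t)"
  by (simp add: oblique_def field_simps)

lemma oblique_dist_le:
  "\<bar>fst (oblique y) - fst (oblique z)\<bar> \<le> 2 * cmod (y - z)"
  "\<bar>snd (oblique y) - snd (oblique z)\<bar> \<le> 2 * cmod (y - z)"
proof -
  define q where "q = Im (y - z) / sqrt 3"
  have re: "\<bar>Re (y - z)\<bar> \<le> cmod (y - z)" by (rule abs_Re_le_cmod)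
  have "\<bar>q\<bar> \<le> \<bar>Im (y - z)\<bar>"
    using mult_left_mono[of 1 "sqrt 3" "\<bar>Im (y - z)\<bar>"] unfolding q_def
    by (simp add: abs_divide pos_divide_le_eq del: minus_complex.sel)
  then have im: "\<bar>q\<bar> \<le> cmod (y - z)" using abs_Im_le_cmod[of "y - z"] by linarith
  have "fst (oblique y) - fst (oblique z) = Re (y - z) - q" "snd (oblique y) - snd (oblique z) = 2 * q"
    by (simp_all add: oblique_def q_def diff_divide_distrib)
  with re im show "\<bar>fst (oblique y) - fst (oblique z)\<bar> \<le> 2 * cmod (y - z)"
    "\<bar>snd (oblique y) - snd (oblique z)\<bar> \<le> 2 * cmod (y - z)"
    by linarith+
qed

text \<open>The rescaled window without its boundary; the interface is the segment where the first
  oblique coordinate is 0.\<close>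

definition rhombi :: "complex set" where
  "rhombi = {z. oblique z \<in> {-1<..<1} \<times> {0<..<1}}"

lemma open_rhombi: "open rhombi"
proof -
  have "continuous_on UNIV oblique"
    unfolding oblique_def by (intro continuous_intros) auto
  then have "open (oblique -` ({-1<..<1} \<times> {0<..<1}))"
    by (intro open_vimage open_Times) auto
  then show ?thesis by (simp add: rhombi_def vimage_def)
qed

text \<open>The form \<open>F dz\<close> is closed on rhombi with sides along the lattice directions, so \<open>F\<close> has a primitive there.\<close>

lemma holomorphic_of_closed_form:
  fixes F :: "real \<times> real \<Rightarrow> complex"
  assumes F: "continuous_on ({-1..1} \<times> {0..1}) F"
    and closed: "\<And>s t. s \<in> {-1..1} \<Longrightarrow> t \<in> {0..1} \<Longrightarrow>
      integral {-1..s} (\<lambda>\<sigma>. F (\<sigma>, 0)) - integral {-1..s} (\<lambda>\<sigma>. F (\<sigma>, t)) +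
      zeta * (integral {0..t} (\<lambda>\<tau>. F (s, \<tau>)) - integral {0..t} (\<lambda>\<tau>. F (-1, \<tau>))) = 0"
  shows "(\<lambda>z. F (oblique z)) holomorphic_on rhombi"
proof -
  define G where "G s t = integral {-1..s} (\<lambda>\<sigma>. F (\<sigma>, t)) + zeta * integral {0..t} (\<lambda>\<tau>. F (-1, \<tau>))" for s t
  \<comment> \<open>Closedness lets the primitive be computed along the other two sides as well, so
    that both partial increments are single integrals.\<close>
  have G2: "G s t = integral {-1..s} (\<lambda>\<sigma>. F (\<sigma>, 0)) + zeta * integral {0..t} (\<lambda>\<tau>. F (s, \<tau>))"
    if "s \<in> {-1..1}" "t \<in> {0..1}" for s t
    using closed[OF that] unfolding G_def by (simp add: algebra_simps)
  define H where "H z = G (fst (oblique z)) (snd (oblique z))" for z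
  have deriv: "(H has_field_derivative F (oblique z)) (at z)" if z: "z \<in> rhombi" for z
    unfolding has_field_derivative_def has_derivative_at_alt
  proof (intro conjI allI impI)
    fix e :: real assume "0 < e"
    obtain s t where st: "oblique z = (s, t)" by (cases "oblique z")
    then have "s \<in> {-1..1}" "t \<in> {0..1}" "(s, t) \<in> {-1..1} \<times> {0..1}" using z by (auto simp: rhombi_def)
    moreover have "0 < e / 4" using \<open>0 < e\<close> by simp
    ultimately obtain \<delta> where \<delta>: "0 < \<delta>"
      "\<And>q. q \<in> {-1..1} \<times> {0..1} \<Longrightarrow> dist q (s, t) < \<delta> \<Longrightarrow> dist (F q) (F (s, t)) < e / 4"
      using F[unfolded continuous_on_iff] by blast
    obtain r where r: "0 < r" "ball z r \<subseteq> rhombi"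
      by (rule openE[OF open_rhombi z])
    show "\<exists>d>0. \<forall>y. norm (y - z) < d \<longrightarrow> norm (H y - H z - F (oblique z) * (y - z)) \<le> e * norm (y - z)"
    proof (intro exI[of _ "min r (\<delta> / 4)"] conjI allI impI)
      fix y assume y: "norm (y - z) < min r (\<delta> / 4)"
      obtain s' t' where st': "oblique y = (s', t')" by (cases "oblique y")
      have "y \<in> rhombi" using y r by (auto simp: dist_norm norm_minus_commute)
      then have mem': "s' \<in> {-1..1}" "t' \<in> {0..1}" by (auto simp: rhombi_def st')
      have near: "\<bar>s' - s\<bar> \<le> 2 * cmod (y - z)" "\<bar>t' - t\<bar> \<le> 2 * cmod (y - z)"
        using oblique_dist_le[of y z] by (simp_all add: st st')
      then have near': "\<bar>s' - s\<bar> < \<delta> / 2" "\<bar>t' - t\<bar> < \<delta> / 2" using y by auto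
      have close: "cmod (F (\<sigma>, \<tau>) - F (s, t)) \<le> e / 4"
        if "\<sigma> \<in> {-1..1}" "\<tau> \<in> {0..1}" "\<bar>\<sigma> - s\<bar> < \<delta> / 2" "\<bar>\<tau> - t\<bar> < \<delta> / 2" for \<sigma> \<tau>
      proof -
        have "dist (\<sigma>, \<tau>) (s, t) \<le> \<bar>\<sigma> - s\<bar> + \<bar>\<tau> - t\<bar>"
          unfolding dist_prod_def dist_real_def by (simp add: sqrt_sum_squares_le_sum_abs)
        then show ?thesis using \<delta>(2)[of "(\<sigma>, \<tau>)"] that by (simp add: dist_norm)
      qed
      have cont_row: "continuous_on {-1..1} (\<lambda>\<sigma>. F (\<sigma>, t'))"
        using mem' by (intro continuous_on_compose2[OF F] continuous_intros) auto
      have cont_col: "continuous_on {0..1} (\<lambda>\<tau>. F (s, \<tau>))"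
        using \<open>s \<in> {-1..1}\<close> by (intro continuous_on_compose2[OF F] continuous_intros) auto
      have row: "cmod (integral {-1..s'} (\<lambda>\<sigma>. F (\<sigma>, t')) - integral {-1..s} (\<lambda>\<sigma>. F (\<sigma>, t')) - of_real (s' - s) * F (s, t)) \<le> e / 4 * \<bar>s' - s\<bar>"
      proof (rule integral_diff_approx[OF cont_row])
        fix \<sigma> assume "\<sigma> \<in> {min s s'..max s s'}"
        then show "cmod (F (\<sigma>, t') - F (s, t)) \<le> e / 4"
          using mem' \<open>s \<in> {-1..1}\<close> near' by (intro close) (auto simp: min_def max_def split: if_splits)
      qed (use mem' \<open>s \<in> {-1..1}\<close> in auto)
      have col: "cmod (integral {0..t'} (\<lambda>\<tau>. F (s, \<tau>)) - integral {0..t} (\<lambda>\<tau>. F (s, \<tau>)) - of_real (t' - t) * F (s, t)) \<le> e / 4 * \<bar>t' - t\<bar>"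
      proof (rule integral_diff_approx[OF cont_col])
        fix \<tau> assume "\<tau> \<in> {min t t'..max t t'}"
        then show "cmod (F (s, \<tau>) - F (s, t)) \<le> e / 4"
          using mem' \<open>s \<in> {-1..1}\<close> \<open>t \<in> {0..1}\<close> near' \<delta>(1) by (intro close) (auto simp: min_def max_def split: if_splits)
      qed (use mem' \<open>t \<in> {0..1}\<close> in auto)
      have yz: "y - z = of_real (s' - s) + of_real (t' - t) * zeta"
        using oblique_inverse[of y] oblique_inverse[of z] unfolding st st' by (simp add: algebra_simps)
      \<comment> \<open>From \<open>z\<close> the path follows column \<open>s\<close> up to height
        \<open>t'\<close>, then row \<open>t'\<close> up to \<open>s'\<close>.\<close>
      have Hyz: "H y - H z = (integral {-1..s'} (\<lambda>\<sigma>. F (\<sigma>, t')) - integral {-1..s} (\<lambda>\<sigma>. F (\<sigma>, t'))) +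
          zeta * (integral {0..t'} (\<lambda>\<tau>. F (s, \<tau>)) - integral {0..t} (\<lambda>\<tau>. F (s, \<tau>)))"
      proof -
        have "H y - H z = (G s' t' - G s t') + (G s t' - G s t)" by (simp add: H_def st st')
        moreover have "G s' t' - G s t' = integral {-1..s'} (\<lambda>\<sigma>. F (\<sigma>, t')) - integral {-1..s} (\<lambda>\<sigma>. F (\<sigma>, t'))"
          by (simp add: G_def)
        moreover have "G s t' - G s t = zeta * (integral {0..t'} (\<lambda>\<tau>. F (s, \<tau>)) - integral {0..t} (\<lambda>\<tau>. F (s, \<tau>)))"
          using G2 mem' \<open>s \<in> {-1..1}\<close> \<open>t \<in> {0..1}\<close> by (simp add: algebra_simps)
        ultimately show ?thesis by simp
      qed
      have "H y - H z - F (s, t) * (y - z) =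
        (integral {-1..s'} (\<lambda>\<sigma>. F (\<sigma>, t')) - integral {-1..s} (\<lambda>\<sigma>. F (\<sigma>, t')) - of_real (s' - s) * F (s, t)) +
        zeta * (integral {0..t'} (\<lambda>\<tau>. F (s, \<tau>)) - integral {0..t} (\<lambda>\<tau>. F (s, \<tau>)) - of_real (t' - t) * F (s, t))"
        unfolding yz Hyz by (simp add: algebra_simps)
      also have "cmod \<dots> \<le> e / 4 * \<bar>s' - s\<bar> + e / 4 * \<bar>t' - t\<bar>"
        by (rule norm_triangle_mono[OF row]) (use col in \<open>simp add: norm_mult\<close>)
      also have "\<dots> \<le> e / 4 * (2 * cmod (y - z)) + e / 4 * (2 * cmod (y - z))"
        using near \<open>0 < e\<close> by (intro add_mono mult_left_mono) auto
      finally show "norm (H y - H z - F (oblique z) * (y - z)) \<le> e * norm (y - z)" by (simp add: st)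
    qed (use r \<delta> in auto)
  qed (rule bounded_linear_mult_right)
  then have "H holomorphic_on rhombi"
    using open_rhombi by (auto simp: holomorphic_on_open)
  then have "deriv H holomorphic_on rhombi" using open_rhombi by (rule holomorphic_deriv)
  moreover have "deriv H z = F (oblique z)" if "z \<in> rhombi" for z using deriv[OF that] by (rule DERIV_imp_deriv)
  ultimately show ?thesis by (simp cong: holomorphic_cong)
qed

text \<open>Taylor expansion with a second derivative bounded on a compact disc. The quadratic order
  is essential: in the area estimate it has to beat the number of cells, which is quadratic in the
  side length.\<close>

lemma holomorphic_quadratic_remainder:
  assumes "f holomorphic_on A" "open A" "z \<in> A"
  obtains r B where "0 < r" "0 \<le> B" "cball z r \<subseteq> A"
    "\<And>y. y \<in> cball z r \<Longrightarrow> cmod (f y - f z - deriv f z * (y - z)) \<le> B * (cmod (y - z))\<^sup>2"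
proof -
  obtain r where r: "0 < r" "cball z r \<subseteq> A" using assms(2,3) by (auto simp: open_contains_cball)
  have f1: "deriv f holomorphic_on A" and f2: "deriv (deriv f) holomorphic_on A"
    using assms(1,2) by (auto intro: holomorphic_deriv)
  have "continuous_on (cball z r) (deriv (deriv f))"
    using f2 r holomorphic_on_imp_continuous_on continuous_on_subset by blast
  then have "bounded (deriv (deriv f) ` cball z r)"
    by (intro compact_imp_bounded compact_continuous_image compact_cball)
  then obtain B where B: "0 < B" "\<forall>y\<in>deriv (deriv f) ` cball z r. cmod y \<le> B" unfolding bounded_pos by blast
  define d where "d i = (if i = 0 then f else if i = 1 then deriv f else deriv (deriv f))" for i :: nat
  show thesis
  proof (rule that[of r B])
    fix y assume y: "y \<in> cball z r"
    have "cmod (d 0 y - (\<Sum>i\<le>1. d i z * (y - z) ^ i / fact i)) \<le> B * cmod (y - z) ^ Suc 1 / fact 1"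
    proof (rule complex_Taylor)
      show "(d i has_field_derivative d (Suc i) x) (at x within cball z r)" if "x \<in> cball z r" "i \<le> 1" for i x
      proof -
        have "x \<in> A" using that r by blast
        then have "(f has_field_derivative deriv f x) (at x)" "(deriv f has_field_derivative deriv (deriv f) x) (at x)"
          using assms(1,2) f1 holomorphic_derivI by blast+
        then show ?thesis using that(2) by (cases "i = 0") (auto simp: d_def intro: has_field_derivative_at_within)
      qed
      show "cmod (d (Suc 1) x) \<le> B" if "x \<in> cball z r" for x using that B by (simp add: d_def)
    qed (use y r in auto)
    then show "cmod (f y - f z - deriv f z * (y - z)) \<le> B * (cmod (y - z))\<^sup>2"
      by (simp add: d_def algebra_simps power2_eq_square)
  qed (use r B(1) in simp_all)
qed

subsection \<open>Rigidity on a lattice rhombus\<close>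

text \<open>Write the linear map on the triangle as h -> a h + b conj(h), so that \<open>e1\<close>
  is a + b. Then \<open>b\<close> in the proof is the antiholomorphic coefficient, the cross product
  is sqrt(3)/2 times |a|^2 - |b|^2, and the claim is the parallelogram law |a + b|^2 + |a - b|^2 = 2
  |a|^2 + 2 |b|^2 with |a - b|^2 dropped.\<close>

lemma triangle_edge_le_wirtinger:
  "(cmod e1)\<^sup>2 \<le> 4 / 3 * (cmod (e2 - zeta * e1))\<^sup>2 + 4 / sqrt 3 * Im (cnj e1 * e2)"
proof -
  define b where "b = \<i> * (e2 - zeta * e1) / sqrt 3"
  have s3: "sqrt 3 * (sqrt 3 * x) = 3 * x" "sqrt 3 * sqrt 3 = (3::real)" for x :: real
    by (simp_all flip: mult.assoc)
  have "4 / 3 * (cmod (e2 - zeta * e1))\<^sup>2 + 4 / sqrt 3 * Im (cnj e1 * e2) - (cmod e1)\<^sup>2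
    = (cmod (e1 - 2 * b))\<^sup>2"
    unfolding b_def cmod_power2
    by (simp add: power2_eq_square field_simps s3)
  then show ?thesis by (smt (verit) zero_le_power2)
qed

text \<open>The cross product of \<open>v l\<close> with itself vanishes, so each term sees only the
  increment: the area swept by a path is bounded by its supremum times its length.\<close>

lemma sum_abs_cross_le:
  fixes v :: "int \<Rightarrow> complex"
  assumes "\<And>l. l \<in> {a..<b} \<Longrightarrow> cmod (v l) \<le> V" "(\<Sum>l\<in>{a..<b}. cmod (v (l + 1) - v l)) \<le> L" "0 \<le> V"
  shows "\<bar>\<Sum>l\<in>{a..<b}. Im (cnj (v l) * v (l + 1))\<bar> \<le> V * L"
proof -
  have "\<bar>Im (cnj (v l) * v (l + 1))\<bar> \<le> V * cmod (v (l + 1) - v l)" if "l \<in> {a..<b}" for l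
  proof -
    have "Im (cnj (v l) * v (l + 1)) = Im (cnj (v l) * (v (l + 1) - v l))"
      by (simp add: algebra_simps)
    also have "\<bar>\<dots>\<bar> \<le> cmod (v l) * cmod (v (l + 1) - v l)"
      by (metis abs_Im_le_cmod complex_mod_cnj norm_mult)
    also have "\<dots> \<le> V * cmod (v (l + 1) - v l)" using assms(1)[OF that] by (rule mult_right_mono) simp
    finally show ?thesis .
  qed
  then have "\<bar>\<Sum>l\<in>{a..<b}. Im (cnj (v l) * v (l + 1))\<bar> \<le> (\<Sum>l\<in>{a..<b}. V * cmod (v (l + 1) - v l))"
    by (intro order.trans[OF sum_abs] sum_mono)
  also have "\<dots> \<le> V * L" unfolding sum_distrib_left[symmetric] using assms(2,3) by (rule mult_left_mono)
  finally show ?thesis .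
qed

text \<open>The increments of \<open>v = U - affine\<close> are controlled by the Wirtinger defects and by the total signed
  area of \<open>v\<close>, which is a boundary term and hence small when \<open>v\<close> is uniformly small.\<close>

lemma rhombus_slope_estimate:
  fixes i0 j0 N :: int
  assumes lam: "0 < lam" "lam \<le> 1" and C: "0 \<le> C"
    and U: "orientation_preserving U k" "window_energy lam U k \<le> C * real k"
    and R: "- int k \<le> i0" "i0 + N \<le> int k" "0 \<le> j0" "j0 + N \<le> int k" "0 \<le> N"
    and m: "\<And>i. i \<in> {i0..<i0 + N} \<Longrightarrow> bond_length lam i = m"
    and V: "\<And>i j. i \<in> {i0..i0 + N} \<Longrightarrow> j \<in> {j0..j0 + N} \<Longrightarrow> cmod (U i j - (w + c * (of_int i + of_int j * zeta))) \<le> V"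
  shows "(of_int N)\<^sup>2 * (cmod c - m)\<^sup>2 \<le>
    (258 * C + 86) * real k + 20 * V * (of_int N * (1 + cmod c) + sqrt (of_int N * (C * real k)))"
proof -
  define E where "E = window_energy lam U k"
  define v where "v i j = U i j - (w + c * (of_int i + of_int j * zeta))" for i j
  let ?A = "{i0..<i0 + N} \<times> {j0..<j0 + N}"
  have "0 \<le> V" using V[of i0 j0] R by (smt (verit) norm_ge_zero atLeastAtMost_iff)
  have vh: "v (i + 1) j - v i j = U (i + 1) j - U i j - c" for i j
    by (simp add: v_def algebra_simps)
  have vv: "v i (j + 1) - v i j = U i (j + 1) - U i j - c * zeta" for i j
    by (simp add: v_def algebra_simps)
  have dbar: "dbar_up v i j = dbar_up U i j" "dbar_down v i j = dbar_down U i j" for i j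
    by (simp_all add: dbar_up_def dbar_down_def v_def algebra_simps)
  \<comment> \<open>Only the area of a whole cell is a difference of edge terms, so the two
    triangles of a cell must be kept together.\<close>
  have areas: "area_up v i j + area_down v i j =
    (Im (cnj (v i j) * v (i + 1) j) - Im (cnj (v i (j + 1)) * v (i + 1) (j + 1))) +
    (Im (cnj (v (i + 1) j) * v (i + 1) (j + 1)) - Im (cnj (v i j) * v i (j + 1)))" for i j
    by (simp add: area_up_def area_down_def algebra_simps)
  have edge: "(cmod (U (i + 1) j - U i j - c))\<^sup>2 \<le>
    4 / 3 * ((cmod (dbar_up U i j))\<^sup>2 + (cmod (dbar_down U i j))\<^sup>2) + 4 / sqrt 3 * (area_up v i j + area_down v i j)" for i j
  proof -
    have "(cmod (v (i + 1) j - v i j))\<^sup>2 \<le> 4 / 3 * (cmod (dbar_up v i j))\<^sup>2 + 4 / sqrt 3 * area_up v i j"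
      unfolding dbar_up_def area_up_def by (rule triangle_edge_le_wirtinger)
    moreover have "(cmod (v i (j + 1) - v (i + 1) (j + 1)))\<^sup>2 \<le> 4 / 3 * (cmod (dbar_down v i j))\<^sup>2 + 4 / sqrt 3 * area_down v i j"
      unfolding dbar_down_def area_down_def by (rule triangle_edge_le_wirtinger)
    ultimately show ?thesis
      unfolding dbar vh distrib_left using zero_le_power2[of "cmod (v i (j + 1) - v (i + 1) (j + 1))"] by linarith
  qed
  define L where "L = of_int N * (1 + cmod c) + sqrt (of_int N * (C * real k))"
  have sqrt_E: "sqrt (of_int N * E) \<le> sqrt (of_int N * (C * real k))"
    using U(2) R(5) unfolding E_def by (intro real_sqrt_le_mono mult_left_mono) auto
  have row: "(\<Sum>l\<in>{i0..<i0 + N}. cmod (v (l + 1) j - v l j)) \<le> L" if "j \<in> {j0..j0 + N}" for j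
  proof -
    have "(\<Sum>l\<in>{i0..<i0 + N}. cmod (v (l + 1) j - v l j)) \<le> (\<Sum>l\<in>{i0..<i0 + N}. cmod (U (l + 1) j - U l j) + cmod c)"
      unfolding vh by (intro sum_mono norm_triangle_ineq4)
    also have "\<dots> = (\<Sum>l\<in>{i0..<i0 + N}. cmod (U (l + 1) j - U l j)) + of_int N * cmod c"
      using R(5) by (simp add: sum.distrib)
    also have "\<dots> \<le> of_int N + sqrt (of_int N * E) + of_int N * cmod c"
      using row_length_le[of lam k i0 "i0 + N" j U] lam R that unfolding E_def by auto
    finally show ?thesis using sqrt_E unfolding L_def distrib_left mult_1_right by linarith
  qed
  have column: "(\<Sum>l\<in>{j0..<j0 + N}. cmod (v i (l + 1) - v i l)) \<le> L" if "i \<in> {i0..i0 + N}" for i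
  proof -
    have "(\<Sum>l\<in>{j0..<j0 + N}. cmod (v i (l + 1) - v i l)) \<le> (\<Sum>l\<in>{j0..<j0 + N}. cmod (U i (l + 1) - U i l) + cmod (c * zeta))"
      unfolding vv by (intro sum_mono norm_triangle_ineq4)
    also have "\<dots> = (\<Sum>l\<in>{j0..<j0 + N}. cmod (U i (l + 1) - U i l)) + of_int N * cmod c"
      using R(5) by (simp add: sum.distrib norm_mult)
    also have "\<dots> \<le> of_int N + sqrt (of_int N * E) + of_int N * cmod c"
      using column_length_le[of lam k i j0 "j0 + N" U] lam R that unfolding E_def by auto
    finally show ?thesis using sqrt_E unfolding L_def distrib_left mult_1_right by linarith
  qed
  have "(\<Sum>(i, j)\<in>?A. area_up v i j + area_down v i j) =
     (\<Sum>i\<in>{i0..<i0 + N}. Im (cnj (v i j0) * v (i + 1) j0) - Im (cnj (v i (j0 + N)) * v (i + 1) (j0 + N))) +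
     (\<Sum>j\<in>{j0..<j0 + N}. Im (cnj (v (i0 + N) j) * v (i0 + N) (j + 1)) - Im (cnj (v i0 j) * v i0 (j + 1)))"
    unfolding areas using R(5)
      sum_cells_eq_boundary[of i0 "i0 + N" j0 "j0 + N" "\<lambda>i j. Im (cnj (v i j) * v (i + 1) j)" "\<lambda>i j. Im (cnj (v i j) * v i (j + 1))"]
    by simp
  also have "\<dots> \<le> V * L + V * L + (V * L + V * L)"
  proof -
    have vV: "cmod (v i j) \<le> V" if "i \<in> {i0..i0 + N}" "j \<in> {j0..j0 + N}" for i j
      using V that unfolding v_def by blast
    have rows: "\<bar>\<Sum>i\<in>{i0..<i0 + N}. Im (cnj (v i j) * v (i + 1) j)\<bar> \<le> V * L" if "j \<in> {j0..j0 + N}" for j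
      using row that vV \<open>0 \<le> V\<close> by (intro sum_abs_cross_le) auto
    have columns: "\<bar>\<Sum>j\<in>{j0..<j0 + N}. Im (cnj (v i j) * v i (j + 1))\<bar> \<le> V * L" if "i \<in> {i0..i0 + N}" for i
      using column that vV \<open>0 \<le> V\<close> by (intro sum_abs_cross_le) auto
    have mem: "j0 \<in> {j0..j0 + N}" "j0 + N \<in> {j0..j0 + N}" "i0 \<in> {i0..i0 + N}" "i0 + N \<in> {i0..i0 + N}"
      using R(5) by auto
    from rows[OF mem(1)] rows[OF mem(2)] columns[OF mem(3)] columns[OF mem(4)] show ?thesis
      unfolding sum_subtractf by linarith
  qed
  finally have area: "(\<Sum>(i, j)\<in>?A. area_up v i j + area_down v i j) \<le> 4 * (V * L)" by linarith
  have defect: "(\<Sum>(i, j)\<in>?A. (cmod (dbar_up U i j))\<^sup>2 + (cmod (dbar_down U i j))\<^sup>2) \<le> (96 * C + 32) * real k"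
  proof -
    have "?A \<subseteq> {- int k..<int k} \<times> {0..<int k}" using R by auto
    from dbar_sum_le[OF lam U(1) this] show ?thesis using U(2) unfolding distrib_right by linarith
  qed
  have "0 \<le> V * L" using \<open>0 \<le> V\<close> R(5) C unfolding L_def by (intro mult_nonneg_nonneg add_nonneg_nonneg) auto
  have "(\<Sum>(i, j)\<in>?A. (cmod (U (i + 1) j - U i j - c))\<^sup>2) \<le>
    (\<Sum>(i, j)\<in>?A. 4 / 3 * ((cmod (dbar_up U i j))\<^sup>2 + (cmod (dbar_down U i j))\<^sup>2) + 4 / sqrt 3 * (area_up v i j + area_down v i j))"
    using edge by (intro sum_mono) auto
  also have "\<dots> = 4 / 3 * (\<Sum>(i, j)\<in>?A. (cmod (dbar_up U i j))\<^sup>2 + (cmod (dbar_down U i j))\<^sup>2) +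
     4 / sqrt 3 * (\<Sum>(i, j)\<in>?A. area_up v i j + area_down v i j)"
    unfolding sum_distrib_left sum.distrib[symmetric] by (intro sum.cong) auto
  also have "\<dots> \<le> 4 / 3 * ((96 * C + 32) * real k) + 4 / sqrt 3 * (4 * (V * L))"
    by (intro add_mono mult_left_mono defect area) auto
  also have "\<dots> \<le> 4 / 3 * ((96 * C + 32) * real k) + 10 * (V * L)"
  proof -
    have "8 / 5 \<le> sqrt 3" by (rule real_le_rsqrt) (simp add: power2_eq_square)
    then have "4 / sqrt 3 \<le> 5 / 2" by (simp add: field_simps)
    then have "4 / sqrt 3 * (4 * (V * L)) \<le> 5 / 2 * (4 * (V * L))" using \<open>0 \<le> V * L\<close> by (intro mult_right_mono) auto
    then show ?thesis by linarith
  qed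
  finally have sum_edges: "(\<Sum>(i, j)\<in>?A. (cmod (U (i + 1) j - U i j - c))\<^sup>2) \<le> 4 / 3 * ((96 * C + 32) * real k) + 10 * (V * L)" .
  have sum_dev: "(\<Sum>(i, j)\<in>?A. (dev_h lam U i j)\<^sup>2) \<le> C * real k"
  proof -
    have "?A \<subseteq> {- int k..int k} \<times> {0..int k}" using R by auto
    then have "(\<Sum>(i, j)\<in>?A. (dev_h lam U i j)\<^sup>2) \<le> window_energy lam U k"
      using dev_h_sum_le[of "\<lambda>x. x" ?A k lam U] by simp
    then show ?thesis using U(2) by linarith
  qed
  \<comment> \<open>\<open>cmod c\<close> is compared with the bond length, and the bond length with
    its rest length \<open>m\<close>; summation over all cells then averages both errors.\<close>
  have "(cmod c - m)\<^sup>2 \<le> 2 * (cmod (U (i + 1) j - U i j - c))\<^sup>2 + 2 * (dev_h lam U i j)\<^sup>2" if "i \<in> {i0..<i0 + N}" for i j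
  proof -
    define x y where "x = cmod c - cmod (U (i + 1) j - U i j)" and "y = dev_h lam U i j"
    have "cmod c - m = x + y" unfolding x_def y_def dev_h_def m[OF that] by simp
    moreover have "\<bar>x\<bar> \<le> cmod (U (i + 1) j - U i j - c)"
      unfolding x_def using norm_triangle_ineq3[of c "U (i + 1) j - U i j"] by (simp add: norm_minus_commute)
    then have "x\<^sup>2 \<le> (cmod (U (i + 1) j - U i j - c))\<^sup>2" by (metis abs_ge_zero power2_abs power_mono)
    moreover have "(x + y)\<^sup>2 \<le> 2 * x\<^sup>2 + 2 * y\<^sup>2" using zero_le_power2[of "x - y"] by (simp add: power2_eq_square algebra_simps)
    ultimately show ?thesis unfolding y_def by simp
  qed
  then have "(\<Sum>(i, j)\<in>?A. (cmod c - m)\<^sup>2) \<le> (\<Sum>(i, j)\<in>?A. 2 * (cmod (U (i + 1) j - U i j - c))\<^sup>2 + 2 * (dev_h lam U i j)\<^sup>2)"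
    by (intro sum_mono) auto
  also have "\<dots> = 2 * (\<Sum>(i, j)\<in>?A. (cmod (U (i + 1) j - U i j - c))\<^sup>2) + 2 * (\<Sum>(i, j)\<in>?A. (dev_h lam U i j)\<^sup>2)"
    unfolding sum_distrib_left sum.distrib[symmetric] by (intro sum.cong) auto
  also have "\<dots> \<le> 2 * (4 / 3 * ((96 * C + 32) * real k) + 10 * (V * L)) + 2 * (C * real k)"
    by (intro add_mono mult_left_mono sum_edges sum_dev) auto
  \<comment> \<open>Here 258 is \<open>2 * 4 / 3 * 96 + 2\<close>, and 86 rounds up
    \<open>2 * 4 / 3 * 32\<close>.\<close>
  also have "\<dots> \<le> (258 * C + 86) * real k + 20 * (V * L)" by (simp add: algebra_simps)
  finally have "(\<Sum>(i, j)\<in>?A. (cmod c - m)\<^sup>2) \<le> (258 * C + 86) * real k + 20 * (V * L)" .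
  moreover have "(\<Sum>(i, j)\<in>?A. (cmod c - m)\<^sup>2) = (of_int N)\<^sup>2 * (cmod c - m)\<^sup>2"
  proof -
    have "real (card ?A) = (of_int N)\<^sup>2" using R(5) by (simp add: power2_eq_square)
    then show ?thesis by (simp add: case_prod_unfold)
  qed
  ultimately show ?thesis unfolding L_def by (simp only: mult.assoc)
qed

subsection \<open>The contradiction in the limit\<close>

lemma norm_diff_halves:
  fixes a b c :: "'a :: real_normed_vector"
  assumes "norm (b - c) < e / 2" "norm (a - b) < e / 2"
  shows "norm (a - c) \<le> e"
  using norm_diff_triangle_less[OF assms(2,1)] by simp

text \<open>A sequence violating superlinear growth, after passage to a convergent subsequence. The
  assumptions turn out to be inconsistent.\<close>

locale lattice_limit =
  fixes lam C :: real and U :: "nat \<Rightarrow> int \<Rightarrow> int \<Rightarrow> complex" and k :: "nat \<Rightarrow> nat"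
    and F :: "real \<times> real \<Rightarrow> complex"
  assumes lam: "0 < lam" "lam < 1" and C: "0 \<le> C"
    and k_pos: "0 < k n"
    and k_lim: "filterlim k at_top sequentially"
    and orient: "orientation_preserving (U n) (k n)"
    and energy: "window_energy lam (U n) (k n) \<le> C * real (k n)"
    and F: "continuous_on ({-1..1} \<times> {0..1}) F"
    and conv: "0 < e \<Longrightarrow> \<forall>\<^sub>F n in sequentially. \<forall>i\<in>{- int (k n)..int (k n)}. \<forall>j\<in>{0..int (k n)}.
        cmod ((U n i j - U n 0 0) / of_nat (k n) - F (of_int i / real (k n), of_int j / real (k n))) < e"
begin

definition g :: "nat \<Rightarrow> int \<Rightarrow> int \<Rightarrow> complex" where
  "g n i j = (U n i j - U n 0 0) / of_nat (k n)"

lemma k_large: "\<forall>\<^sub>F n in sequentially. x < real (k n)"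
proof -
  have "\<forall>\<^sub>F n in sequentially. nat \<lceil>x\<rceil> + 1 \<le> k n" using k_lim by (simp add: filterlim_at_top)
  then show ?thesis by eventually_elim linarith
qed

lemma F_uniform:
  assumes "0 < e"
  shows "\<exists>d>0. \<forall>p\<in>{-1..1} \<times> {0..1}. \<forall>q\<in>{-1..1} \<times> {0..1}. dist p q < d \<longrightarrow> cmod (F p - F q) < e"
proof -
  have "uniformly_continuous_on ({-1..1} \<times> {0..1}) F"
    using F by (intro compact_uniformly_continuous compact_Times) auto
  then show ?thesis using assms unfolding uniformly_continuous_on_def dist_norm[of "F _"] by (metis dist_commute)
qed

text \<open>The strict bound by \<open>a * kn - 1\<close> improves to \<open>a * kn\<close> wherever
  that number is an integer, as it is at the borders of the window.\<close>

lemma floor_window: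
  assumes "0 < kn" "x \<in> {a..b}"
  shows "a * kn - 1 < of_int \<lfloor>x * kn\<rfloor>" "of_int \<lfloor>x * kn\<rfloor> \<le> b * kn" "\<bar>of_int \<lfloor>x * kn\<rfloor> / kn - x\<bar> \<le> 1 / kn"
proof -
  have "a * kn \<le> x * kn" "x * kn \<le> b * kn" using assms by auto
  then show "a * kn - 1 < of_int \<lfloor>x * kn\<rfloor>" "of_int \<lfloor>x * kn\<rfloor> \<le> b * kn" by linarith+
  have "of_int \<lfloor>x * kn\<rfloor> / kn - x = (of_int \<lfloor>x * kn\<rfloor> - x * kn) / kn" using assms(1) by (simp add: field_simps)
  moreover have "\<bar>of_int \<lfloor>x * kn\<rfloor> - x * kn\<bar> \<le> 1" by linarith
  ultimately show "\<bar>of_int \<lfloor>x * kn\<rfloor> / kn - x\<bar> \<le> 1 / kn" using assms(1) by (simp add: abs_divide divide_right_mono)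
qed

text \<open>An error of \<open>1 / k n\<close> is allowed in each coordinate because a real position
  times \<open>k n\<close> has to be rounded to a lattice index.\<close>

lemma eventually_near:
  assumes "0 < e"
  shows "\<forall>\<^sub>F n in sequentially. \<forall>i\<in>{- int (k n)..int (k n)}. \<forall>j\<in>{0..int (k n)}. \<forall>q\<in>{-1..1} \<times> {0..1}.
    \<bar>of_int i / real (k n) - fst q\<bar> \<le> 1 / real (k n) \<and> \<bar>of_int j / real (k n) - snd q\<bar> \<le> 1 / real (k n) \<longrightarrow>
    cmod (g n i j - F q) \<le> e"
proof -
  have half: "0 < e / 2" using assms by simp
  obtain d where d: "0 < d" "\<And>p q. p \<in> {-1..1} \<times> {0..1} \<Longrightarrow> q \<in> {-1..1} \<times> {0..1} \<Longrightarrow> dist p q < d \<Longrightarrow> cmod (F p - F q) < e / 2"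
    using F_uniform[OF half] by blast
  show ?thesis using conv[OF half] k_large[of "2 / d"]
  proof eventually_elim
    case (elim n)
    have "2 / real (k n) < d" using elim(2) d(1) k_pos[of n] by (simp add: field_simps)
    show ?case
    proof (intro ballI impI)
      fix i j q
      assume ij: "i \<in> {- int (k n)..int (k n)}" "j \<in> {0..int (k n)}" and q: "q \<in> {-1..1} \<times> {0..1}"
        and near: "\<bar>of_int i / real (k n) - fst q\<bar> \<le> 1 / real (k n) \<and> \<bar>of_int j / real (k n) - snd q\<bar> \<le> 1 / real (k n)"
      let ?p = "(of_int i / real (k n), of_int j / real (k n))"
      have "- int (k n) \<le> i" "i \<le> int (k n)" "j \<le> int (k n)" using ij by auto
      then have "- real (k n) \<le> of_int i" "of_int i \<le> real (k n)" "of_int j \<le> real (k n)" by linarith+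
      then have "?p \<in> {-1..1} \<times> {0..1}" using ij k_pos[of n] by (auto simp: field_simps)
      moreover have "dist ?p q < d"
      proof -
        have "dist ?p q \<le> \<bar>of_int i / real (k n) - fst q\<bar> + \<bar>of_int j / real (k n) - snd q\<bar>"
          unfolding dist_prod_def dist_real_def by (simp add: sqrt_sum_squares_le_sum_abs)
        then show ?thesis using near \<open>2 / real (k n) < d\<close> by linarith
      qed
      ultimately have "cmod (F ?p - F q) < e / 2" using q by (intro d(2))
      moreover have "cmod (g n i j - F ?p) < e / 2" using elim(1) ij unfolding g_def by blast
      ultimately show "cmod (g n i j - F q) \<le> e" by (rule norm_diff_halves)
    qed
  qed
qed

lemma row_sum_limit:
  assumes s: "s \<in> {-1..1}" and t: "t \<in> {0..1}"
  shows "(\<lambda>n. (\<Sum>i\<in>{- int (k n)..<\<lfloor>s * real (k n)\<rfloor>}. g n i \<lfloor>t * real (k n)\<rfloor>) / of_nat (k n))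
    \<longlonglongrightarrow> integral {-1..s} (\<lambda>\<sigma>. F (\<sigma>, t))"
proof -
  have "continuous_on {real_of_int (-1)..1} (\<lambda>\<sigma>. F (\<sigma>, t))"
    using t by (intro continuous_on_compose2[OF F] continuous_intros) auto
  moreover have "\<forall>\<^sub>F n in sequentially. \<forall>i. real_of_int (-1) * real (k n) \<le> of_int i \<and> of_int i \<le> 1 * real (k n) \<longrightarrow>
      cmod (g n i \<lfloor>t * real (k n)\<rfloor> - F (of_int i / real (k n), t)) \<le> e" if "0 < e" for e
    using eventually_near[OF that]
  proof eventually_elim
    case (elim n)
    show ?case
    proof (intro allI impI)
      fix i assume "real_of_int (-1) * real (k n) \<le> of_int i \<and> of_int i \<le> 1 * real (k n)"
      then have i: "i \<in> {- int (k n)..int (k n)}" "(of_int i / real (k n), t) \<in> {-1..1} \<times> {0..1}"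
        using t k_pos[of n] by (auto simp: field_simps)
      define j where "j = \<lfloor>t * real (k n)\<rfloor>"
      have j: "- 1 < real_of_int j" "of_int j \<le> real (k n)" "\<bar>of_int j / real (k n) - t\<bar> \<le> 1 / real (k n)"
        using floor_window[of "real (k n)" t 0 1] k_pos[of n] t unfolding j_def by auto
      then have "j \<in> {0..int (k n)}" by auto
      with elim i j(3) show "cmod (g n i \<lfloor>t * real (k n)\<rfloor> - F (of_int i / real (k n), t)) \<le> e"
        unfolding j_def[symmetric] by fastforce
    qed
  qed
  ultimately show ?thesis
    using lattice_riemann_sum[of "-1" 1 "\<lambda>\<sigma>. F (\<sigma>, t)" s k "\<lambda>n i. g n i \<lfloor>t * real (k n)\<rfloor>"] s k_lim by simp
qed

lemma column_sum_limit:
  assumes s: "s \<in> {-1..1}" and t: "t \<in> {0..1}"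
  shows "(\<lambda>n. (\<Sum>j\<in>{0..<\<lfloor>t * real (k n)\<rfloor>}. g n \<lfloor>s * real (k n)\<rfloor> j) / of_nat (k n))
    \<longlonglongrightarrow> integral {0..t} (\<lambda>\<tau>. F (s, \<tau>))"
proof -
  have "continuous_on {real_of_int 0..1} (\<lambda>\<tau>. F (s, \<tau>))"
    using s by (intro continuous_on_compose2[OF F] continuous_intros) auto
  moreover have "\<forall>\<^sub>F n in sequentially. \<forall>j. real_of_int 0 * real (k n) \<le> of_int j \<and> of_int j \<le> 1 * real (k n) \<longrightarrow>
      cmod (g n \<lfloor>s * real (k n)\<rfloor> j - F (s, of_int j / real (k n))) \<le> e" if "0 < e" for e
    using eventually_near[OF that]
  proof eventually_elim
    case (elim n)
    show ?case
    proof (intro allI impI)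
      fix j assume "real_of_int 0 * real (k n) \<le> of_int j \<and> of_int j \<le> 1 * real (k n)"
      then have j: "j \<in> {0..int (k n)}" "(s, of_int j / real (k n)) \<in> {-1..1} \<times> {0..1}"
        using s k_pos[of n] by (auto simp: field_simps)
      define i where "i = \<lfloor>s * real (k n)\<rfloor>"
      have i: "- real (k n) - 1 < real_of_int i" "of_int i \<le> real (k n)" "\<bar>of_int i / real (k n) - s\<bar> \<le> 1 / real (k n)"
        using floor_window[of "real (k n)" s "-1" 1] k_pos[of n] s unfolding i_def by auto
      then have "i \<in> {- int (k n)..int (k n)}" by auto
      with elim j i(3) show "cmod (g n \<lfloor>s * real (k n)\<rfloor> j - F (s, of_int j / real (k n))) \<le> e"
        unfolding i_def[symmetric] by fastforce
    qed
  qed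
  ultimately show ?thesis
    using lattice_riemann_sum[of 0 1 "\<lambda>\<tau>. F (s, \<tau>)" t k "\<lambda>n j. g n \<lfloor>s * real (k n)\<rfloor> j"] t k_lim by simp
qed

text \<open>A discrete Morera condition. The boundary sum \<open>B n\<close> equals, by telescoping,
  \<open>- 1 / k^2\<close> times the sum of \<open>dbar_up\<close> over O(k^2) cells. The squared
  defects sum to O(k), so Cauchy-Schwarz gives \<open>B n\<close> = O(1 / sqrt k), while its Riemann
  sums converge to the integrals.\<close>

lemma closed_form:
  assumes s: "s \<in> {-1..1}" and t: "t \<in> {0..1}"
  shows "integral {-1..s} (\<lambda>\<sigma>. F (\<sigma>, 0)) - integral {-1..s} (\<lambda>\<sigma>. F (\<sigma>, t)) +
      zeta * (integral {0..t} (\<lambda>\<tau>. F (s, \<tau>)) - integral {0..t} (\<lambda>\<tau>. F (-1, \<tau>))) = 0"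
proof -
  define B where "B n = (\<Sum>i\<in>{- int (k n)..<\<lfloor>s * real (k n)\<rfloor>}. g n i 0) / of_nat (k n)
    - (\<Sum>i\<in>{- int (k n)..<\<lfloor>s * real (k n)\<rfloor>}. g n i \<lfloor>t * real (k n)\<rfloor>) / of_nat (k n)
    + zeta * ((\<Sum>j\<in>{0..<\<lfloor>t * real (k n)\<rfloor>}. g n \<lfloor>s * real (k n)\<rfloor> j) / of_nat (k n)
      - (\<Sum>j\<in>{0..<\<lfloor>t * real (k n)\<rfloor>}. g n (- int (k n)) j) / of_nat (k n))" for n
  have lim: "B \<longlonglongrightarrow> integral {-1..s} (\<lambda>\<sigma>. F (\<sigma>, 0)) - integral {-1..s} (\<lambda>\<sigma>. F (\<sigma>, t)) +
      zeta * (integral {0..t} (\<lambda>\<tau>. F (s, \<tau>)) - integral {0..t} (\<lambda>\<tau>. F (-1, \<tau>)))"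
  proof -
    have floor_neg: "\<lfloor>- 1 * real (k n)\<rfloor> = - int (k n)" for n by (simp add: floor_eq_iff)
    have row0: "(\<lambda>n. (\<Sum>i\<in>{- int (k n)..<\<lfloor>s * real (k n)\<rfloor>}. g n i 0) / of_nat (k n)) \<longlonglongrightarrow> integral {-1..s} (\<lambda>\<sigma>. F (\<sigma>, 0))"
      using row_sum_limit[OF s, of 0] by simp
    have column0: "(\<lambda>n. (\<Sum>j\<in>{0..<\<lfloor>t * real (k n)\<rfloor>}. g n (- int (k n)) j) / of_nat (k n)) \<longlonglongrightarrow> integral {0..t} (\<lambda>\<tau>. F (-1, \<tau>))"
      using column_sum_limit[of "-1", OF _ t] unfolding floor_neg by simp
    show ?thesis
      unfolding B_def
      by (intro tendsto_add tendsto_diff tendsto_mult tendsto_const row0 column0 row_sum_limit column_sum_limit s t)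
  qed
  have bound: "cmod (B n) \<le> sqrt ((192 * C + 64) / real (k n))" for n
  proof -
    define kn where "kn = real (k n)"
    define i1 j1 where "i1 = \<lfloor>s * kn\<rfloor>" and "j1 = \<lfloor>t * kn\<rfloor>"
    have "0 < kn" using k_pos by (simp add: kn_def)
    then have "- kn - 1 < of_int i1" "of_int i1 \<le> kn" "- 1 < real_of_int j1" "of_int j1 \<le> kn"
      using floor_window[of kn s "-1" 1] floor_window[of kn t 0 1] s t unfolding i1_def j1_def by auto
    then have ij: "- int (k n) \<le> i1" "i1 \<le> int (k n)" "0 \<le> j1" "j1 \<le> int (k n)"
      unfolding kn_def by linarith+
    let ?A = "{- int (k n)..<i1} \<times> {0..<j1}"
    have sub: "?A \<subseteq> {- int (k n)..<int (k n)} \<times> {0..<int (k n)}" using ij by auto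
    have "(\<Sum>(i, j)\<in>?A. (U n i j - U n i (j + 1)) + (zeta * U n (i + 1) j - zeta * U n i j)) =
      (\<Sum>i\<in>{- int (k n)..<i1}. U n i 0 - U n i j1) + (\<Sum>j\<in>{0..<j1}. zeta * U n i1 j - zeta * U n (- int (k n)) j)"
      by (rule sum_cells_eq_boundary[OF ij(1,3)])
    also have "\<dots> = (of_real kn)\<^sup>2 * B n"
    proof -
      have "of_real kn * g n i j = U n i j - U n 0 0" for i j
        using \<open>0 < kn\<close> unfolding g_def kn_def by simp
      then have diff: "of_real kn * (g n i j - g n i' j') = U n i j - U n i' j'" for i j i' j'
        by (simp add: right_diff_distrib)
      have "(of_real kn)\<^sup>2 * B n = of_real kn * ((\<Sum>i\<in>{- int (k n)..<i1}. g n i 0 - g n i j1) +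
          zeta * (\<Sum>j\<in>{0..<j1}. g n i1 j - g n (- int (k n)) j))"
        using \<open>0 < kn\<close> unfolding B_def i1_def j1_def kn_def sum_subtractf by (simp add: power2_eq_square field_simps)
      also have "\<dots> = (\<Sum>i\<in>{- int (k n)..<i1}. of_real kn * (g n i 0 - g n i j1)) +
          (\<Sum>j\<in>{0..<j1}. zeta * (of_real kn * (g n i1 j - g n (- int (k n)) j)))"
        by (simp add: sum_distrib_left distrib_left mult.left_commute)
      finally have "(of_real kn)\<^sup>2 * B n = (\<Sum>i\<in>{- int (k n)..<i1}. U n i 0 - U n i j1) +
          (\<Sum>j\<in>{0..<j1}. zeta * (U n i1 j - U n (- int (k n)) j))" unfolding diff .
      then show ?thesis by (simp only: right_diff_distrib)
    qed
    finally have cells: "(\<Sum>(i, j)\<in>?A. (U n i j - U n i (j + 1)) + (zeta * U n (i + 1) j - zeta * U n i j)) = (of_real kn)\<^sup>2 * B n" .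
    have "kn\<^sup>2 * cmod (B n) = cmod ((of_real kn)\<^sup>2 * B n)"
      by (simp add: norm_mult norm_power)
    also have "\<dots> = cmod (\<Sum>(i, j)\<in>?A. - dbar_up (U n) i j)"
      unfolding cells[symmetric] by (simp add: dbar_up_def algebra_simps case_prod_unfold)
    also have "\<dots> \<le> (\<Sum>(i, j)\<in>?A. \<bar>cmod (dbar_up (U n) i j)\<bar>)"
      using norm_sum[of "\<lambda>(i, j). - dbar_up (U n) i j" ?A] by (simp add: case_prod_unfold)
    also have "\<dots> \<le> sqrt (real (card ?A) * ((96 * C + 32) * kn))"
    proof -
      have "(\<Sum>(i, j)\<in>?A. (cmod (dbar_up (U n) i j))\<^sup>2) \<le> (\<Sum>(i, j)\<in>?A. (cmod (dbar_up (U n) i j))\<^sup>2 + (cmod (dbar_down (U n) i j))\<^sup>2)"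
        by (intro sum_mono) auto
      also have "\<dots> \<le> 96 * window_energy lam (U n) (k n) + 32 * real (k n)"
        using lam by (intro dbar_sum_le[OF _ _ orient sub]) auto
      also have "\<dots> \<le> (96 * C + 32) * kn" using energy[of n] unfolding kn_def distrib_right by linarith
      finally show ?thesis
        using sum_abs_le_sqrt[of ?A "\<lambda>(i, j). cmod (dbar_up (U n) i j)"] by (simp add: case_prod_unfold)
    qed
    also have "\<dots> \<le> sqrt ((2 * kn\<^sup>2) * ((96 * C + 32) * kn))"
    proof (intro real_sqrt_le_mono mult_right_mono)
      have "real (card ?A) = of_int (i1 + int (k n)) * of_int j1" using ij by simp
      also have "\<dots> \<le> (2 * kn) * kn"
      proof (rule mult_mono)
        show "of_int (i1 + int (k n)) \<le> 2 * kn" "of_int j1 \<le> kn" using ij unfolding kn_def by linarith+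
      qed (use ij \<open>0 < kn\<close> in auto)
      finally show "real (card ?A) \<le> 2 * kn\<^sup>2" by (simp add: power2_eq_square)
    qed (use C \<open>0 < kn\<close> in auto)
    also have "(2 * kn\<^sup>2) * ((96 * C + 32) * kn) = (kn\<^sup>2)\<^sup>2 * ((192 * C + 64) / kn)"
      using \<open>0 < kn\<close> by (simp add: power2_eq_square field_simps)
    also have "sqrt \<dots> = kn\<^sup>2 * sqrt ((192 * C + 64) / kn)"
      by (simp only: real_sqrt_mult real_sqrt_abs abs_power2)
    finally have "kn\<^sup>2 * cmod (B n) \<le> kn\<^sup>2 * sqrt ((192 * C + 64) / kn)" .
    moreover have "0 < kn\<^sup>2" using \<open>0 < kn\<close> by simp
    ultimately show ?thesis unfolding kn_def by (rule mult_left_le_imp_le)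
  qed
  have "(\<lambda>n. sqrt ((192 * C + 64) / real (k n))) \<longlonglongrightarrow> sqrt 0"
    by (intro tendsto_intros tendsto_divide_0[OF tendsto_const] filterlim_at_top_imp_at_infinity
        filterlim_compose[OF filterlim_real_sequentially k_lim])
  then have "B \<longlonglongrightarrow> 0"
    using bound by (intro Lim_null_comparison[of B]) auto
  then show ?thesis using lim by (rule LIMSEQ_unique[symmetric])
qed

lemma holomorphic: "(\<lambda>z. F (oblique z)) holomorphic_on rhombi"
  using F closed_form by (rule holomorphic_of_closed_form)


text \<open>The slope estimate is applied to a rhombus of side about \<open>h * k n\<close> at
  \<open>z\<close>, with the tangent of the limit as affine map. For fixed \<open>h\<close> a large
  \<open>k n\<close> suppresses the energy term, and the area term leaves \<open>D * sqrt h\<close>,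
  where \<open>h\<close> may tend to 0.\<close>

lemma deriv_modulus:
  assumes z: "z \<in> rhombi"
    and side: "fst (oblique z) < 0 \<and> m = 1 \<or> 0 < fst (oblique z) \<and> m = lam"
  shows "cmod (deriv (\<lambda>z. F (oblique z)) z) = m"
proof -
  define f where "f z = F (oblique z)" for z
  define c where "c = deriv f z"
  obtain s t where st: "oblique z = (s, t)" by (cases "oblique z")
  have s: "-1 < s" "s < 1" "s \<noteq> 0" and t: "0 < t" "t < 1" using z side unfolding rhombi_def mem_Collect_eq st by auto
  have "\<exists>r B. 0 < r \<and> 0 \<le> B \<and> cball z r \<subseteq> rhombi \<and>
      (\<forall>y\<in>cball z r. cmod (f y - f z - c * (y - z)) \<le> B * (cmod (y - z))\<^sup>2)"
    unfolding c_def by (rule holomorphic_quadratic_remainder[OF holomorphic[folded f_def] open_rhombi z]) blast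
  then obtain r B where rB: "0 < r" "0 \<le> B"
    "\<And>y. y \<in> cball z r \<Longrightarrow> cmod (f y - f z - c * (y - z)) \<le> B * (cmod (y - z))\<^sup>2"
    by blast
  define L where "L = 1 + cmod c + sqrt C"
  \<comment> \<open>The lower bound \<open>h * kn / 2\<close> for the side contributes a factor 4 to
    the coefficients 1 and 20 of the two error terms; \<open>L\<close> bounds the boundary length
    divided by \<open>sqrt h * kn\<close>.\<close>
  define D where "D = 4 + 80 * (1 + 4 * B) * L"
  have L: "1 \<le> L" using C unfolding L_def by simp
  have z_eq: "z = of_real s + of_real t * zeta" using oblique_inverse[of z] by (simp add: st)
  \<comment> \<open>Keeps the rhombus inside the domain, on one side of the interface and in the
    disc of the Taylor estimate; the halves leave room for rounding and for
    \<open>cmod (y - z) \<le> 2 * h\<close>.\<close>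
  define h0 where "h0 = min (min (1/2) (r / 2)) (min (\<bar>s\<bar> / 2) (min ((1 - \<bar>s\<bar>) / 2) (min (t / 2) ((1 - t) / 2))))"
  have h0: "0 < h0" unfolding h0_def using rB(1) s t by (auto simp: abs_if)
  have estimate: "(cmod c - m)\<^sup>2 \<le> D * sqrt h" if h: "0 < h" "h \<le> h0" for h
  proof -
    have h_le: "h \<le> 1" "2 * h \<le> r" "2 * h \<le> \<bar>s\<bar>" "2 * h \<le> 1 - \<bar>s\<bar>" "2 * h \<le> t" "2 * h \<le> 1 - t"
      using h unfolding h0_def by auto
    \<comment> \<open>The first bound gives \<open>h * kn > 2\<close>, so rounding at most halves
      the side; the second makes the energy term at most \<open>h^2 * sqrt h * kn^2\<close>.\<close>
    define K where "K = max (2 / h) ((258 * C + 86) / (h\<^sup>2 * sqrt h))"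
    have "0 < h\<^sup>2" using h by simp
    then have "\<forall>\<^sub>F n in sequentially. K < real (k n) \<and> (\<forall>i\<in>{- int (k n)..int (k n)}. \<forall>j\<in>{0..int (k n)}.
        cmod ((U n i j - U n 0 0) / of_nat (k n) - F (of_int i / real (k n), of_int j / real (k n))) < h\<^sup>2)"
      by (intro eventually_conj k_large conv)
    then obtain n where n: "K < real (k n)" "\<And>i j. i \<in> {- int (k n)..int (k n)} \<Longrightarrow> j \<in> {0..int (k n)} \<Longrightarrow>
        cmod ((U n i j - U n 0 0) / of_nat (k n) - F (of_int i / real (k n), of_int j / real (k n))) < h\<^sup>2"
      by (auto dest: eventually_happens)
    define kn where "kn = real (k n)"
    have "0 < kn" using k_pos unfolding kn_def by simp
    have K: "2 / h < kn" "(258 * C + 86) / (h\<^sup>2 * sqrt h) < kn" using n(1) unfolding K_def kn_def by auto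
    have big: "2 < h * kn" using K(1) h by (simp add: pos_divide_less_eq mult.commute)
    define N i0 j0 where "N = \<lfloor>h * kn\<rfloor>" and "i0 = \<lfloor>s * kn\<rfloor>" and "j0 = \<lfloor>t * kn\<rfloor>"
    have N: "of_int N \<le> h * kn" "h * kn / 2 \<le> of_int N" "0 \<le> N"
      using big unfolding N_def by linarith+
    have i0: "of_int i0 \<le> s * kn" "s * kn - 1 < of_int i0" unfolding i0_def by linarith+
    have j0: "of_int j0 \<le> t * kn" "t * kn - 1 < of_int j0" unfolding j0_def by linarith+
    have scaled: "2 * (h * kn) \<le> \<bar>s\<bar> * kn" "2 * (h * kn) \<le> kn - \<bar>s\<bar> * kn" "2 * (h * kn) \<le> t * kn" "2 * (h * kn) \<le> kn - t * kn"
      using mult_right_mono[OF h_le(3), of kn] mult_right_mono[OF h_le(4), of kn]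
        mult_right_mono[OF h_le(5), of kn] mult_right_mono[OF h_le(6), of kn] \<open>0 < kn\<close>
      by (simp_all add: algebra_simps)
    have s_abs: "- (\<bar>s\<bar> * kn) \<le> s * kn" "s * kn \<le> \<bar>s\<bar> * kn"
      using \<open>0 < kn\<close> mult_right_mono[of "- \<bar>s\<bar>" s kn] mult_right_mono[of s "\<bar>s\<bar>" kn] by auto
    have window_real: "- kn \<le> of_int i0" "of_int i0 + of_int N \<le> kn" "0 \<le> real_of_int j0" "of_int j0 + of_int N \<le> kn"
      using N i0 j0 scaled s_abs big by linarith+
    then have window: "- int (k n) \<le> i0" "i0 + N \<le> int (k n)" "0 \<le> j0" "j0 + N \<le> int (k n)"
      unfolding kn_def by linarith+
    have bond: "bond_length lam i = m" if i: "i \<in> {i0..<i0 + N}" for i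
    proof (cases "s < 0")
      case True
      then have "of_int i0 + of_int N < (0 :: real)" using N i0 scaled(1) big by (simp add: abs_if)
      then have "i0 + N < 0" by linarith
      then have "i < 0" using i by auto
      then show ?thesis using True side by (auto simp: bond_length_def st)
    next
      case False
      then have "0 < real_of_int i0" using i0 scaled(1) big by (simp add: abs_if)
      then have "0 \<le> i" using i by auto
      then show ?thesis using False side by (auto simp: bond_length_def st)
    qed
    define w where "w = U n 0 0 + of_real kn * f z - c * of_real kn * z"
    \<comment> \<open>One \<open>h^2\<close> is the error of uniform convergence, and
      \<open>4 * B * h^2\<close> is the Taylor remainder at distance at most
      \<open>2 * h\<close>.\<close>
    have V: "cmod (U n i j - (w + c * (of_int i + of_int j * zeta))) \<le> (1 + 4 * B) * h\<^sup>2 * kn"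
      if i: "i \<in> {i0..i0 + N}" and j: "j \<in> {j0..j0 + N}" for i j
    proof -
      have ij: "i \<in> {- int (k n)..int (k n)}" "j \<in> {0..int (k n)}" using i j window by auto
      define y where "y = of_real (of_int i / kn) + of_real (of_int j / kn) * zeta"
      have "of_int i0 \<le> real_of_int i" "real_of_int i \<le> of_int i0 + of_int N"
         "of_int j0 \<le> real_of_int j" "real_of_int j \<le> of_int j0 + of_int N" using i j by auto
      then have "\<bar>of_int i - s * kn\<bar> \<le> h * kn" "\<bar>of_int j - t * kn\<bar> \<le> h * kn"
        using i0 j0 N big by (auto simp: abs_le_iff)
      moreover have "of_int i / kn - s = (of_int i - s * kn) / kn" "of_int j / kn - t = (of_int j - t * kn) / kn"
        using \<open>0 < kn\<close> by (simp_all add: field_simps)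
      ultimately have near: "\<bar>of_int i / kn - s\<bar> \<le> h" "\<bar>of_int j / kn - t\<bar> \<le> h"
        using \<open>0 < kn\<close> by (simp_all add: abs_divide pos_divide_le_eq)
      have yz: "y - z = of_real (of_int i / kn - s) + of_real (of_int j / kn - t) * zeta"
        unfolding y_def z_eq by (simp add: algebra_simps)
      have "cmod (y - z) \<le> \<bar>of_int i / kn - s\<bar> + \<bar>of_int j / kn - t\<bar>"
        unfolding yz by (rule order.trans[OF norm_triangle_ineq]) (simp add: norm_mult del: of_real_diff of_real_divide)
      then have yz_le: "cmod (y - z) \<le> 2 * h" using near by linarith
      then have "y \<in> cball z r" using h_le(2) by (simp add: dist_norm norm_minus_commute)
      then have "cmod (f y - f z - c * (y - z)) \<le> B * (cmod (y - z))\<^sup>2" by (rule rB(3))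
      also have "\<dots> \<le> B * (2 * h)\<^sup>2" using yz_le rB(2) by (intro mult_left_mono power_mono) auto
      finally have taylor: "cmod (f y - f z - c * (y - z)) \<le> 4 * B * h\<^sup>2" by (simp add: power_mult_distrib)
      have "f y = F (of_int i / kn, of_int j / kn)" unfolding f_def y_def by (simp only: oblique_combination)
      then have "cmod ((U n i j - U n 0 0) / of_real kn - f y) \<le> h\<^sup>2"
        using n(2)[OF ij] unfolding kn_def by simp
      then have "cmod (((U n i j - U n 0 0) / of_real kn - f y) + (f y - f z - c * (y - z))) \<le> h\<^sup>2 + 4 * B * h\<^sup>2"
        using taylor by (rule norm_triangle_mono)
      moreover have "of_real kn * (((U n i j - U n 0 0) / of_real kn - f y) + (f y - f z - c * (y - z))) =
        U n i j - (w + c * (of_int i + of_int j * zeta))"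
        using \<open>0 < kn\<close> unfolding w_def y_def by (simp add: field_simps)
      then have "cmod (U n i j - (w + c * (of_int i + of_int j * zeta))) =
        kn * cmod (((U n i j - U n 0 0) / of_real kn - f y) + (f y - f z - c * (y - z)))"
        using \<open>0 < kn\<close> by (metis norm_mult norm_of_real abs_of_pos)
      ultimately have "cmod (U n i j - (w + c * (of_int i + of_int j * zeta))) \<le> kn * (h\<^sup>2 + 4 * B * h\<^sup>2)"
        using \<open>0 < kn\<close> by simp
      then show ?thesis by (simp add: algebra_simps)
    qed
    have main: "(of_int N)\<^sup>2 * (cmod c - m)\<^sup>2 \<le> (258 * C + 86) * kn +
      20 * ((1 + 4 * B) * h\<^sup>2 * kn) * (of_int N * (1 + cmod c) + sqrt (of_int N * (C * kn)))"
      using rhombus_slope_estimate[OF lam(1) _ C orient energy window N(3) bond V] lam(2) unfolding kn_def by simp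
    have sqrt_h: "0 < sqrt h" "h \<le> sqrt h"
      using h h_le(1) by (auto intro!: real_le_rsqrt simp: power2_eq_square mult_left_le)
    have "of_int N * (1 + cmod c) + sqrt (of_int N * (C * kn)) \<le> sqrt h * kn * L"
    proof -
      have "of_int N \<le> sqrt h * kn" using N(1) mult_right_mono[OF sqrt_h(2), of kn] \<open>0 < kn\<close> by linarith
      then have "of_int N * (1 + cmod c) \<le> sqrt h * kn * (1 + cmod c)" by (rule mult_right_mono) simp
      moreover have "of_int N * (C * kn) \<le> h * kn * (C * kn)" using N(1) C \<open>0 < kn\<close> by (intro mult_right_mono) auto
      then have "sqrt (of_int N * (C * kn)) \<le> sqrt (h * C * kn\<^sup>2)"
        by (intro real_sqrt_le_mono) (simp add: power2_eq_square mult_ac)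
      then have "sqrt (of_int N * (C * kn)) \<le> sqrt h * sqrt C * kn"
        using \<open>0 < kn\<close> by (simp add: real_sqrt_mult)
      ultimately show ?thesis unfolding L_def by (simp add: algebra_simps)
    qed
    then have "20 * ((1 + 4 * B) * h\<^sup>2 * kn) * (of_int N * (1 + cmod c) + sqrt (of_int N * (C * kn))) \<le>
      20 * ((1 + 4 * B) * h\<^sup>2 * kn) * (sqrt h * kn * L)"
      using rB(2) \<open>0 < kn\<close> by (intro mult_left_mono) auto
    moreover have "(258 * C + 86) * kn \<le> h\<^sup>2 * sqrt h * kn * kn"
    proof -
      have "258 * C + 86 \<le> kn * (h\<^sup>2 * sqrt h)"
        using K(2) h sqrt_h by (simp add: pos_divide_less_eq)
      then have "(258 * C + 86) * kn \<le> kn * (h\<^sup>2 * sqrt h) * kn" using \<open>0 < kn\<close> by (intro mult_right_mono) auto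
      then show ?thesis by (simp add: mult_ac)
    qed
    ultimately have "(of_int N)\<^sup>2 * (cmod c - m)\<^sup>2 \<le> h\<^sup>2 * sqrt h * kn * kn + 20 * ((1 + 4 * B) * h\<^sup>2 * kn) * (sqrt h * kn * L)"
      using main by linarith
    also have "\<dots> = (h * kn / 2)\<^sup>2 * (D * sqrt h)" unfolding D_def by (simp add: power2_eq_square field_simps)
    finally have upper: "(of_int N)\<^sup>2 * (cmod c - m)\<^sup>2 \<le> (h * kn / 2)\<^sup>2 * (D * sqrt h)" .
    have "(h * kn / 2)\<^sup>2 \<le> (of_int N)\<^sup>2" using N(2) h \<open>0 < kn\<close> by (intro power_mono) auto
    then have "(h * kn / 2)\<^sup>2 * (cmod c - m)\<^sup>2 \<le> (of_int N)\<^sup>2 * (cmod c - m)\<^sup>2" by (rule mult_right_mono) simp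
    then have "(h * kn / 2)\<^sup>2 * (cmod c - m)\<^sup>2 \<le> (h * kn / 2)\<^sup>2 * (D * sqrt h)" using upper by linarith
    moreover have "0 < (h * kn / 2)\<^sup>2" using h \<open>0 < kn\<close> by simp
    ultimately show ?thesis by (rule mult_left_le_imp_le)
  qed
  have "((\<lambda>h. D * sqrt h) \<longlongrightarrow> D * sqrt 0) (at_right 0)"
    by (intro tendsto_intros)
  moreover have "\<forall>\<^sub>F h in at_right 0. (cmod c - m)\<^sup>2 \<le> D * sqrt h"
    using eventually_at_right_less[of "0 :: real"] eventually_at_right_real[OF h0]
    by eventually_elim (use estimate in auto)
  ultimately have "(cmod c - m)\<^sup>2 \<le> D * sqrt 0"
    by (intro tendsto_lowerbound[of "\<lambda>h. D * sqrt h"]) auto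
  then show ?thesis by (simp add: c_def f_def[abs_def])
qed

lemma contradiction: False
proof -
  define h where "h z = cmod (deriv (\<lambda>z. F (oblique z)) z)" for z
  \<comment> \<open>A segment in direction \<open>w1\<close> at half height, crossing the interface
    at \<open>s = 0\<close>; the two one-sided limits of \<open>h\<close> along it disagree.\<close>
  define p where "p s = of_real s + of_real (1 / 2) * zeta" for s
  have p: "oblique (p s) = (s, 1 / 2)" for s unfolding p_def by (rule oblique_combination)
  have p_mem: "p s \<in> rhombi" if "- 1 < s" "s < 1" for s using that by (simp add: rhombi_def p)
  have "deriv (\<lambda>z. F (oblique z)) holomorphic_on rhombi"
    using holomorphic open_rhombi by (rule holomorphic_deriv)
  then have "isCont (deriv (\<lambda>z. F (oblique z))) (p 0)"
    using holomorphic_on_imp_continuous_on continuous_on_eq_continuous_at[OF open_rhombi] p_mem[of 0] by auto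
  moreover have "isCont p 0" unfolding p_def by (intro continuous_intros)
  ultimately have "isCont (\<lambda>s. deriv (\<lambda>z. F (oblique z)) (p s)) 0"
    using isCont_o2[where f = p and g = "deriv (\<lambda>z. F (oblique z))" and a = 0] by blast
  then have "isCont (\<lambda>s. h (p s)) 0"
    unfolding h_def by (rule isCont_norm)
  then have lim: "((\<lambda>s. h (p s)) \<longlongrightarrow> h (p 0)) (at 0)" by (simp add: isCont_def)
  have "\<forall>\<^sub>F s in at_left 0. h (p s) = 1"
    using eventually_at_left_real[of "-1" 0] by (auto elim!: eventually_mono simp: h_def p p_mem deriv_modulus)
  then have "((\<lambda>s. h (p s)) \<longlongrightarrow> 1) (at_left 0)" by (rule tendsto_eventually)
  moreover have "\<forall>\<^sub>F s in at_right 0. h (p s) = lam"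
    using eventually_at_right_real[of 0 1] by (auto elim!: eventually_mono simp: h_def p p_mem deriv_modulus)
  then have "((\<lambda>s. h (p s)) \<longlongrightarrow> lam) (at_right 0)" by (rule tendsto_eventually)
  moreover have "((\<lambda>s. h (p s)) \<longlongrightarrow> h (p 0)) (at_left 0)" "((\<lambda>s. h (p s)) \<longlongrightarrow> h (p 0)) (at_right 0)"
    using lim by (auto intro: filterlim_mono at_le)
  ultimately have "h (p 0) = 1" "h (p 0) = lam"
    using tendsto_unique[OF trivial_limit_at_left_real] tendsto_unique[OF trivial_limit_at_right_real] by blast+
  then show False using lam by simp
qed

end

text \<open>Proved by compactness, so \<open>K\<close> depends on \<open>C\<close> in a non-explicit
  way; \<open>C\<close> is arbitrary, so the energy per row is eventually above any bound.\<close>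

lemma window_energy_superlinear:
  assumes lam: "0 < lam" "lam < 1" and C: "0 \<le> C"
  shows "\<exists>K. \<forall>k\<ge>K. \<forall>U. orientation_preserving U k \<longrightarrow> C * real k < window_energy lam U k"
proof (rule ccontr)
  assume "\<not> ?thesis"
  then have "\<forall>n. \<exists>k U. Suc n \<le> k \<and> orientation_preserving U k \<and> window_energy lam U k \<le> C * real k"
    unfolding not_ex not_all not_imp not_less by blast
  then have "\<exists>k. \<forall>n. \<exists>U. Suc n \<le> k n \<and> orientation_preserving U (k n) \<and> window_energy lam U (k n) \<le> C * real (k n)"
    by (rule choice)
  then obtain k where "\<forall>n. \<exists>U. Suc n \<le> k n \<and> orientation_preserving U (k n) \<and> window_energy lam U (k n) \<le> C * real (k n)" ..
  then have "\<exists>U. \<forall>n. Suc n \<le> k n \<and> orientation_preserving (U n) (k n) \<and> window_energy lam (U n) (k n) \<le> C * real (k n)"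
    by (rule choice)
  then obtain U where kU: "\<And>n. Suc n \<le> k n" "\<And>n. orientation_preserving (U n) (k n)"
    "\<And>n. window_energy lam (U n) (k n) \<le> C * real (k n)"
    by blast
  have pos: "0 < k n" for n using kU(1)[of n] by simp
  define g where "g n i j = (U n i j - U n 0 0) / of_nat (k n)" for n i j
  obtain F r where F: "continuous_on ({-1..1} \<times> {0..1}) F" "strict_mono (r :: nat \<Rightarrow> nat)"
    "\<And>e. 0 < e \<Longrightarrow> \<exists>N. \<forall>n\<ge>N. \<forall>i\<in>{- int (k (r n))..int (k (r n))}. \<forall>j\<in>{0..int (k (r n))}.
        cmod (g (r n) i j - F (of_int i / real (k (r n)), of_int j / real (k (r n)))) < e"
  proof (rule lattice_functions_subconverge[OF C, of g k])
    show "g n 0 0 = 0" for n by (simp add: g_def)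
    fix n i i' j j'
    assume ij: "i \<in> {- int (k n)..int (k n)}" "i' \<in> {- int (k n)..int (k n)}" "j \<in> {0..int (k n)}" "j' \<in> {0..int (k n)}"
    have "cmod (g n i' j' - g n i j) = cmod (U n i' j' - U n i j) / real (k n)"
      unfolding g_def diff_divide_distrib[symmetric] by (simp add: norm_divide)
    then show "cmod (g n i' j' - g n i j) \<le>
      \<bar>of_int i' - of_int i\<bar> / real (k n) + sqrt (C * (\<bar>of_int i' - of_int i\<bar> / real (k n))) +
      (\<bar>of_int j' - of_int j\<bar> / real (k n) + sqrt (C * (\<bar>of_int j' - of_int j\<bar> / real (k n))))"
      using lattice_holder[OF lam(1) _ kU(3) pos ij] lam(2) by simp
  qed blast
  have "lattice_limit lam C (U \<circ> r) (k \<circ> r) F"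
  proof
    show "filterlim (k \<circ> r) at_top sequentially"
    proof (rule filterlim_at_top_mono[OF filterlim_ident always_eventually])
      show "\<forall>n. n \<le> (k \<circ> r) n"
        using kU(1) seq_suble[OF F(2)] by (metis comp_apply Suc_leD order.trans)
    qed
    show "\<forall>\<^sub>F n in sequentially. \<forall>i\<in>{- int ((k \<circ> r) n)..int ((k \<circ> r) n)}. \<forall>j\<in>{0..int ((k \<circ> r) n)}.
        cmod (((U \<circ> r) n i j - (U \<circ> r) n 0 0) / of_nat ((k \<circ> r) n) - F (of_int i / real ((k \<circ> r) n), of_int j / real ((k \<circ> r) n))) < e"
      if "0 < e" for e
      using F(3)[OF that] unfolding eventually_sequentially comp_def g_def .
  qed (simp_all add: lam C pos kU F(1))
  then show False by (rule lattice_limit.contradiction)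
qed

subsection \<open>Comparison of the two costs\<close>

lemma transition_cost_unit_ge:
  assumes "1 \<le> k" and x: "0 \<le> x"
    and lower: "\<And>U. orientation_preserving U k \<Longrightarrow> 6 * x \<le> window_energy lam U k"
  shows "ennreal x \<le> transition_cost lam 1 k"
  unfolding transition_cost_def
proof (rule Inf_greatest, clarify)
  fix v assume "v \<in> admissible 1 k"
  then have "orientation_preserving (lattice_map v) k"
    using assms(1) by (rule lattice_map_orientation_preserving)
  then have "ennreal (6 * x) \<le> ennreal (window_energy lam (lattice_map v) k)"
    using lower by (intro ennreal_leI)
  also have "\<dots> \<le> 6 * energy lam v 1 k" using assms(1) by (rule window_energy_le_energy)
  finally have "6 * ennreal x \<le> 6 * energy lam v 1 k" using x by (simp add: ennreal_mult)
  then show "ennreal x \<le> energy lam v 1 k"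
    by (subst (asm) ennreal_mult_le_mult_iff) auto
qed

theorem corollary2p8:
  fixes lam :: real
  assumes "0 < lam" and "lam < 1"
  shows "\<exists>K. \<forall>k\<ge>K. transition_cost lam 1 k > (INF \<rho>\<in>{0<..1}. transition_cost lam \<rho> k)"
proof -
  obtain C where C: "0 < C" "\<And>k. (INF \<rho>\<in>{0<..1}. transition_cost lam \<rho> k) \<le> ennreal (C * (real k + 1))"
    using transition_cost_matched_le[OF assms] by blast
  \<comment> \<open>The factor 6 converts window energy into energy, and \<open>2 * C + 1\<close> is
    chosen so that \<open>(2 * C + 1) * k\<close> exceeds \<open>C * (k + 1)\<close> for all
    \<open>k \<ge> 1\<close>.\<close>
  obtain K where K: "\<And>k U. K \<le> k \<Longrightarrow> orientation_preserving U k \<Longrightarrow> 6 * (2 * C + 1) * real k < window_energy lam U k"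
    using window_energy_superlinear[OF assms, of "6 * (2 * C + 1)"] C(1) by auto
  show ?thesis
  proof (intro exI[of _ "max K 1"] allI impI)
    fix k assume "max K 1 \<le> k"
    then have k: "K \<le> k" "1 \<le> k" by auto
    have "C * (real k + 1) < (2 * C + 1) * real k"
    proof -
      have "C * 1 \<le> C * real k" using C(1) k(2) by (intro mult_left_mono) auto
      then show ?thesis using k(2) by (simp add: algebra_simps)
    qed
    then have "ennreal (C * (real k + 1)) < ennreal ((2 * C + 1) * real k)"
      using C(1) k(2) by (intro ennreal_lessI mult_pos_pos) auto
    also have "\<dots> \<le> transition_cost lam 1 k"
    proof (rule transition_cost_unit_ge[OF k(2)])
      show "6 * ((2 * C + 1) * real k) \<le> window_energy lam U k" if "orientation_preserving U k" for U
        using K[OF k(1) that] by (metis mult.assoc less_imp_le)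
    qed (use C(1) in auto)
    finally show "transition_cost lam 1 k > (INF \<rho>\<in>{0<..1}. transition_cost lam \<rho> k)"
      using C(2) by (rule le_less_trans[rotated])
  qed
qed

end
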